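(* Let $Q$ be a quiver which is a disjoint union of quivers $Q^1,\ldots,Q^r$. Let $(\mathbf{u},Q)$ be a seed, and let $(\mathbf{u}^1,Q^1),\ldots,(\mathbf{u}^r,Q^r)$ be the seeds corresponding to the decomposition of $Q$ (that is, $\mathbf{u}^i$ consists of the variables of $\mathbf{u}$ indexed by the vertices of $Q^i$, and $(\mathbf{u}^i,Q^i)$ is a seed in the field $\mathbb{Q}(\mathbf{u}^i)$). Then the cluster algebra $\mathscr{A}(\mathbf{u},Q)$ is unistructural if and only if the cluster algebra $\mathscr{A}(\mathbf{u}^i,Q^i)$ is unistructural for all $i\in\{1,\ldots,r\}$.
   Context: **Quivers and mutation.** A quiver $Q$ is an oriented graph (multiple arrows allowed) with vertex set $Q_0$, arrow set $Q_1$ and source and target maps $s,t:Q_1\to Q_0$. Let $Q$ be a finite quiver without oriented cycles of length $1$ or $2$, and $i\in Q_0$. The mutation $\mu_i(Q)$ is obtained from $Q$ by: (1) for each path $h\xrightarrow{\alpha} i\xrightarrow{\beta} j$, adding an arrow $h\to j$; (2) reversing all arrows with source or target $i$; (3) removing the arrows of a maximal set of disjoint oriented $2$-cycles created by the previous steps. **Seeds.** The ambient field $\mathcal{F}$ is a field of rational functions in $n$ variables over $\mathbb{Q}$. A seed in $\mathcal{F}$ is a pair $(\mathbf{u},Q)$ where $Q$ is a finite quiver without oriented cycles of length $1$ or $2$ with $n$ vertices, and $\mathbf{u}=(u_j)_{j\in Q_0}$ is a free generating set of $\mathcal{F}$ over $\mathbb{Q}$ (algebraically independent and generating $\mathcal{F}$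 as a field). Its mutation at $i$ is $(\mathbf{u}',\mu_i(Q))$ with $u'_\ell=u_\ell$ for $\ell\ne i$ and $u_iu'_i=\prod_{\alpha\in Q_1,\,t(\alpha)=i}u_{s(\alpha)}+\prod_{\alpha\in Q_1,\,s(\alpha)=i}u_{t(\alpha)}$. Two seeds are isomorphic if they agree up to reordering the variables and correspondingly relabelling the quiver vertices. **Cluster algebras (skew-symmetric, trivial coefficients).** Given a seed $(\mathbf{u},Q)$, the tuples $\mathbf{u}'$ in the seeds $(\mathbf{u}',Q')$ obtained from $(\mathbf{u},Q)$ by iterated mutation are the clusters, their elements are the cluster variables, and $\mathscr{A}(\mathbf{u},Q)$ is the subring of $\mathcal{F}$ generated by all cluster variables (considered together with its seeds). The exchange graph has as vertices the isomorphism classes of these seeds, two being joined by an edge if one is obtained from the other by one mutation. **Unistructurality.** Let $\mathscr{X}$ be the set of cluster variables of $\mathscr{A}(\mathbf{u},Q)$. The cluster algebra $\mathscr{A}(\mathbf{u},Q)$ is unistructural if for every seed $(\mathbf{v},R)$ in the same ambient field $\mathcal{F}$ such that the set of cluster variables of $\mathscr{A}(\mathbf{v},R)$ equals $\mathscr{X}$, there is an isomorphism between the exchange graphs of $\mathscr{A}(\mathbf{u},Q)$ and $\mathscr{A}(\mathbf{v},R)$, and the two cluster algebras have the same clusters (up to permutation of the variables in each cluster). For $\mathscr{A}(\mathbf{u}^i,Q^i)$ the ambient field is $\mathbb{Q}(\mathbf{u}^i)$. *)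

theory Defs
  imports Complex_Main "HOL-Library.Multiset" "HOL-Library.FuncSet" "HOL-Library.Poly_Mapping"
begin

section \<open>Subfields, subrings and free generating sets\<close>

text \<open>
  The ambient field of a cluster algebra is a subset \<open>F\<close> of a type of class
  \<open>field_char_0\<close> (possibly the whole type), so that fields such as \<open>\<rat>(u\<^sup>i) \<subseteq> \<rat>(u)\<close> can be
  considered side by side.  Since \<open>inverse 0 = 0\<close>, closure under \<open>inverse\<close> needs no side
  condition.
\<close>

definition is_subring :: "'f::ring_1 set \<Rightarrow> bool" where
  "is_subring S \<longleftrightarrow> 1 \<in> S \<and> (\<forall>x\<in>S. \<forall>y\<in>S. x - y \<in> S \<and> x * y \<in> S)"

definition is_subfield :: "'f::field set \<Rightarrow> bool" where
  "is_subfield S \<longleftrightarrow> is_subring S \<and> (\<forall>x\<in>S. inverse x \<in> S)"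

text \<open>
  In characteristic 0 every subfield contains \<open>\<rat>\<close>, so this is the field
  \<open>\<rat>(X)\<close> generated by \<open>X\<close> over \<open>\<rat>\<close>.
\<close>

definition field_generated :: "'f::field_char_0 set \<Rightarrow> 'f set" where
  "field_generated X = is_subfield hull X"

text \<open>
  Polynomials over \<open>\<rat>\<close> in variables indexed by \<open>'v\<close>: a monomial is a finitely supported
  exponent function \<open>'v \<Rightarrow>\<^sub>0 nat\<close>, a polynomial a finitely supported family of coefficients.
\<close>

definition eval_poly :: "('v \<Rightarrow> 'f::field_char_0) \<Rightarrow> (('v \<Rightarrow>\<^sub>0 nat) \<Rightarrow>\<^sub>0 rat) \<Rightarrow> 'f" where
  "eval_poly u p =
     (\<Sum>m\<in>Poly_Mapping.keys p.
        of_rat (Poly_Mapping.lookup p m) *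
        (\<Prod>x\<in>Poly_Mapping.keys m. u x ^ Poly_Mapping.lookup m x))"

definition algebraically_independent :: "'v set \<Rightarrow> ('v \<Rightarrow> 'f::field_char_0) \<Rightarrow> bool" where
  "algebraically_independent I u \<longleftrightarrow>
     (\<forall>p. (\<forall>m\<in>Poly_Mapping.keys p. Poly_Mapping.keys m \<subseteq> I) \<and> eval_poly u p = 0 \<longrightarrow> p = 0)"

definition free_generating_set :: "'f::field_char_0 set \<Rightarrow> 'v set \<Rightarrow> ('v \<Rightarrow> 'f) \<Rightarrow> bool" where
  "free_generating_set F I u \<longleftrightarrow>
     algebraically_independent I u \<and> field_generated (u ` I) = F"


section \<open>Quivers\<close>

text \<open>
  An arrow is recorded only by its pair (source, target); parallel arrows are accounted for by
  multiplicity.  Mutation and all notions below depend on the arrows only through these pairs.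
\<close>

datatype 'v quiver = Quiver (verts: "'v set") (arrows: "('v \<times> 'v) multiset")

text \<open>Finite quivers without oriented cycles of length 1 or 2.\<close>

definition is_quiver :: "'v quiver \<Rightarrow> bool" where
  "is_quiver Q \<longleftrightarrow>
     finite (verts Q) \<and>
     set_mset (arrows Q) \<subseteq> verts Q \<times> verts Q \<and>
     (\<forall>a. (a, a) \<notin># arrows Q) \<and>
     (\<forall>a b. (a, b) \<in># arrows Q \<longrightarrow> (b, a) \<notin># arrows Q)"

text \<open>The sources of the arrows with target \<open>i\<close>, and the targets of the arrows with source \<open>i\<close>.\<close>

definition sources_into :: "'v \<Rightarrow> ('v \<times> 'v) multiset \<Rightarrow> 'v multiset" where
  "sources_into i A = image_mset fst (filter_mset (\<lambda>\<alpha>. snd \<alpha> = i) A)"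

definition targets_from :: "'v \<Rightarrow> ('v \<times> 'v) multiset \<Rightarrow> 'v multiset" where
  "targets_from i A = image_mset snd (filter_mset (\<lambda>\<alpha>. fst \<alpha> = i) A)"

definition add_composites :: "'v \<Rightarrow> ('v \<times> 'v) multiset \<Rightarrow> ('v \<times> 'v) multiset" where
  "add_composites i A = A + (\<Sum>h\<in>#sources_into i A. {#(h, j). j \<in># targets_from i A#})"

definition reverse_at :: "'v \<Rightarrow> ('v \<times> 'v) multiset \<Rightarrow> ('v \<times> 'v) multiset" where
  "reverse_at i A = image_mset (\<lambda>(a, b). if a = i \<or> b = i then (b, a) else (a, b)) A"

text \<open>
  In the absence of loops, a maximal set of disjoint oriented 2-cycles consists, for
  distinct vertices \<open>a\<close> and \<open>b\<close>, of \<open>min (count A (a, b)) (count A (b, a))\<close> cycles through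
  \<open>a\<close> and \<open>b\<close>; its arrows form the multiset \<open>A \<inter># image_mset prod.swap A\<close>.
\<close>

definition cancel_2cycles :: "('v \<times> 'v) multiset \<Rightarrow> ('v \<times> 'v) multiset" where
  "cancel_2cycles A = A - (A \<inter># image_mset prod.swap A)"

definition mutate_quiver :: "'v \<Rightarrow> 'v quiver \<Rightarrow> 'v quiver" where
  "mutate_quiver i Q =
     Quiver (verts Q) (cancel_2cycles (reverse_at i (add_composites i (arrows Q))))"

definition disjoint_union_of :: "'v quiver \<Rightarrow> 'i set \<Rightarrow> ('i \<Rightarrow> 'v quiver) \<Rightarrow> bool" where
  "disjoint_union_of Q I Qs \<longleftrightarrow>
     (\<forall>i\<in>I. is_quiver (Qs i)) \<and>
     (\<forall>i\<in>I. \<forall>j\<in>I. i \<noteq> j \<longrightarrow> verts (Qs i) \<inter> verts (Qs j) = {}) \<and>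
     verts Q = (\<Union>i\<in>I. verts (Qs i)) \<and>
     arrows Q = (\<Sum>i\<in>I. arrows (Qs i))"


section \<open>Seeds\<close>

text \<open>
  The tuple of a seed \<open>(u, Q)\<close> is a function, of which only the values on \<open>verts Q\<close> matter.
\<close>

type_synonym ('v, 'f) seed = "('v \<Rightarrow> 'f) \<times> 'v quiver"

text \<open>
  Seeds in \<open>F\<close>, a field of rational functions in \<open>n\<close> variables over \<open>\<rat>\<close> (that \<open>F\<close> is
  such a field is a consequence of the existence of a free generating set with \<open>n\<close> elements).
\<close>

definition is_seed :: "'f::field_char_0 set \<Rightarrow> nat \<Rightarrow> ('v, 'f) seed \<Rightarrow> bool" where
  "is_seed F n S \<longleftrightarrow>
     (case S of (u, Q) \<Rightarrow> is_quiver Q \<and> card (verts Q) = n \<and> free_generating_set F (verts Q) u)"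

definition mutate_seed :: "'v \<Rightarrow> ('v, 'f::field) seed \<Rightarrow> ('v, 'f) seed" where
  "mutate_seed i S = (case S of (u, Q) \<Rightarrow>
     (u(i := ((\<Prod>h\<in>#sources_into i (arrows Q). u h) + (\<Prod>j\<in>#targets_from i (arrows Q). u j))
             / u i),
      mutate_quiver i Q))"

definition seed_iso :: "('v, 'f) seed \<Rightarrow> ('v, 'f) seed \<Rightarrow> bool" where
  "seed_iso S T \<longleftrightarrow> (case (S, T) of ((u, Q), (v, R)) \<Rightarrow>
     (\<exists>\<sigma>. bij_betw \<sigma> (verts Q) (verts R) \<and>
          (\<forall>j\<in>verts Q. v (\<sigma> j) = u j) \<and>
          arrows R = image_mset (map_prod \<sigma> \<sigma>) (arrows Q)))"

inductive_set mutation_class :: "('v, 'f::field) seed \<Rightarrow> ('v, 'f) seed set"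
  for S :: "('v, 'f) seed" where
  initial: "S \<in> mutation_class S"
| mutate: "\<lbrakk>T \<in> mutation_class S; i \<in> verts (snd T)\<rbrakk> \<Longrightarrow> mutate_seed i T \<in> mutation_class S"


section \<open>Cluster algebras\<close>

text \<open>
  Clusters are taken up to permutation of their variables, i.e. as sets; the entries of a tuple
  are pairwise distinct by algebraic independence.
\<close>

definition clusters_of :: "('v, 'f) seed set \<Rightarrow> 'f set set" where
  "clusters_of \<S> = (\<lambda>(u, Q). u ` verts Q) ` \<S>"

text \<open>
  A cluster algebra is considered together with its ambient field, the number of variables of the
  latter, and its seeds.
\<close>

record ('v, 'f) cluster_algebra =
  ambient :: "'f set"
  rank :: nat
  subalgebra :: "'f set"
  seeds :: "('v, 'f) seed set"

definition cluster_algebra ::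
    "'f::field_char_0 set \<Rightarrow> ('v, 'f) seed \<Rightarrow> ('v, 'f) cluster_algebra" where
  "cluster_algebra F S =
     \<lparr>ambient = F,
      rank = card (verts (snd S)),
      subalgebra = is_subring hull (\<Union>(clusters_of (mutation_class S))),
      seeds = mutation_class S\<rparr>"

definition clusters :: "('v, 'f) cluster_algebra \<Rightarrow> 'f set set" where
  "clusters A = clusters_of (seeds A)"

definition cluster_variables :: "('v, 'f) cluster_algebra \<Rightarrow> 'f set" where
  "cluster_variables A = \<Union>(clusters A)"


section \<open>Exchange graphs and unistructurality\<close>

text \<open>A graph is given by its set of vertices and its adjacency relation.\<close>

type_synonym 'a graph = "'a set \<times> ('a \<times> 'a) set"

definition graph_isomorphic :: "'a graph \<Rightarrow> 'b graph \<Rightarrow> bool" where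
  "graph_isomorphic G H \<longleftrightarrow>
     (\<exists>f. bij_betw f (fst G) (fst H) \<and>
          (\<forall>x\<in>fst G. \<forall>y\<in>fst G. (x, y) \<in> snd G \<longleftrightarrow> (f x, f y) \<in> snd H))"

definition seed_classes :: "('v, 'f) cluster_algebra \<Rightarrow> ('v, 'f) seed set set" where
  "seed_classes A = seeds A // {(S, T). S \<in> seeds A \<and> T \<in> seeds A \<and> seed_iso S T}"

definition one_mutation :: "('v, 'f::field) seed \<Rightarrow> ('v, 'f) seed \<Rightarrow> bool" where
  "one_mutation S T \<longleftrightarrow> (\<exists>i\<in>verts (snd S). T = mutate_seed i S)"

definition exchange_graph ::
    "('v, 'f::field) cluster_algebra \<Rightarrow> ('v, 'f) seed set graph" where
  "exchange_graph A =
     (seed_classes A,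
      {(C, D). C \<in> seed_classes A \<and> D \<in> seed_classes A \<and>
               (\<exists>S\<in>C. \<exists>T\<in>D. one_mutation S T \<or> one_mutation T S)})"

text \<open>
  The competing seeds \<open>T\<close> have their vertices in the same type \<open>'v\<close> as the seeds of \<open>A\<close>.  This
  loses no generality: \<open>T\<close> has \<open>rank A\<close> vertices, and \<open>'v\<close> contains a set of that size, so every
  seed in the ambient field is isomorphic to one of this form.
\<close>

definition unistructural :: "('v, 'f::field_char_0) cluster_algebra \<Rightarrow> bool" where
  "unistructural A \<longleftrightarrow>
     (\<forall>T :: ('v, 'f) seed.
        is_seed (ambient A) (rank A) T \<and>
        cluster_variables (cluster_algebra (ambient A) T) = cluster_variables A \<longrightarrow>
          graph_isomorphic (exchange_graph A) (exchange_graph (cluster_algebra (ambient A) T)) \<and>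
          clusters A = clusters (cluster_algebra (ambient A) T))"

end

theory Submission
  imports Defs "HOL-Computational_Algebra.Polynomial"
begin

text \<open>
  By induction on the number of blocks it is enough to treat a disjoint union of two quivers \<open>Q\<close> and
  \<open>R\<close>.  Mutation at a vertex of one block leaves the other block alone, so the seeds obtained from the
  union are exactly the pairs of a seed obtained from \<open>Q\<close> and one obtained from \<open>R\<close>.  Hence a cluster
  of the union is a cluster of \<open>Q\<close> together with one of \<open>R\<close>, and the exchange graph of the union is the
  Cartesian product of the two exchange graphs (\<open>seed_graph_union\<close>).  The two parts of a cluster can be
  told apart: the cluster variables of a block lie in the field generated by that block, and none of
  them lies in the field of the other block (\<open>right_variables_not_in_left_field\<close>).

  If both blocks are unistructural (\<open>unistructural_union\<close>), take a seed \<open>(v, P)\<close> in the big field with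
  the same cluster variables as the union.  Each \<open>v k\<close> lies in the field of one of the two blocks, which
  divides the vertices of \<open>P\<close> into two groups, and each group generates the field of its block
  (\<open>block_fields_eq\<close>).  There is no arrow between the groups: the exchange relation at \<open>k\<close> is
  \<open>v k * x = M + N\<close>, where \<open>x\<close> is again a cluster variable and so lies in one of the two fields; since \<open>x\<close>
  involves \<open>v k\<close>, this is the field of the group of \<open>k\<close>, and then \<open>M + N\<close> involves no variable of the
  other group, whereas it involves every variable joined to \<open>k\<close> by an arrow.  So \<open>P\<close> is a disjoint
  union as well, and unistructurality of the two blocks applies to its parts.

  If the union is unistructural (\<open>unistructural_left_block\<close>), a seed with the same cluster variables as
  \<open>(u, Q)\<close> can be glued to \<open>(u, R)\<close>, and the result competes with the union.  Equality of the clusters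
  of \<open>(u, Q)\<close> and of its competitor follows by intersecting the clusters of the unions with the field of
  the block.  For exchange graphs one is left with an isomorphism between two Cartesian products that
  have a factor in common, and nothing is known about how this isomorphism treats the factors.  The
  common factor can nevertheless be cancelled, because exchange graphs are connected and locally finite
  (\<open>box_product_cancel\<close>).

  All statements about algebraic independence are reduced to derivations: a family is algebraically
  independent if and only if its field carries partial derivatives with respect to it
  (\<open>algebraically_independent_iff_dual_derivations\<close>), and an element of the field belongs to the
  subfield generated by some of the variables as soon as the partial derivatives in the remaining
  directions vanish (\<open>common_constants\<close>).
\<close>

section \<open>Cancellation for products of integer-valued metrics\<close>

definition nat_metric :: "'a set \<Rightarrow> ('a \<Rightarrow> 'a \<Rightarrow> nat) \<Rightarrow> bool" where
  "nat_metric A d \<longleftrightarrow>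
     (\<forall>x\<in>A. \<forall>y\<in>A. (d x y = 0 \<longleftrightarrow> x = y) \<and> d x y = d y x) \<and>
     (\<forall>x\<in>A. \<forall>y\<in>A. \<forall>z\<in>A. d x z \<le> d x y + d y z)"

text \<open>
  Path distances in a Cartesian product of graphs add up, so that cancellation of a factor becomes a
  question about metrics with values in the natural numbers and their \<open>l\<^sup>1\<close> products.
\<close>

definition sum_metric ::
    "('a \<Rightarrow> 'a \<Rightarrow> nat) \<Rightarrow> ('b \<Rightarrow> 'b \<Rightarrow> nat) \<Rightarrow> 'a \<times> 'b \<Rightarrow> 'a \<times> 'b \<Rightarrow> nat" where
  "sum_metric d e p q = d (fst p) (fst q) + e (snd p) (snd q)"

definition isometry ::
    "'a set \<Rightarrow> ('a \<Rightarrow> 'a \<Rightarrow> nat) \<Rightarrow> 'b set \<Rightarrow> ('b \<Rightarrow> 'b \<Rightarrow> nat) \<Rightarrow> ('a \<Rightarrow> 'b) \<Rightarrow> bool" where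
  "isometry A d B e f \<longleftrightarrow> bij_betw f A B \<and> (\<forall>x\<in>A. \<forall>y\<in>A. e (f x) (f y) = d x y)"

definition isometric ::
    "'a set \<Rightarrow> ('a \<Rightarrow> 'a \<Rightarrow> nat) \<Rightarrow> 'b set \<Rightarrow> ('b \<Rightarrow> 'b \<Rightarrow> nat) \<Rightarrow> bool" where
  "isometric A d B e \<longleftrightarrow> (\<exists>f. isometry A d B e f)"

text \<open>
  From every point one can make a first step of length 1 towards any other point.  Unlike
  connectedness of a graph, this property mentions the metric only, and it passes to factors.
\<close>

definition geodesic :: "'a set \<Rightarrow> ('a \<Rightarrow> 'a \<Rightarrow> nat) \<Rightarrow> bool" where
  "geodesic A d \<longleftrightarrow>
     (\<forall>x\<in>A. \<forall>y\<in>A. x \<noteq> y \<longrightarrow> (\<exists>z\<in>A. d x z = 1 \<and> d x y = Suc (d z y)))"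

definition neighbours :: "'a set \<Rightarrow> ('a \<Rightarrow> 'a \<Rightarrow> nat) \<Rightarrow> 'a \<Rightarrow> 'a set" where
  "neighbours A d x = {y \<in> A. d x y = 1}"

definition locally_finite :: "'a set \<Rightarrow> ('a \<Rightarrow> 'a \<Rightarrow> nat) \<Rightarrow> bool" where
  "locally_finite A d \<longleftrightarrow> (\<forall>x\<in>A. finite (neighbours A d x))"

definition min_degree :: "'a set \<Rightarrow> ('a \<Rightarrow> 'a \<Rightarrow> nat) \<Rightarrow> nat" where
  "min_degree A d = (LEAST k. \<exists>x\<in>A. card (neighbours A d x) = k)"

definition interval_closed :: "'a set \<Rightarrow> ('a \<Rightarrow> 'a \<Rightarrow> nat) \<Rightarrow> 'a set \<Rightarrow> bool" where
  "interval_closed X d L \<longleftrightarrow>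
     (\<forall>x\<in>L. \<forall>y\<in>L. \<forall>z\<in>X. d x y = d x z + d z y \<longrightarrow> z \<in> L)"

lemma nat_metricD:
  assumes "nat_metric A d" "x \<in> A" "y \<in> A"
  shows "d x y = 0 \<longleftrightarrow> x = y" "d x y = d y x" "d x x = 0"
  using assms by (simp_all add: nat_metric_def)

lemma nat_metric_subset: "nat_metric A d \<Longrightarrow> B \<subseteq> A \<Longrightarrow> nat_metric B d"
  unfolding nat_metric_def by (simp add: subset_iff)

lemma isometry_inv_into:
  assumes "isometry A d B e f"
  shows "isometry B e A d (inv_into A f)"
  unfolding isometry_def
proof (intro conjI ballI)
  have f: "bij_betw f A B" and eq: "\<And>x y. x \<in> A \<Longrightarrow> y \<in> A \<Longrightarrow> e (f x) (f y) = d x y"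
    using assms by (auto simp: isometry_def)
  show "bij_betw (inv_into A f) B A"
    by (rule bij_betw_inv_into[OF f])
  fix x y assume "x \<in> B" "y \<in> B"
  then show "d (inv_into A f x) (inv_into A f y) = e x y"
    using eq[of "inv_into A f x" "inv_into A f y"] f
    by (metis bij_betw_def bij_betw_inv_into_right inv_into_into)
qed

lemma isometry_comp:
  assumes "isometry A d B e f" "isometry B e C c g"
  shows "isometry A d C c (g \<circ> f)"
  using assms unfolding isometry_def
  by (auto intro: bij_betw_trans dest: bij_betwE)

lemma isometry_restrict:
  assumes "isometry A d B e f" "X \<subseteq> A"
  shows "isometry X d (f ` X) e f"
  using assms unfolding isometry_def
  by (auto intro: inj_on_imp_bij_betw inj_on_subset simp: bij_betw_def)

lemma isometric_sym: "isometric A d B e \<Longrightarrow> isometric B e A d"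
  unfolding isometric_def using isometry_inv_into by blast

lemma isometric_trans: "isometric A d B e \<Longrightarrow> isometric B e C c \<Longrightarrow> isometric A d C c"
  unfolding isometric_def using isometry_comp by blast

lemma isometric_refl: "isometric A d A d"
  unfolding isometric_def isometry_def using bij_betw_id by fastforce

lemma isometric_Times:
  assumes "isometric A d A' d'" "isometric B e B' e'"
  shows "isometric (A \<times> B) (sum_metric d e) (A' \<times> B') (sum_metric d' e')"
proof -
  obtain f g where "isometry A d A' d' f" "isometry B e B' e' g"
    using assms by (auto simp: isometric_def)
  then have "isometry (A \<times> B) (sum_metric d e) (A' \<times> B') (sum_metric d' e') (map_prod f g)"
    unfolding isometry_def by (auto intro!: bij_betw_map_prod simp: sum_metric_def)
  then show ?thesis by (auto simp: isometric_def)
qed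

lemma isometry_swap: "isometry (A \<times> B) (sum_metric d e) (B \<times> A) (sum_metric e d) prod.swap"
  unfolding isometry_def sum_metric_def
  by (auto simp: bij_betw_def inj_on_def image_iff)

lemma isometric_Times_singleton:
  assumes "nat_metric B e" "b \<in> B"
  shows "isometric A d (A \<times> {b}) (sum_metric d e)"
  unfolding isometric_def isometry_def sum_metric_def
  by (rule exI[of _ "\<lambda>a. (a, b)"])
     (auto simp: bij_betw_def inj_on_def nat_metricD(3)[OF assms(1) assms(2) assms(2)])

text \<open>
  The mechanism behind unique factorization of graphs: in a product, a set that is closed under
  metric intervals is itself a product, because two corners of a rectangle that are opposite to each
  other have the remaining two between them.
\<close>

lemma interval_closed_is_box:
  assumes B: "nat_metric B d" and K: "nat_metric K e" and "L \<subseteq> B \<times> K"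
    and L: "interval_closed (B \<times> K) (sum_metric d e) L"
  shows "L = fst ` L \<times> snd ` L"
proof (intro equalityI subsetI)
  fix p assume "p \<in> fst ` L \<times> snd ` L"
  then obtain b k b' k' where p: "p = (b, k')" and bk: "(b, k) \<in> L" "(b', k') \<in> L"
    by force
  then have *: "b \<in> B" "k \<in> K" "b' \<in> B" "k' \<in> K"
    using assms(3) by auto
  \<comment> \<open>The corner \<open>(b, k')\<close> lies between \<open>(b, k)\<close> and \<open>(b', k')\<close>.\<close>
  have "sum_metric d e (b, k) (b', k') = sum_metric d e (b, k) p + sum_metric d e p (b', k')"
    using * by (simp add: sum_metric_def p nat_metricD(3)[OF B] nat_metricD(3)[OF K])
  then show "p \<in> L"
    using L bk * p unfolding interval_closed_def by blast
qed force

lemma layer_interval_closed: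
  assumes A: "nat_metric A d" and H: "nat_metric H e" and "h \<in> H"
  shows "interval_closed (A \<times> H) (sum_metric d e) (A \<times> {h})"
  unfolding interval_closed_def
proof (intro ballI impI)
  fix x y z
  assume x: "x \<in> A \<times> {h}" and y: "y \<in> A \<times> {h}" and z: "z \<in> A \<times> H"
    and eq: "sum_metric d e x y = sum_metric d e x z + sum_metric d e z y"
  have "d (fst x) (fst y) \<le> d (fst x) (fst z) + d (fst z) (fst y)"
    using A x y z unfolding nat_metric_def by (auto simp: mem_Times_iff)
  moreover have "e h h = 0" using nat_metricD(3)[OF H] assms(3) by blast
  ultimately have "e h (snd z) = 0"
    using eq x y by (auto simp: sum_metric_def)
  then show "z \<in> A \<times> {h}"
    using z nat_metricD(1)[OF H assms(3)] by (auto simp: mem_Times_iff)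
qed

lemma isometry_interval_closed:
  assumes f: "isometry X d Y e f" and L: "interval_closed X d L" "L \<subseteq> X"
  shows "interval_closed Y e (f ` L)"
  unfolding interval_closed_def
proof (intro ballI impI)
  fix x y z assume "x \<in> f ` L" "y \<in> f ` L" and z: "z \<in> Y" and eq: "e x y = e x z + e z y"
  then obtain x' y' where xy: "x = f x'" "y = f y'" "x' \<in> L" "y' \<in> L" by auto
  obtain z' where z': "z = f z'" "z' \<in> X"
    using z f by (auto simp: isometry_def bij_betw_def)
  have "d x' y' = d x' z' + d z' y'"
    using eq xy z' L(2) f unfolding isometry_def by (metis subsetD)
  then have "z' \<in> L" using L xy z' unfolding interval_closed_def by blast
  then show "z \<in> f ` L" using z' by simp
qed

text \<open>
  A layer \<open>A \<times> {h}\<close> is closed under intervals, a property preserved by isometries.  Its image under an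
  isometry to another product \<open>B \<times> K\<close> is therefore a box, and its sides are cut out by the two layers
  of \<open>B \<times> K\<close> through the image of the base point.
\<close>

lemma layer_decomposition:
  assumes A: "nat_metric A dA" and H: "nat_metric H dH"
    and B: "nat_metric B dB" and K: "nat_metric K dK"
    and f: "isometry (A \<times> H) (sum_metric dA dH) (B \<times> K) (sum_metric dB dK) f"
    and "a \<in> A" "h \<in> H" "f (a, h) = (b, k)"
  shows "isometric A dA ({b'. \<exists>x\<in>A. f (x, h) = (b', k)} \<times> {k'. \<exists>x\<in>A. f (x, h) = (b, k')})
           (sum_metric dB dK)"
proof -
  define L where "L = f ` (A \<times> {h})"
  have sub: "A \<times> {h} \<subseteq> A \<times> H" using assms by auto
  have "L \<subseteq> B \<times> K"
    unfolding L_def using f sub by (auto simp: isometry_def bij_betw_def)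
  moreover have "interval_closed (B \<times> K) (sum_metric dB dK) L"
    unfolding L_def
    by (rule isometry_interval_closed[OF f layer_interval_closed[OF A H] sub]) fact
  ultimately have box: "L = fst ` L \<times> snd ` L"
    by (rule interval_closed_is_box[OF B K])
  have bk: "(b, k) \<in> L" unfolding L_def using assms by force
  have "fst ` L = {b'. (b', k) \<in> L}"
    using box bk by (metis (no_types, lifting) Collect_cong SigmaE2 SigmaI fst_conv image_eqI
        mem_Collect_eq set_eq_iff snd_conv)
  moreover have "snd ` L = {k'. (b, k') \<in> L}"
    using box bk by (metis (no_types, lifting) Collect_cong SigmaE2 SigmaI snd_conv image_eqI
        mem_Collect_eq set_eq_iff fst_conv)
  ultimately have "L = {b'. (b', k) \<in> L} \<times> {k'. (b, k') \<in> L}"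
    using box by simp
  also have "\<dots> = {b'. \<exists>x\<in>A. f (x, h) = (b', k)} \<times> {k'. \<exists>x\<in>A. f (x, h) = (b, k')}"
    unfolding L_def by (auto simp: image_iff) metis+
  finally have L: "L = \<dots>" .
  have "isometric A dA (A \<times> {h}) (sum_metric dA dH)"
    by (rule isometric_Times_singleton[OF H]) fact
  moreover have "isometric (A \<times> {h}) (sum_metric dA dH) L (sum_metric dB dK)"
    unfolding isometric_def L_def using isometry_restrict[OF f sub] by blast
  ultimately show ?thesis unfolding L by (rule isometric_trans)
qed

text \<open>
  The intersection of an \<open>A\<close>-layer with a \<open>B\<close>-layer can be read as a subset of \<open>A\<close> or as a subset
  of \<open>B\<close>.
\<close>

lemma common_part:
  assumes H: "nat_metric H dH" and K: "nat_metric K dK"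
    and f: "isometry (A \<times> H) (sum_metric dA dH) (B \<times> K) (sum_metric dB dK) f"
    and "h \<in> H" "k \<in> K"
  shows "isometric {a. \<exists>y\<in>B. inv_into (A \<times> H) f (y, k) = (a, h)} dA
           {b. \<exists>x\<in>A. f (x, h) = (b, k)} dB"
    (is "isometric ?S _ ?U _")
proof -
  have bij: "bij_betw f (A \<times> H) (B \<times> K)" using f by (simp add: isometry_def)
  have S: "?S = {a\<in>A. \<exists>b\<in>B. f (a, h) = (b, k)}"
  proof (intro set_eqI iffI; clarsimp)
    fix a y assume "y \<in> B" "inv_into (A \<times> H) f (y, k) = (a, h)"
    then have "(a, h) \<in> A \<times> H" "f (a, h) = (y, k)"
      using bij assms(5) by (metis SigmaI bij_betw_def inv_into_into,
        metis SigmaI assms(5) bij bij_betw_inv_into_right)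
    then show "a \<in> A \<and> (\<exists>b\<in>B. f (a, h) = (b, k))" using \<open>y \<in> B\<close> by auto
  next
    fix a b assume "a \<in> A" "b \<in> B" "f (a, h) = (b, k)"
    then show "\<exists>y\<in>B. inv_into (A \<times> H) f (y, k) = (a, h)"
      using bij assms(4) by (metis SigmaI bij_betw_inv_into_left)
  qed
  have img: "f ` (?S \<times> {h}) = ?U \<times> {k}"
    unfolding S using bij assms(4) by (force simp: bij_betw_def)
  have "isometric ?S dA (?S \<times> {h}) (sum_metric dA dH)"
    by (rule isometric_Times_singleton[OF H assms(4)])
  moreover have "isometric (?S \<times> {h}) (sum_metric dA dH) (?U \<times> {k}) (sum_metric dB dK)"
    unfolding isometric_def img[symmetric]
    using isometry_restrict[OF f, of "?S \<times> {h}"] S assms(4) by auto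
  moreover have "isometric (?U \<times> {k}) (sum_metric dB dK) ?U dB"
    by (rule isometric_sym[OF isometric_Times_singleton[OF K assms(5)]])
  ultimately show ?thesis by (blast intro: isometric_trans)
qed

text \<open>
  The decomposition of \<open>B\<close> induced by \<open>A\<close> and \<open>H\<close>: decompose the \<open>B\<close>-layer by means of the inverse isometry
  and transport both sides, which are subsets of \<open>A\<close> and of \<open>H\<close>, to \<open>B\<close> by \<open>common_part\<close>.
\<close>

lemma half_refinement:
  assumes A: "nat_metric A dA" and H: "nat_metric H dH"
    and B: "nat_metric B dB" and K: "nat_metric K dK"
    and f: "isometry (A \<times> H) (sum_metric dA dH) (B \<times> K) (sum_metric dB dK) f"
    and "a \<in> A" "h \<in> H" and fab: "f (a, h) = (b, k)"
  shows "isometric B dB ({b'. \<exists>x\<in>A. f (x, h) = (b', k)} \<times> {b'. \<exists>y\<in>H. f (a, y) = (b', k)})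
           (sum_metric dB dB)"
proof -
  let ?g = "inv_into (A \<times> H) f"
  have bij: "bij_betw f (A \<times> H) (B \<times> K)" using f by (simp add: isometry_def)
  have "(b, k) \<in> B \<times> K" using bij assms(6,7) fab by (metis SigmaI bij_betwE)
  then have bk: "b \<in> B" "k \<in> K" by auto
  have ga: "?g (b, k) = (a, h)"
    using bij assms(6,7) fab by (metis SigmaI bij_betw_inv_into_left)
  have 1: "isometric B dB ({a'. \<exists>y\<in>B. ?g (y, k) = (a', h)} \<times> {h'. \<exists>y\<in>B. ?g (y, k) = (a, h')})
           (sum_metric dA dH)"
    by (rule layer_decomposition[OF B K A H isometry_inv_into[OF f] bk ga])
  have 2: "isometric {a'. \<exists>y\<in>B. ?g (y, k) = (a', h)} dA {b'. \<exists>x\<in>A. f (x, h) = (b', k)} dB"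
    by (rule common_part[OF H K f]) fact+
  let ?f' = "f \<circ> prod.swap"
  have f': "isometry (H \<times> A) (sum_metric dH dA) (B \<times> K) (sum_metric dB dK) ?f'"
    by (rule isometry_comp[OF isometry_swap f])
  have bij': "bij_betw ?f' (H \<times> A) (B \<times> K)" using f' by (simp add: isometry_def)
  have "inv_into (H \<times> A) ?f' p = prod.swap (?g p)" if "p \<in> B \<times> K" for p
  proof -
    have "?g p \<in> A \<times> H" "f (?g p) = p"
      using that bij by (metis bij_betw_def inv_into_into, metis bij bij_betw_inv_into_right that)
    then have "prod.swap (?g p) \<in> H \<times> A" "?f' (prod.swap (?g p)) = p" by auto
    then show ?thesis using bij' by (metis bij_betw_inv_into_left)
  qed
  then have "{h'. \<exists>y\<in>B. inv_into (H \<times> A) ?f' (y, k) = (h', a)} = {h'. \<exists>y\<in>B. ?g (y, k) = (a, h')}"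
    using bk by (auto simp: prod_eq_iff)
  moreover have "isometric {h'. \<exists>y\<in>B. inv_into (H \<times> A) ?f' (y, k) = (h', a)} dH
       {b'. \<exists>y\<in>H. ?f' (y, a) = (b', k)} dB"
    by (rule common_part[OF A K f']) fact+
  ultimately have 3: "isometric {h'. \<exists>y\<in>B. ?g (y, k) = (a, h')} dH {b'. \<exists>y\<in>H. f (a, y) = (b', k)} dB"
    by simp
  show ?thesis by (rule isometric_trans[OF 1 isometric_Times[OF 2 3]])
qed

text \<open>
  Two product decompositions of one space have a common refinement into four pieces, the
  intersections of the layers through a base point: \<open>U\<close> is the common part of \<open>A\<close> and \<open>B\<close>, \<open>V\<close> that of
  \<open>A\<close> and \<open>K\<close>, \<open>U'\<close> that of \<open>H\<close> and \<open>B\<close>, and \<open>V'\<close> that of \<open>H\<close> and \<open>K\<close>.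
\<close>

lemma common_refinement:
  assumes A: "nat_metric A dA" and H: "nat_metric H dH"
    and B: "nat_metric B dB" and K: "nat_metric K dK"
    and "isometric (A \<times> H) (sum_metric dA dH) (B \<times> K) (sum_metric dB dK)"
    and "A \<noteq> {}" "H \<noteq> {}"
  obtains U U' V V' where "U \<subseteq> B" "U' \<subseteq> B" "V \<subseteq> K" "V' \<subseteq> K"
    "U \<noteq> {}" "U' \<noteq> {}" "V \<noteq> {}" "V' \<noteq> {}"
    "isometric A dA (U \<times> V) (sum_metric dB dK)"
    "isometric H dH (U' \<times> V') (sum_metric dB dK)"
    "isometric B dB (U \<times> U') (sum_metric dB dB)"
    "isometric K dK (V \<times> V') (sum_metric dK dK)"
proof -
  obtain f where f: "isometry (A \<times> H) (sum_metric dA dH) (B \<times> K) (sum_metric dB dK) f"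
    using assms(5) by (auto simp: isometric_def)
  obtain a h where ah: "a \<in> A" "h \<in> H" using assms by blast
  obtain b k where fab: "f (a, h) = (b, k)" by fastforce
  have mem: "f p \<in> B \<times> K" if "p \<in> A \<times> H" for p
    using f that by (auto simp: isometry_def dest: bij_betwE)
  let ?U = "{b'. \<exists>x\<in>A. f (x, h) = (b', k)}" and ?V = "{k'. \<exists>x\<in>A. f (x, h) = (b, k')}"
  let ?U' = "{b'. \<exists>y\<in>H. f (a, y) = (b', k)}" and ?V' = "{k'. \<exists>y\<in>H. f (a, y) = (b, k')}"
  have fs: "isometry (H \<times> A) (sum_metric dH dA) (B \<times> K) (sum_metric dB dK) (f \<circ> prod.swap)"
    by (rule isometry_comp[OF isometry_swap f])
  have sf: "isometry (A \<times> H) (sum_metric dA dH) (K \<times> B) (sum_metric dK dB) (prod.swap \<circ> f)"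
    by (rule isometry_comp[OF f isometry_swap])
  have swap_eq: "prod.swap p = (x, y) \<longleftrightarrow> p = (y, x)" for p :: "'c \<times> 'd" and x y by (cases p) auto
  show ?thesis
  proof (rule that[of ?U ?U' ?V ?V'])
    show "?U \<subseteq> B" "?V \<subseteq> K" using mem ah by fastforce+
    show "?U' \<subseteq> B" "?V' \<subseteq> K" using mem ah by fastforce+
    show "?U \<noteq> {}" "?U' \<noteq> {}" "?V \<noteq> {}" "?V' \<noteq> {}" using fab ah by auto
    show "isometric A dA (?U \<times> ?V) (sum_metric dB dK)"
      by (rule layer_decomposition[OF A H B K f ah fab])
    show "isometric H dH (?U' \<times> ?V') (sum_metric dB dK)"
      using layer_decomposition[OF H A B K fs ah(2,1), of b k] fab by simp
    show "isometric B dB (?U \<times> ?U') (sum_metric dB dB)"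
      by (rule half_refinement[OF A H B K f ah fab])
    show "isometric K dK (?V \<times> ?V') (sum_metric dK dK)"
      using half_refinement[OF A H K B sf ah, of k b] fab by (simp add: swap_eq)
  qed
qed

lemma isometric_geodesic:
  assumes "isometric A d B e" "geodesic A d"
  shows "geodesic B e"
proof -
  obtain f where f: "isometry A d B e f" using assms by (auto simp: isometric_def)
  then have B: "B = f ` A" and eq: "\<And>x y. x \<in> A \<Longrightarrow> y \<in> A \<Longrightarrow> e (f x) (f y) = d x y"
    by (auto simp: isometry_def bij_betw_def)
  show ?thesis unfolding geodesic_def B
  proof (intro ballI impI)
    fix x y assume "x \<in> f ` A" "y \<in> f ` A" "x \<noteq> y"
    then obtain x' y' where *: "x = f x'" "y = f y'" "x' \<in> A" "y' \<in> A" "x' \<noteq> y'" by auto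
    then obtain z where "z \<in> A" "d x' z = 1" "d x' y' = Suc (d z y')"
      using assms(2) unfolding geodesic_def by blast
    then show "\<exists>z\<in>f ` A. e x z = 1 \<and> e x y = Suc (e z y)"
      using * eq by auto
  qed
qed

lemma isometry_neighbours:
  assumes f: "isometry A d B e f" and "x \<in> A"
  shows "bij_betw f (neighbours A d x) (neighbours B e (f x))"
proof -
  have B: "B = f ` A" "inj_on f A" and eq: "\<And>y. y \<in> A \<Longrightarrow> e (f x) (f y) = d x y"
    using assms by (auto simp: isometry_def bij_betw_def)
  then show ?thesis
    unfolding bij_betw_def neighbours_def by (auto intro: inj_on_subset)
qed

lemma isometric_locally_finite:
  assumes "isometric A d B e" "locally_finite A d"
  shows "locally_finite B e"
proof -
  obtain f where f: "isometry A d B e f" using assms by (auto simp: isometric_def)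
  then have "B = f ` A" by (auto simp: isometry_def bij_betw_def)
  then show ?thesis
    using assms(2) isometry_neighbours[OF f] bij_betw_finite
    unfolding locally_finite_def by blast
qed

lemma isometric_min_degree:
  assumes "isometric A d B e"
  shows "min_degree A d = min_degree B e"
proof -
  obtain f where f: "isometry A d B e f" using assms by (auto simp: isometric_def)
  then have "B = f ` A" by (auto simp: isometry_def bij_betw_def)
  then show ?thesis
    unfolding min_degree_def using bij_betw_same_card[OF isometry_neighbours[OF f]] by auto
qed

lemma neighbours_Times:
  assumes A: "nat_metric A d" and B: "nat_metric B e" and "a \<in> A" "b \<in> B"
  shows "neighbours (A \<times> B) (sum_metric d e) (a, b) =
           neighbours A d a \<times> {b} \<union> {a} \<times> neighbours B e b"
proof -
  have "d a x + e b y = 1 \<longleftrightarrow> d a x = 1 \<and> y = b \<or> x = a \<and> e b y = 1"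
    if "x \<in> A" "y \<in> B" for x y
    using nat_metricD(1)[OF A \<open>a \<in> A\<close> that(1)] nat_metricD(1)[OF B \<open>b \<in> B\<close> that(2)]
    by (auto simp: add_is_1)
  then show ?thesis
    using assms unfolding neighbours_def sum_metric_def by fastforce
qed

lemma min_degree_attained:
  assumes "A \<noteq> {}"
  obtains x where "x \<in> A" "card (neighbours A d x) = min_degree A d"
    "\<And>y. y \<in> A \<Longrightarrow> min_degree A d \<le> card (neighbours A d y)"
proof -
  obtain a where "a \<in> A" using assms by blast
  then have "\<exists>x\<in>A. card (neighbours A d x) = min_degree A d"
    unfolding min_degree_def
    by (intro LeastI[of "\<lambda>k. \<exists>x\<in>A. card (neighbours A d x) = k"]) blast
  moreover have "min_degree A d \<le> card (neighbours A d y)" if "y \<in> A" for y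
    unfolding min_degree_def using that by (intro Least_le) blast
  ultimately show ?thesis using that by blast
qed

lemma product_properties:
  assumes A: "nat_metric A d" and B: "nat_metric B e" and ne: "A \<noteq> {}" "B \<noteq> {}"
    and lf: "locally_finite (A \<times> B) (sum_metric d e)"
  shows factor_locally_finite: "locally_finite A d" "locally_finite B e"
    and min_degree_Times:
      "min_degree (A \<times> B) (sum_metric d e) = min_degree A d + min_degree B e"
proof -
  have fin: "finite (neighbours A d a \<times> {b} \<union> {a} \<times> neighbours B e b)"
    if "a \<in> A" "b \<in> B" for a b
    using lf that neighbours_Times[OF A B that] unfolding locally_finite_def
    by (metis SigmaI)
  have fin': "finite (neighbours A d a)" "finite (neighbours B e b)" if "a \<in> A" "b \<in> B" for a b
    using fin[OF that] by (auto dest: finite_cartesian_productD1 finite_cartesian_productD2)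
  then show lfs: "locally_finite A d" "locally_finite B e"
    using ne unfolding locally_finite_def by blast+
  have deg: "card (neighbours (A \<times> B) (sum_metric d e) (a, b)) =
      card (neighbours A d a) + card (neighbours B e b)" if ab: "a \<in> A" "b \<in> B" for a b
  proof -
    have "(neighbours A d a \<times> {b}) \<inter> ({a} \<times> neighbours B e b) = {}"
      using nat_metricD(3)[OF A \<open>a \<in> A\<close> \<open>a \<in> A\<close>] by (auto simp: neighbours_def)
    then show ?thesis
      using fin'[OF ab] by (simp add: neighbours_Times[OF A B ab] card_Un_disjoint)
  qed
  obtain a where a: "a \<in> A" "card (neighbours A d a) = min_degree A d"
    "\<And>y. y \<in> A \<Longrightarrow> min_degree A d \<le> card (neighbours A d y)"
    using min_degree_attained[OF ne(1)] by blast
  obtain b where b: "b \<in> B" "card (neighbours B e b) = min_degree B e"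
    "\<And>y. y \<in> B \<Longrightarrow> min_degree B e \<le> card (neighbours B e y)"
    using min_degree_attained[OF ne(2)] by blast
  show "min_degree (A \<times> B) (sum_metric d e) = min_degree A d + min_degree B e"
    unfolding min_degree_def[of "A \<times> B"]
  proof (rule Least_equality)
    show "\<exists>x\<in>A \<times> B. card (neighbours (A \<times> B) (sum_metric d e) x) = min_degree A d + min_degree B e"
      using deg[OF a(1) b(1)] a b by auto
    fix k assume "\<exists>x\<in>A \<times> B. card (neighbours (A \<times> B) (sum_metric d e) x) = k"
    then show "min_degree A d + min_degree B e \<le> k"
      using deg a(3) b(3) by (auto intro!: add_mono)
  qed
qed

lemma factor_geodesic:
  assumes A: "nat_metric A d" and B: "nat_metric B e" and "B \<noteq> {}"
    and geo: "geodesic (A \<times> B) (sum_metric d e)"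
  shows "geodesic A d"
  unfolding geodesic_def
proof (intro ballI impI)
  fix x y assume xy: "x \<in> A" "y \<in> A" "x \<noteq> y"
  obtain b where b: "b \<in> B" using assms by blast
  obtain z c where zc: "z \<in> A" "c \<in> B" "d x z + e b c = 1" "d x y + e b b = Suc (d z y + e c b)"
    using geo xy b unfolding geodesic_def sum_metric_def by fastforce
  have "e b b = 0" using nat_metricD(3)[OF B] b by blast
  moreover have "e b c = 0"
  proof (rule ccontr)
    assume "e b c \<noteq> 0"
    then have "d x z = 0" using zc by simp
    then have "x = z" using nat_metricD(1)[OF A xy(1) zc(1)] by simp
    then show False using zc \<open>e b b = 0\<close> by simp
  qed
  moreover from this have "c = b" using nat_metricD(1)[OF B b zc(2)] by simp
  ultimately show "\<exists>z\<in>A. d x z = 1 \<and> d x y = Suc (d z y)"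
    using zc by auto
qed

lemma min_degree_0_singleton:
  assumes "geodesic A d" "locally_finite A d" "A \<noteq> {}" "min_degree A d = 0"
  obtains a where "A = {a}"
proof -
  obtain a where a: "a \<in> A" "card (neighbours A d a) = 0"
    using min_degree_attained[OF assms(3)] assms(4) by metis
  then have "neighbours A d a = {}" using assms(2) unfolding locally_finite_def by auto
  then have "A = {a}"
    using a assms(1) unfolding geodesic_def neighbours_def by fastforce
  then show ?thesis by (rule that)
qed

text \<open>
  In the refinement, \<open>A = U V\<close> and \<open>B = U U'\<close>, while \<open>H\<close> is both \<open>U' V'\<close> and \<open>V V'\<close>.  It remains to cancel
  \<open>V'\<close> in order to get \<open>U' = V\<close>.  Since minimal degrees of products add up, either \<open>V'\<close> has smaller
  minimal degree than \<open>H\<close> and induction applies, or \<open>U'\<close> and \<open>V\<close> have minimal degree 0 and are points.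
  Local finiteness is essential: infinite powers of a graph absorb further factors.
\<close>

theorem metric_cancellation:
  fixes A B H :: "'a set"
  assumes "nat_metric A dA" "nat_metric B dB" "nat_metric H dH"
    and "geodesic H dH" "locally_finite H dH" "A \<noteq> {}" "H \<noteq> {}"
    and "isometric (A \<times> H) (sum_metric dA dH) (B \<times> H) (sum_metric dB dH)"
  shows "isometric A dA B dB"
  using assms
proof (induction "min_degree H dH" arbitrary: A dA B dB H dH rule: less_induct)
  case less
  note A = less.prems(1) and B = less.prems(2) and H = less.prems(3) and geo = less.prems(4)
    and lf = less.prems(5)
  obtain U U' V V' where sub: "U \<subseteq> B" "U' \<subseteq> B" "V \<subseteq> H" "V' \<subseteq> H"
    and ne: "U \<noteq> {}" "U' \<noteq> {}" "V \<noteq> {}" "V' \<noteq> {}"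
    and Ai: "isometric A dA (U \<times> V) (sum_metric dB dH)"
    and Hi: "isometric H dH (U' \<times> V') (sum_metric dB dH)"
    and Bi: "isometric B dB (U \<times> U') (sum_metric dB dB)"
    and Hi': "isometric H dH (V \<times> V') (sum_metric dH dH)"
    by (rule common_refinement[OF A H B H less.prems(8) less.prems(6,7)]) (rule that; assumption)
  have U': "nat_metric U' dB" using nat_metric_subset[OF B sub(2)] .
  have V: "nat_metric V dH" and V': "nat_metric V' dH"
    using nat_metric_subset[OF H] sub by auto
  have lf1: "locally_finite (U' \<times> V') (sum_metric dB dH)"
    and lf2: "locally_finite (V \<times> V') (sum_metric dH dH)"
    using isometric_locally_finite[OF Hi lf] isometric_locally_finite[OF Hi' lf] by auto
  have geo1: "geodesic (U' \<times> V') (sum_metric dB dH)"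
    and geo2: "geodesic (V \<times> V') (sum_metric dH dH)"
    using isometric_geodesic[OF Hi geo] isometric_geodesic[OF Hi' geo] by auto
  have lfV': "locally_finite V' dH" and lfU': "locally_finite U' dB" and lfV: "locally_finite V dH"
    using factor_locally_finite[OF U' V' ne(2,4) lf1] factor_locally_finite[OF V V' ne(3,4) lf2]
    by auto
  have geoU': "geodesic U' dB" and geoV: "geodesic V dH"
    using factor_geodesic[OF U' V' ne(4) geo1] factor_geodesic[OF V V' ne(4) geo2] by auto
  have "isometric (V' \<times> U') (sum_metric dH dB) (U' \<times> V') (sum_metric dB dH)"
    unfolding isometric_def using isometry_swap by blast
  then have geoV': "geodesic V' dH"
    using factor_geodesic[OF V' U' ne(2)] isometric_geodesic[OF isometric_sym geo1] by blast
  have deg1: "min_degree H dH = min_degree U' dB + min_degree V' dH"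
    using isometric_min_degree[OF Hi] min_degree_Times[OF U' V' ne(2,4) lf1] by simp
  have deg2: "min_degree H dH = min_degree V dH + min_degree V' dH"
    using isometric_min_degree[OF Hi'] min_degree_Times[OF V V' ne(3,4) lf2] by simp
  have "isometric U' dB V dH"
  proof (cases "min_degree V' dH < min_degree H dH")
    case True
    then show ?thesis
      by (rule less.hyps[OF _ U' V V' geoV' lfV' ne(2,4)
            isometric_trans[OF isometric_sym[OF Hi] Hi']])
  next
    case False
    then have "min_degree U' dB = 0" "min_degree V dH = 0" using deg1 deg2 by auto
    then obtain b k where "U' = {b}" "V = {k}"
      using min_degree_0_singleton[OF geoU' lfU' ne(2)] min_degree_0_singleton[OF geoV lfV ne(3)]
      by metis
    moreover have "dB b b = 0" "dH k k = 0"
      using nat_metricD(3)[OF U'] nat_metricD(3)[OF V] calculation by auto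
    ultimately show ?thesis
      unfolding isometric_def isometry_def by (intro exI[of _ "\<lambda>_. k"]) (auto simp: bij_betw_def)
  qed
  then have "isometric (U \<times> V) (sum_metric dB dH) (U \<times> U') (sum_metric dB dB)"
    by (rule isometric_Times[OF isometric_refl isometric_sym])
  then show ?case
    by (rule isometric_trans[OF isometric_trans[OF Ai] isometric_sym[OF Bi]])
qed

section \<open>Cancellation for Cartesian products of graphs\<close>

definition graph_dist :: "('a \<times> 'a) set \<Rightarrow> 'a \<Rightarrow> 'a \<Rightarrow> nat" where
  "graph_dist E x y = (LEAST n. (x, y) \<in> E ^^ n)"

text \<open>
  Connectedness comes with the further properties that make the path distance a faithful encoding:
  the edges form a symmetric relation without loops, and every vertex has finite degree.
\<close>

definition connected_graph :: "'a graph \<Rightarrow> bool" where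
  "connected_graph G \<longleftrightarrow>
     snd G \<subseteq> fst G \<times> fst G \<and> sym (snd G) \<and> irrefl (snd G) \<and>
     (\<forall>x\<in>fst G. finite (snd G `` {x})) \<and>
     (\<forall>x\<in>fst G. \<forall>y\<in>fst G. (x, y) \<in> (snd G)\<^sup>*)"

definition box_product :: "'a graph \<Rightarrow> 'b graph \<Rightarrow> ('a \<times> 'b) graph" where
  "box_product G H =
     (fst G \<times> fst H,
      {((a, b), (a', b')). a \<in> fst G \<and> a' \<in> fst G \<and> b \<in> fst H \<and> b' \<in> fst H \<and>
         ((a, a') \<in> snd G \<and> b = b' \<or> a = a' \<and> (b, b') \<in> snd H)})"

lemma graph_dist_relpow:
  assumes "(x, y) \<in> E\<^sup>*"
  shows "(x, y) \<in> E ^^ graph_dist E x y"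
  unfolding graph_dist_def using assms by (metis LeastI rtrancl_imp_relpow)

lemma graph_dist_le: "(x, y) \<in> E ^^ n \<Longrightarrow> graph_dist E x y \<le> n"
  unfolding graph_dist_def by (rule Least_le)

lemma relpow_in_verts:
  assumes "E \<subseteq> V \<times> V" "x \<in> V" "(x, y) \<in> E ^^ n"
  shows "y \<in> V"
  using assms(3) by (cases n) (use assms in \<open>auto elim: relpow_Suc_E\<close>)

lemma relpow_sym:
  assumes "sym E" "(x, y) \<in> E ^^ n"
  shows "(y, x) \<in> E ^^ n"
  using assms(2)
proof (induction n arbitrary: y)
  case (Suc n)
  then obtain z where "(x, z) \<in> E ^^ n" "(z, y) \<in> E" by auto
  then show ?case
    using Suc.IH assms(1) by (metis relpow_Suc_I2 symD)
qed auto

context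
  fixes V :: "'a set" and E :: "('a \<times> 'a) set"
  assumes G: "connected_graph (V, E)"
begin

lemma connected_graph_facts:
  "E \<subseteq> V \<times> V" "sym E" "irrefl E" "\<And>x. x \<in> V \<Longrightarrow> finite (E `` {x})"
  "\<And>x y. x \<in> V \<Longrightarrow> y \<in> V \<Longrightarrow> (x, y) \<in> E\<^sup>*"
  using G by (simp_all add: connected_graph_def)

lemma graph_dist_path: "x \<in> V \<Longrightarrow> y \<in> V \<Longrightarrow> (x, y) \<in> E ^^ graph_dist E x y"
  by (rule graph_dist_relpow) (rule connected_graph_facts)

lemma graph_dist_metric: "nat_metric V (graph_dist E)"
  unfolding nat_metric_def
proof (intro conjI ballI)
  fix x y assume xy: "x \<in> V" "y \<in> V"
  show "graph_dist E x y = 0 \<longleftrightarrow> x = y"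
    using graph_dist_path[OF xy] graph_dist_le[where E = E and n = 0] by (metis le_zero_eq pair_in_Id_conv relpow.simps(1))
  show "graph_dist E x y = graph_dist E y x"
    by (rule order_antisym;
        rule graph_dist_le[OF relpow_sym[OF connected_graph_facts(2) graph_dist_path]]; fact)
  fix z assume z: "z \<in> V"
  have "(x, z) \<in> E ^^ (graph_dist E x y + graph_dist E y z)"
    using graph_dist_path[OF xy] graph_dist_path[OF xy(2) z] by (auto simp: relpow_add)
  then show "graph_dist E x z \<le> graph_dist E x y + graph_dist E y z"
    by (rule graph_dist_le)
qed

lemma graph_dist_eq_1:
  assumes "x \<in> V" "y \<in> V"
  shows "graph_dist E x y = 1 \<longleftrightarrow> (x, y) \<in> E"
proof
  assume "graph_dist E x y = 1"
  then show "(x, y) \<in> E" using graph_dist_path[OF assms] by simp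
next
  assume xy: "(x, y) \<in> E"
  then have "x \<noteq> y" using connected_graph_facts(3) by (auto simp: irrefl_def)
  then have "graph_dist E x y \<noteq> 0" using nat_metricD(1)[OF graph_dist_metric assms] by simp
  moreover have "graph_dist E x y \<le> 1" using xy by (intro graph_dist_le) simp
  ultimately show "graph_dist E x y = 1" by simp
qed

lemma graph_dist_geodesic: "geodesic V (graph_dist E)"
  unfolding geodesic_def
proof (intro ballI impI)
  fix x y assume xy: "x \<in> V" "y \<in> V" "x \<noteq> y"
  then obtain n where n: "graph_dist E x y = Suc n"
    using nat_metricD(1)[OF graph_dist_metric xy(1,2)] by (cases "graph_dist E x y") auto
  then obtain z where z: "(x, z) \<in> E" "(z, y) \<in> E ^^ n"
    using graph_dist_path[OF xy(1,2)] by (metis relpow_Suc_E2)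
  then have zV: "z \<in> V" using connected_graph_facts(1) by auto
  have 1: "graph_dist E x z = 1" using graph_dist_eq_1 xy zV z by blast
  have "graph_dist E z y \<le> n" by (rule graph_dist_le) fact
  moreover have "graph_dist E x y \<le> graph_dist E x z + graph_dist E z y"
    using graph_dist_metric xy zV unfolding nat_metric_def by blast
  ultimately show "\<exists>z\<in>V. graph_dist E x z = 1 \<and> graph_dist E x y = Suc (graph_dist E z y)"
    using zV 1 n by auto
qed

lemma graph_dist_locally_finite: "locally_finite V (graph_dist E)"
  unfolding locally_finite_def neighbours_def
proof
  fix x assume x: "x \<in> V"
  have "{y \<in> V. graph_dist E x y = 1} \<subseteq> E `` {x}"
    using graph_dist_eq_1 x by auto
  then show "finite {y \<in> V. graph_dist E x y = 1}"
    using connected_graph_facts(4)[OF x] finite_subset by blast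
qed

end

lemma relpow_map:
  assumes "E \<subseteq> V \<times> V" "\<And>x y. x \<in> V \<Longrightarrow> y \<in> V \<Longrightarrow> (x, y) \<in> E \<Longrightarrow> (f x, f y) \<in> E'"
    and "(x, y) \<in> E ^^ n"
  shows "(f x, f y) \<in> E' ^^ n"
  using assms(3)
proof (induction n arbitrary: y)
  case (Suc n)
  then obtain z where "(x, z) \<in> E ^^ n" "(z, y) \<in> E" by auto
  then have "(f x, f z) \<in> E' ^^ n" "(f z, f y) \<in> E'" using Suc.IH assms(1,2) by auto
  then show ?case by auto
qed auto

lemma graph_isomorphic_imp_isometric:
  assumes G: "connected_graph (V, E)" and H: "E' \<subseteq> V' \<times> V'"
    and "graph_isomorphic (V, E) (V', E')"
  shows "isometric V (graph_dist E) V' (graph_dist E')"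
proof -
  obtain f where f: "bij_betw f V V'"
    and adj: "\<And>x y. x \<in> V \<Longrightarrow> y \<in> V \<Longrightarrow> (x, y) \<in> E \<longleftrightarrow> (f x, f y) \<in> E'"
    using assms(3) by (auto simp: graph_isomorphic_def)
  let ?g = "inv_into V f"
  have g: "?g (f x) = x" if "x \<in> V" for x
    using f that by (simp add: bij_betw_inv_into_left)
  have "(f x, f y) \<in> E' ^^ n \<longleftrightarrow> (x, y) \<in> E ^^ n" if xy: "x \<in> V" "y \<in> V" for x y n
  proof
    assume "(x, y) \<in> E ^^ n"
    then show "(f x, f y) \<in> E' ^^ n"
      using relpow_map[of E V f E'] adj connected_graph_facts(1)[OF G] by blast
  next
    assume "(f x, f y) \<in> E' ^^ n"
    moreover have "(?g a, ?g b) \<in> E" if "a \<in> V'" "b \<in> V'" "(a, b) \<in> E'" for a b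
      using adj[of "?g a" "?g b"] that f
      by (metis bij_betw_def bij_betw_inv_into_right inv_into_into)
    ultimately have "(?g (f x), ?g (f y)) \<in> E ^^ n"
      using relpow_map[OF H] by blast
    then show "(x, y) \<in> E ^^ n" using g xy by simp
  qed
  then have "isometry V (graph_dist E) V' (graph_dist E') f"
    using f unfolding isometry_def graph_dist_def by simp
  then show ?thesis by (auto simp: isometric_def)
qed

lemma isometric_imp_graph_isomorphic:
  assumes G: "connected_graph (V, E)" and H: "connected_graph (V', E')"
    and "isometric V (graph_dist E) V' (graph_dist E')"
  shows "graph_isomorphic (V, E) (V', E')"
proof -
  obtain f where f: "bij_betw f V V'"
    and eq: "\<And>x y. x \<in> V \<Longrightarrow> y \<in> V \<Longrightarrow> graph_dist E' (f x) (f y) = graph_dist E x y"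
    using assms(3) by (auto simp: isometric_def isometry_def)
  have "(x, y) \<in> E \<longleftrightarrow> (f x, f y) \<in> E'" if "x \<in> V" "y \<in> V" for x y
    using graph_dist_eq_1[OF G that] graph_dist_eq_1[OF H, of "f x" "f y"] eq[OF that] f that
    by (auto dest: bij_betwE)
  then show ?thesis using f by (auto simp: graph_isomorphic_def)
qed

lemma graph_isomorphic_refl: "graph_isomorphic G G"
  unfolding graph_isomorphic_def by (rule exI[of _ id]) simp

lemma graph_isomorphic_trans:
  assumes "graph_isomorphic G H" "graph_isomorphic H K"
  shows "graph_isomorphic G K"
proof -
  obtain f g where f: "bij_betw f (fst G) (fst H)"
      "\<forall>x\<in>fst G. \<forall>y\<in>fst G. (x, y) \<in> snd G \<longleftrightarrow> (f x, f y) \<in> snd H"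
    and g: "bij_betw g (fst H) (fst K)"
      "\<forall>x\<in>fst H. \<forall>y\<in>fst H. (x, y) \<in> snd H \<longleftrightarrow> (g x, g y) \<in> snd K"
    using assms by (auto simp: graph_isomorphic_def)
  have "bij_betw (g \<circ> f) (fst G) (fst K)" using f(1) g(1) by (rule bij_betw_trans)
  moreover have "\<forall>x\<in>fst G. \<forall>y\<in>fst G. (x, y) \<in> snd G \<longleftrightarrow> ((g \<circ> f) x, (g \<circ> f) y) \<in> snd K"
    using f g by (auto dest: bij_betwE)
  ultimately show ?thesis unfolding graph_isomorphic_def by blast
qed

lemma graph_isomorphic_sym:
  assumes "graph_isomorphic G H"
  shows "graph_isomorphic H G"
proof -
  obtain f where f: "bij_betw f (fst G) (fst H)"
      "\<forall>x\<in>fst G. \<forall>y\<in>fst G. (x, y) \<in> snd G \<longleftrightarrow> (f x, f y) \<in> snd H"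
    using assms by (auto simp: graph_isomorphic_def)
  have "inv_into (fst G) f x \<in> fst G \<and> f (inv_into (fst G) f x) = x" if "x \<in> fst H" for x
    using f(1) that by (metis bij_betw_def bij_betw_inv_into_right inv_into_into)
  then show ?thesis
    unfolding graph_isomorphic_def using bij_betw_inv_into[OF f(1)] f(2)
    by (intro exI[of _ "inv_into (fst G) f"]) metis
qed

text \<open>
  A walk in the product is a shuffle of a walk in each factor, hence distances add up.
\<close>

lemma box_product_relpow:
  assumes "E \<subseteq> V \<times> V" "E' \<subseteq> V' \<times> V'" and "a \<in> V" "b \<in> V'"
  shows "((a, b), (a', b')) \<in> snd (box_product (V, E) (V', E')) ^^ n \<longleftrightarrow>
         (\<exists>p q. n = p + q \<and> (a, a') \<in> E ^^ p \<and> (b, b') \<in> E' ^^ q)"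
proof (induction n arbitrary: a' b')
  case 0
  then show ?case by auto
next
  case (Suc n)
  let ?B = "snd (box_product (V, E) (V', E'))"
  have B: "((c, e), (a', b')) \<in> ?B \<longleftrightarrow>
      c \<in> V \<and> a' \<in> V \<and> e \<in> V' \<and> b' \<in> V' \<and> ((c, a') \<in> E \<and> e = b' \<or> c = a' \<and> (e, b') \<in> E')" for c e
    by (auto simp: box_product_def)
  show ?case
  proof
    assume "((a, b), (a', b')) \<in> ?B ^^ Suc n"
    then obtain c e where 1: "((a, b), (c, e)) \<in> ?B ^^ n" and 2: "((c, e), (a', b')) \<in> ?B"
      by auto
    then obtain p q where pq: "n = p + q" "(a, c) \<in> E ^^ p" "(b, e) \<in> E' ^^ q"
      using Suc.IH by blast
    from 2 consider "(c, a') \<in> E" "e = b'" | "c = a'" "(e, b') \<in> E'" using B by blast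
    then show "\<exists>p q. Suc n = p + q \<and> (a, a') \<in> E ^^ p \<and> (b, b') \<in> E' ^^ q"
    proof cases
      case 1
      then show ?thesis using pq by (intro exI[of _ "Suc p"] exI[of _ q]) auto
    next
      case 2
      then show ?thesis using pq by (intro exI[of _ p] exI[of _ "Suc q"]) auto
    qed
  next
    assume "\<exists>p q. Suc n = p + q \<and> (a, a') \<in> E ^^ p \<and> (b, b') \<in> E' ^^ q"
    then obtain p q where pq: "Suc n = p + q" "(a, a') \<in> E ^^ p" "(b, b') \<in> E' ^^ q" by blast
    have V: "a' \<in> V" "b' \<in> V'"
      using relpow_in_verts[OF assms(1,3) pq(2)] relpow_in_verts[OF assms(2,4) pq(3)] by auto
    show "((a, b), (a', b')) \<in> ?B ^^ Suc n"
    proof (cases p)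
      case 0
      then obtain e where e: "(b, e) \<in> E' ^^ n" "(e, b') \<in> E'" using pq by auto
      then have "((a, b), (a, e)) \<in> ?B ^^ n"
        unfolding Suc.IH by (intro exI[of _ 0] exI[of _ n]) auto
      moreover have "((a, e), (a', b')) \<in> ?B" using B e V 0 pq assms by auto
      ultimately show ?thesis by auto
    next
      case (Suc p')
      then obtain c where c: "(a, c) \<in> E ^^ p'" "(c, a') \<in> E" using pq by auto
      then have "((a, b), (c, b')) \<in> ?B ^^ n" using Suc.IH pq Suc by auto
      moreover have "((c, b'), (a', b')) \<in> ?B" using B c V assms by auto
      ultimately show ?thesis by auto
    qed
  qed
qed

context
  fixes V :: "'a set" and E :: "('a \<times> 'a) set" and V' :: "'b set" and E' :: "('b \<times> 'b) set"
  assumes G: "connected_graph (V, E)" and H: "connected_graph (V', E')"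
begin

lemma box_product_dist:
  assumes "a \<in> V" "a' \<in> V" "b \<in> V'" "b' \<in> V'"
  shows "graph_dist (snd (box_product (V, E) (V', E'))) (a, b) (a', b') =
           sum_metric (graph_dist E) (graph_dist E') (a, b) (a', b')"
  unfolding sum_metric_def fst_conv snd_conv
proof -
  note R = box_product_relpow[OF connected_graph_facts(1)[OF G] connected_graph_facts(1)[OF H]
      assms(1,3)]
  show "graph_dist (snd (box_product (V, E) (V', E'))) (a, b) (a', b') =
      graph_dist E a a' + graph_dist E' b b'"
    unfolding graph_dist_def[of "snd _"]
  proof (rule Least_equality)
    show "((a, b), (a', b')) \<in> snd (box_product (V, E) (V', E')) ^^
        (graph_dist E a a' + graph_dist E' b b')"
      unfolding R using graph_dist_path[OF G] graph_dist_path[OF H] assms by blast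
    fix n assume "((a, b), (a', b')) \<in> snd (box_product (V, E) (V', E')) ^^ n"
    then obtain p q where "n = p + q" "(a, a') \<in> E ^^ p" "(b, b') \<in> E' ^^ q" unfolding R by blast
    then show "graph_dist E a a' + graph_dist E' b b' \<le> n"
      by (simp add: add_mono graph_dist_le)
  qed
qed

lemma connected_box_product: "connected_graph (box_product (V, E) (V', E'))"
  unfolding connected_graph_def
proof (intro conjI ballI)
  let ?P = "box_product (V, E) (V', E')"
  note G' = connected_graph_facts[OF G] and H' = connected_graph_facts[OF H]
  show "snd ?P \<subseteq> fst ?P \<times> fst ?P" by (auto simp: box_product_def)
  show "sym (snd ?P)"
    using G'(2) H'(2) unfolding sym_def box_product_def by auto
  show "irrefl (snd ?P)"
    using G'(3) H'(3) unfolding irrefl_def box_product_def by auto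
  fix x assume "x \<in> fst ?P"
  then obtain a b where x: "x = (a, b)" "a \<in> V" "b \<in> V'" by (auto simp: box_product_def)
  have "snd ?P `` {x} \<subseteq> (E `` {a}) \<times> {b} \<union> {a} \<times> (E' `` {b})"
    by (auto simp: box_product_def x)
  then show "finite (snd ?P `` {x})"
    by (rule finite_subset) (simp add: G'(4) H'(4) x)
  fix y assume "y \<in> fst ?P"
  then obtain a' b' where y: "y = (a', b')" "a' \<in> V" "b' \<in> V'" by (auto simp: box_product_def)
  have "((a, b), (a', b')) \<in> snd ?P ^^ (graph_dist E a a' + graph_dist E' b b')"
    unfolding box_product_relpow[OF G'(1) H'(1) x(2,3)]
    using graph_dist_path[OF G x(2) y(2)] graph_dist_path[OF H x(3) y(3)] by blast
  then show "(x, y) \<in> (snd ?P)\<^sup>*" using x y relpow_imp_rtrancl by metis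
qed

lemma box_product_isometric:
  "isometric (fst (box_product (V, E) (V', E'))) (graph_dist (snd (box_product (V, E) (V', E'))))
     (V \<times> V') (sum_metric (graph_dist E) (graph_dist E'))"
proof -
  have "fst (box_product (V, E) (V', E')) = V \<times> V'" by (simp add: box_product_def)
  then have "isometry (fst (box_product (V, E) (V', E')))
      (graph_dist (snd (box_product (V, E) (V', E')))) (V \<times> V')
      (sum_metric (graph_dist E) (graph_dist E')) id"
    unfolding isometry_def by (auto simp: box_product_dist bij_betw_id)
  then show ?thesis by (auto simp: isometric_def)
qed

end

lemma box_product_cong:
  assumes "graph_isomorphic G G'" "graph_isomorphic H H'"
  shows "graph_isomorphic (box_product G H) (box_product G' H')"
proof -
  obtain f g where f: "bij_betw f (fst G) (fst G')"
      "\<forall>x\<in>fst G. \<forall>y\<in>fst G. (x, y) \<in> snd G \<longleftrightarrow> (f x, f y) \<in> snd G'"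
    and g: "bij_betw g (fst H) (fst H')"
      "\<forall>x\<in>fst H. \<forall>y\<in>fst H. (x, y) \<in> snd H \<longleftrightarrow> (g x, g y) \<in> snd H'"
    using assms by (auto simp: graph_isomorphic_def)
  have inj: "f x = f y \<longleftrightarrow> x = y" if "x \<in> fst G" "y \<in> fst G" for x y
    using f(1) that by (auto simp: bij_betw_def inj_on_def)
  have inj': "g x = g y \<longleftrightarrow> x = y" if "x \<in> fst H" "y \<in> fst H" for x y
    using g(1) that by (auto simp: bij_betw_def inj_on_def)
  have mem: "f x \<in> fst G'" if "x \<in> fst G" for x using f(1) that by (auto dest: bij_betwE)
  have mem': "g x \<in> fst H'" if "x \<in> fst H" for x using g(1) that by (auto dest: bij_betwE)
  show ?thesis unfolding graph_isomorphic_def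
    by (rule exI[of _ "map_prod f g"])
       (auto simp: box_product_def inj inj' mem mem' f(2) g(2) intro!: bij_betw_map_prod f(1) g(1))
qed

text \<open>
  Between connected graphs, isomorphisms and isometries for the path distance are the same thing, so
  \<open>metric_cancellation\<close> applies.
\<close>

theorem box_product_cancel:
  fixes G G' H :: "'a graph"
  assumes "connected_graph G" "connected_graph G'" "connected_graph H"
    and "fst G \<noteq> {}" "fst H \<noteq> {}"
    and "graph_isomorphic (box_product G H) (box_product G' H)"
  shows "graph_isomorphic G G'"
proof -
  obtain V E V' E' W D where eq: "G = (V, E)" "G' = (V', E')" "H = (W, D)"
    by (metis surj_pair)
  note G = assms(1)[unfolded eq] and G' = assms(2)[unfolded eq] and H = assms(3)[unfolded eq]
  let ?P = "box_product (V, E) (W, D)" and ?P' = "box_product (V', E') (W, D)"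
  have "isometric (fst ?P) (graph_dist (snd ?P)) (fst ?P') (graph_dist (snd ?P'))"
    using graph_isomorphic_imp_isometric[of "fst ?P" "snd ?P" "snd ?P'" "fst ?P'"] assms(6)
      connected_box_product[OF G H] connected_box_product[OF G' H]
    by (simp add: connected_graph_def eq)
  then have "isometric (V \<times> W) (sum_metric (graph_dist E) (graph_dist D))
      (V' \<times> W) (sum_metric (graph_dist E') (graph_dist D))"
    by (rule isometric_trans[OF isometric_trans[OF isometric_sym[OF box_product_isometric[OF G H]]]
          box_product_isometric[OF G' H]])
  then have "isometric V (graph_dist E) V' (graph_dist E')"
    using metric_cancellation[OF graph_dist_metric[OF G] graph_dist_metric[OF G']
        graph_dist_metric[OF H] graph_dist_geodesic[OF H] graph_dist_locally_finite[OF H]]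
      assms(4,5) eq by simp
  then show ?thesis
    unfolding eq by (rule isometric_imp_graph_isomorphic[OF G G'])
qed

section \<open>Derivations and free generating sets\<close>

lemma is_subringD:
  assumes "is_subring S"
  shows "0 \<in> S" "1 \<in> S" "\<And>x y. x \<in> S \<Longrightarrow> y \<in> S \<Longrightarrow> x - y \<in> S"
    "\<And>x y. x \<in> S \<Longrightarrow> y \<in> S \<Longrightarrow> x * y \<in> S"
    "\<And>x. x \<in> S \<Longrightarrow> - x \<in> S" "\<And>x y. x \<in> S \<Longrightarrow> y \<in> S \<Longrightarrow> x + y \<in> S"
proof -
  show *: "1 \<in> S" "\<And>x y. x \<in> S \<Longrightarrow> y \<in> S \<Longrightarrow> x - y \<in> S"
    "\<And>x y. x \<in> S \<Longrightarrow> y \<in> S \<Longrightarrow> x * y \<in> S"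
    using assms by (auto simp: is_subring_def)
  show 0: "0 \<in> S" using *(2)[OF *(1) *(1)] by simp
  show neg: "- x \<in> S" if "x \<in> S" for x using *(2)[OF 0 that] by simp
  show "x + y \<in> S" if "x \<in> S" "y \<in> S" for x y using *(2)[OF that(1) neg[OF that(2)]] by simp
qed

lemma is_subfieldD:
  assumes "is_subfield S"
  shows "is_subring S" "0 \<in> S" "1 \<in> S" "\<And>x y. x \<in> S \<Longrightarrow> y \<in> S \<Longrightarrow> x - y \<in> S"
    "\<And>x y. x \<in> S \<Longrightarrow> y \<in> S \<Longrightarrow> x * y \<in> S"
    "\<And>x. x \<in> S \<Longrightarrow> - x \<in> S" "\<And>x y. x \<in> S \<Longrightarrow> y \<in> S \<Longrightarrow> x + y \<in> S"
    "\<And>x. x \<in> S \<Longrightarrow> inverse x \<in> S" "\<And>x y. x \<in> S \<Longrightarrow> y \<in> S \<Longrightarrow> x / y \<in> S"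
proof -
  show 1: "is_subring S" using assms by (simp add: is_subfield_def)
  show inv: "\<And>x. x \<in> S \<Longrightarrow> inverse x \<in> S" using assms by (simp add: is_subfield_def)
  show "\<And>x y. x \<in> S \<Longrightarrow> y \<in> S \<Longrightarrow> x / y \<in> S"
    using inv is_subringD(4)[OF 1] by (simp add: divide_inverse)
qed (use assms is_subringD in \<open>auto simp: is_subfield_def\<close>)

lemma is_subfieldI:
  assumes "1 \<in> S" "\<And>x y. x \<in> S \<Longrightarrow> y \<in> S \<Longrightarrow> x - y \<in> S"
    "\<And>x y. x \<in> S \<Longrightarrow> y \<in> S \<Longrightarrow> x * y \<in> S" "\<And>x. x \<in> S \<Longrightarrow> inverse x \<in> S"
  shows "is_subfield S"
  using assms by (simp add: is_subfield_def is_subring_def)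

lemma subfield_prod_mset:
  "is_subfield S \<Longrightarrow> (\<And>x. x \<in># M \<Longrightarrow> f x \<in> S) \<Longrightarrow> (\<Prod>x\<in>#M. f x) \<in> S"
  by (induction M) (auto intro: is_subfieldD)

lemma field_generated_subfield: "is_subfield (field_generated X)"
  unfolding field_generated_def
  by (rule hull_in) (auto simp: is_subfield_def is_subring_def)

lemma field_generated_superset: "X \<subseteq> field_generated X"
  unfolding field_generated_def by (rule hull_subset)

lemma field_generated_minimal: "X \<subseteq> S \<Longrightarrow> is_subfield S \<Longrightarrow> field_generated X \<subseteq> S"
  unfolding field_generated_def by (rule hull_minimal)

lemma field_generated_mono: "X \<subseteq> Y \<Longrightarrow> field_generated X \<subseteq> field_generated Y"
  unfolding field_generated_def by (rule hull_mono)

lemma field_generated_subset: "X \<subseteq> field_generated Y \<Longrightarrow> field_generated X \<subseteq> field_generated Y"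
  by (rule field_generated_minimal) (auto intro: field_generated_subfield)

lemma field_generated_eqI:
  "X \<subseteq> field_generated Y \<Longrightarrow> Y \<subseteq> field_generated X \<Longrightarrow> field_generated X = field_generated Y"
  by (intro equalityI field_generated_subset)

lemma field_generated_Un_left: "field_generated (field_generated X \<union> Y) = field_generated (X \<union> Y)"
  unfolding field_generated_def by (rule hull_Un_left[symmetric])

text \<open>
  A derivation matters on \<open>F\<close> only; its values may lie outside \<open>F\<close>, and no extension to the whole
  type is required.
\<close>

definition derivation_on :: "'f::field_char_0 set \<Rightarrow> ('f \<Rightarrow> 'f) \<Rightarrow> bool" where
  "derivation_on F D \<longleftrightarrow>
     (\<forall>x\<in>F. \<forall>y\<in>F. D (x + y) = D x + D y \<and> D (x * y) = D x * y + x * D y)"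

lemma derivation_on_subset: "derivation_on F D \<Longrightarrow> K \<subseteq> F \<Longrightarrow> derivation_on K D"
  unfolding derivation_on_def by (simp add: subset_iff)

lemma derivation_on_linear_combination:
  assumes "\<And>j. j \<in> J \<Longrightarrow> derivation_on F (D j)"
  shows "derivation_on F (\<lambda>x. \<Sum>j\<in>J. c j * D j x)"
  unfolding derivation_on_def
proof (intro ballI conjI)
  fix x y assume xy: "x \<in> F" "y \<in> F"
  show "(\<Sum>j\<in>J. c j * D j (x + y)) = (\<Sum>j\<in>J. c j * D j x) + (\<Sum>j\<in>J. c j * D j y)"
    unfolding sum.distrib[symmetric]
    by (intro sum.cong refl) (use assms xy in \<open>simp add: derivation_on_def distrib_left\<close>)
  show "(\<Sum>j\<in>J. c j * D j (x * y)) = (\<Sum>j\<in>J. c j * D j x) * y + x * (\<Sum>j\<in>J. c j * D j y)"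
    unfolding sum_distrib_left sum_distrib_right sum.distrib[symmetric]
    by (intro sum.cong refl) (use assms xy in \<open>simp add: derivation_on_def algebra_simps\<close>)
qed

context
  fixes R :: "'f::field_char_0 set" and D :: "'f \<Rightarrow> 'f"
  assumes R: "is_subring R" and D: "derivation_on R D"
begin

lemma derivation_add: "x \<in> R \<Longrightarrow> y \<in> R \<Longrightarrow> D (x + y) = D x + D y"
  and derivation_mult: "x \<in> R \<Longrightarrow> y \<in> R \<Longrightarrow> D (x * y) = D x * y + x * D y"
  using D by (auto simp: derivation_on_def)

lemma derivation_0: "D 0 = 0"
  using derivation_add[of 0 0] is_subringD(1)[OF R] by simp

lemma derivation_1: "D 1 = 0"
  using derivation_mult[of 1 1] is_subringD(2)[OF R] by simp

lemma derivation_diff: "x \<in> R \<Longrightarrow> y \<in> R \<Longrightarrow> D (x - y) = D x - D y"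
  using derivation_add[of "x - y" y] is_subringD(3)[OF R] by simp

lemma derivation_sum:
  "finite J \<Longrightarrow> (\<And>j. j \<in> J \<Longrightarrow> f j \<in> R) \<Longrightarrow> D (\<Sum>j\<in>J. f j) = (\<Sum>j\<in>J. D (f j)) \<and> (\<Sum>j\<in>J. f j) \<in> R"
proof (induction J rule: finite_induct)
  case empty
  then show ?case using derivation_0 is_subringD(1)[OF R] by simp
next
  case (insert j J)
  then show ?case using derivation_add[of "f j" "sum f J"] is_subringD(6)[OF R] by simp
qed

lemma derivation_log_prod_mset:
  assumes "\<And>x. x \<in># M \<Longrightarrow> f x \<in> R" "\<And>x. x \<in># M \<Longrightarrow> D (f x) = a x * f x"
  shows "D (\<Prod>x\<in>#M. f x) = (\<Sum>x\<in>#M. a x) * (\<Prod>x\<in>#M. f x) \<and> (\<Prod>x\<in>#M. f x) \<in> R"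
  using assms
proof (induction M)
  case empty
  then show ?case using derivation_1 is_subringD(2)[OF R] by simp
next
  case (add x M)
  then have "(\<Prod>x\<in>#M. f x) \<in> R" "D (\<Prod>x\<in>#M. f x) = (\<Sum>x\<in>#M. a x) * (\<Prod>x\<in>#M. f x)"
    "f x \<in> R" "D (f x) = a x * f x" by auto
  then show ?case
    using derivation_mult[of "f x" "\<Prod>x\<in>#M. f x"] is_subringD(4)[OF R]
    by (simp add: algebra_simps)
qed

end

lemma derivation_inverse:
  assumes F: "is_subfield F" and D: "derivation_on F D" and "x \<in> F"
  shows "D (inverse x) = - D x / (x * x)"
proof (cases "x = 0")
  case True
  then show ?thesis using derivation_0[OF is_subfieldD(1)[OF F] D] by simp
next
  case False
  have "D (x * inverse x) = D x * inverse x + x * D (inverse x)"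
    using derivation_mult[OF is_subfieldD(1)[OF F] D] assms(3) is_subfieldD(8)[OF F] by blast
  then show ?thesis
    using False derivation_1[OF is_subfieldD(1)[OF F] D] by (simp add: field_simps eq_neg_iff_add_eq_0)
qed

context
  fixes F :: "'f::field_char_0 set" and D :: "'f \<Rightarrow> 'f"
  assumes F: "is_subfield F" and D: "derivation_on F D"
begin

lemma derivation_divide_constant:
  assumes "c \<in> F" "x \<in> F" "D c = 0"
  shows "D (c / x) = - (c * D x) / (x * x)"
  using derivation_mult[OF is_subfieldD(1)[OF F] D assms(1) is_subfieldD(8)[OF F assms(2)]]
    derivation_inverse[OF F D assms(2)] assms(3)
  by (simp add: divide_inverse)

lemma derivations_agree_subfield:
  assumes E: "derivation_on F E"
  shows "is_subfield {x \<in> F. D x = E x}"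
proof -
  note R = is_subfieldD(1)[OF F]
  show ?thesis
    using derivation_1[OF R D] derivation_1[OF R E] derivation_diff[OF R D] derivation_diff[OF R E]
      derivation_mult[OF R D] derivation_mult[OF R E] derivation_inverse[OF F D] derivation_inverse[OF F E]
    by (intro is_subfieldI) (auto simp: is_subfieldD[OF F])
qed

text \<open>
  The points at which two derivations agree form a subfield.
\<close>

lemma derivations_agree_on_generated:
  assumes "derivation_on F E" "field_generated X \<subseteq> F" "\<And>x. x \<in> X \<Longrightarrow> D x = E x"
    and "x \<in> field_generated X"
  shows "D x = E x"
proof -
  have "field_generated X \<subseteq> {x \<in> F. D x = E x}"
    using assms field_generated_superset
    by (intro field_generated_minimal derivations_agree_subfield) auto
  then show ?thesis using assms(4) by auto
qed

lemma derivation_vanishes_on_generated: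
  assumes "field_generated X \<subseteq> F" "\<And>x. x \<in> X \<Longrightarrow> D x = 0" "x \<in> field_generated X"
  shows "D x = 0"
  using derivations_agree_on_generated[of "\<lambda>_. 0"] assms by (simp add: derivation_on_def)

lemma derivation_kernel_subfield: "is_subfield {x \<in> F. D x = 0}"
  using derivations_agree_subfield[of "\<lambda>_. 0"] by (simp add: derivation_on_def)

end

lemma subfield_of_rat:
  assumes "is_subfield (S :: 'f::field_char_0 set)"
  shows "of_rat q \<in> S"
proof -
  have nat: "of_nat n \<in> S" for n
    by (induction n) (auto intro: is_subfieldD[OF assms])
  have "of_int k \<in> S" for k
    by (cases k rule: int_diff_cases) (auto intro: is_subfieldD[OF assms] nat)
  moreover obtain a b where "q = Fract a b" "b > 0" by (cases q) auto
  ultimately show ?thesis by (auto simp: of_rat_rat intro: is_subfieldD[OF assms])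
qed

lemma derivation_of_rat:
  assumes "is_subfield F" "derivation_on F D"
  shows "D (of_rat q) = 0"
  using subfield_of_rat[OF derivation_kernel_subfield[OF assms]] by simp

lemma subring_fractions_subfield:
  assumes "is_subring (R :: 'f::field_char_0 set)"
  shows "is_subfield {a / b |a b. a \<in> R \<and> b \<in> R \<and> b \<noteq> 0}" (is "is_subfield ?F")
proof (rule is_subfieldI)
  note R = is_subringD[OF assms]
  show "1 \<in> ?F" using R by (auto intro!: exI[of _ 1])
  fix x y assume "x \<in> ?F" "y \<in> ?F"
  then obtain a b c d where *: "x = a / b" "y = c / d" "a \<in> R" "b \<in> R" "c \<in> R" "d \<in> R"
    "b \<noteq> 0" "d \<noteq> 0" by auto
  have "x - y = (a * d - c * b) / (b * d)" "x * y = (a * c) / (b * d)"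
    using * by (auto simp: field_simps)
  moreover have "a * d - c * b \<in> R" "a * c \<in> R" "b * d \<in> R" "b * d \<noteq> 0"
    using * R by auto
  ultimately show "x - y \<in> ?F" "x * y \<in> ?F" by blast+
next
  note R = is_subringD[OF assms]
  fix x assume "x \<in> ?F"
  then obtain a b where *: "x = a / b" "a \<in> R" "b \<in> R" "b \<noteq> 0" by auto
  show "inverse x \<in> ?F"
  proof (cases "a = 0")
    case True
    then have "inverse x = 0 / 1 \<and> 0 \<in> R \<and> 1 \<in> R \<and> (1 :: 'f) \<noteq> 0" using * R(1,2) by simp
    then show ?thesis by blast
  next
    case False
    then have "inverse x = b / a" using * by simp
    then show ?thesis using * False by blast
  qed
qed

lemma derivation_extends_to_fractions:
  assumes R: "is_subring (R :: 'f::field_char_0 set)" and \<theta>: "derivation_on R \<theta>"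
  shows "\<exists>D. derivation_on {a / b |a b. a \<in> R \<and> b \<in> R \<and> b \<noteq> 0} D \<and> (\<forall>x\<in>R. D x = \<theta> x)"
proof -
  let ?F = "{a / b |a b. a \<in> R \<and> b \<in> R \<and> b \<noteq> 0}"
  define good where "good x p \<longleftrightarrow> fst p \<in> R \<and> snd p \<in> R \<and> snd p \<noteq> 0 \<and> x = fst p / snd p" for x p
  define val where "val p = (\<theta> (fst p) * snd p - fst p * \<theta> (snd p)) / (snd p * snd p)" for p
  define D where "D x = val (SOME p. good x p)" for x
  note mult = derivation_mult[OF R \<theta>] and add = derivation_add[OF R \<theta>] and R' = is_subringD[OF R]
  have D: "D (a / b) = (\<theta> a * b - a * \<theta> b) / (b * b)" if ab: "a \<in> R" "b \<in> R" "b \<noteq> 0" for a b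
  proof -
    define p where "p = (SOME p. good (a / b) p)"
    have "good (a / b) p"
      unfolding p_def by (rule someI[of _ "(a, b)"]) (use ab in \<open>simp add: good_def\<close>)
    then obtain c d where p: "p = (c, d)" "c \<in> R" "d \<in> R" "d \<noteq> 0" and eq: "a / b = c / d"
      by (cases p) (auto simp: good_def)
    have cross: "a * d = c * b" using eq ab p by (simp add: field_simps)
    then have "\<theta> (a * d) = \<theta> (c * b)" by simp
    then have "\<theta> a * d + a * \<theta> d = \<theta> c * b + c * \<theta> b" using mult ab p by simp
    then have "(\<theta> c * d - c * \<theta> d) * (b * b) = (\<theta> a * b - a * \<theta> b) * (d * d)"
      using cross by algebra
    then have "(\<theta> c * d - c * \<theta> d) / (d * d) = (\<theta> a * b - a * \<theta> b) / (b * b)"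
      using ab p by (simp add: frac_eq_eq)
    then show ?thesis unfolding D_def p_def[symmetric] val_def p by simp
  qed
  show ?thesis
  proof (intro exI[of _ D] conjI ballI)
    show "D x = \<theta> x" if "x \<in> R" for x
      using D[OF that R'(2)] derivation_1[OF R \<theta>] by simp
    show "derivation_on ?F D"
      unfolding derivation_on_def
    proof (intro ballI)
      fix x y assume "x \<in> ?F" "y \<in> ?F"
      then obtain a b c d where *: "x = a / b" "y = c / d" "a \<in> R" "b \<in> R" "c \<in> R" "d \<in> R"
        "b \<noteq> 0" "d \<noteq> 0" by auto
      have xy: "x + y = (a * d + c * b) / (b * d)" "x * y = (a * c) / (b * d)"
        using * by (auto simp: field_simps)
      have mem: "a * d \<in> R" "c * b \<in> R" "a * d + c * b \<in> R" "a * c \<in> R" "b * d \<in> R" "b * d \<noteq> 0"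
        using * R' by auto
      have 1: "D (x + y) = (\<theta> (a * d + c * b) * (b * d) - (a * d + c * b) * \<theta> (b * d)) / (b * d * (b * d))"
        "D (x * y) = (\<theta> (a * c) * (b * d) - (a * c) * \<theta> (b * d)) / (b * d * (b * d))"
        unfolding xy by (rule D; fact)+
      have 2: "D x = (\<theta> a * b - a * \<theta> b) / (b * b)" "D y = (\<theta> c * d - c * \<theta> d) / (d * d)"
        unfolding *(1,2) by (rule D; fact)+
      have 3: "\<theta> (a * d + c * b) = \<theta> a * d + a * \<theta> d + (\<theta> c * b + c * \<theta> b)"
        "\<theta> (b * d) = \<theta> b * d + b * \<theta> d" "\<theta> (a * c) = \<theta> a * c + a * \<theta> c"
        using * mem by (simp_all add: add mult)
      show "D (x + y) = D x + D y \<and> D (x * y) = D x * y + x * D y"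
        unfolding 1 2 3 unfolding *(1,2) using *(7,8) by (simp add: field_simps)
    qed
  qed
qed

text \<open>
  Linear extension of a function \<open>f\<close> from monomials to polynomials.  It is used with monomials
  evaluated at a tuple, which gives polynomial evaluation, and with these weighted by an exponent,
  which gives an Euler operator.
\<close>

lemma linear_combination_of_monomials:
  fixes f :: "('v \<Rightarrow>\<^sub>0 nat) \<Rightarrow> 'f::field_char_0"
  defines "L \<equiv> \<lambda>p :: ('v \<Rightarrow>\<^sub>0 nat) \<Rightarrow>\<^sub>0 rat.
      \<Sum>m\<in>Poly_Mapping.keys p. of_rat (Poly_Mapping.lookup p m) * f m"
  shows "finite S \<Longrightarrow> Poly_Mapping.keys p \<subseteq> S \<Longrightarrow>
      L p = (\<Sum>m\<in>S. of_rat (Poly_Mapping.lookup p m) * f m)"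
    and combination_add: "L (p + q) = L p + L q"
    and combination_diff: "L (p - q) = L p - L q"
    and combination_single: "L (Poly_Mapping.single m c) = of_rat c * f m"
    and combination_mult: "L (p * q) =
      (\<Sum>m\<in>Poly_Mapping.keys p. \<Sum>m'\<in>Poly_Mapping.keys q.
         of_rat (Poly_Mapping.lookup p m) * of_rat (Poly_Mapping.lookup q m') * f (m + m'))"
proof -
  show super: "L p = (\<Sum>m\<in>S. of_rat (Poly_Mapping.lookup p m) * f m)"
    if "finite S" "Poly_Mapping.keys p \<subseteq> S" for p S
    unfolding L_def using that
    by (intro sum.mono_neutral_left) (auto simp: in_keys_iff)
  show add: "L (p + q) = L p + L q" for p q
  proof -
    let ?S = "Poly_Mapping.keys p \<union> Poly_Mapping.keys q"
    have "Poly_Mapping.keys (p + q) \<subseteq> ?S" by (rule Poly_Mapping.keys_add)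
    then show ?thesis
      by (simp add: super[of ?S] lookup_add of_rat_add sum.distrib[symmetric] distrib_right)
  qed
  show "L (p - q) = L p - L q" for p q
    using add[of "p - q" q] by simp
  show single: "L (Poly_Mapping.single m c) = of_rat c * f m" for m c
    by (simp add: super[of "{m}"])
  have sum: "L (\<Sum>x\<in>X. g x) = (\<Sum>x\<in>X. L (g x))" if "finite X" for g and X :: "'c set"
    using that by (induction X rule: finite_induct) (simp_all add: add, simp add: L_def)
  have decomp: "p = (\<Sum>m\<in>Poly_Mapping.keys p. Poly_Mapping.single m (Poly_Mapping.lookup p m))"
    for p :: "('v \<Rightarrow>\<^sub>0 nat) \<Rightarrow>\<^sub>0 rat"
    by (rule poly_mapping_eqI)
       (simp add: lookup_sum lookup_single when_def in_keys_iff sum.delta')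
  have "p * q = (\<Sum>m\<in>Poly_Mapping.keys p. \<Sum>m'\<in>Poly_Mapping.keys q.
      Poly_Mapping.single (m + m') (Poly_Mapping.lookup p m * Poly_Mapping.lookup q m'))"
    by (subst decomp[of p], subst decomp[of q]) (simp add: sum_product mult_single)
  then show "L (p * q) =
      (\<Sum>m\<in>Poly_Mapping.keys p. \<Sum>m'\<in>Poly_Mapping.keys q.
         of_rat (Poly_Mapping.lookup p m) * of_rat (Poly_Mapping.lookup q m') * f (m + m'))"
    by (simp add: sum single of_rat_mult)
qed

definition monomial :: "('v \<Rightarrow> 'f::field_char_0) \<Rightarrow> ('v \<Rightarrow>\<^sub>0 nat) \<Rightarrow> 'f" where
  "monomial u m = (\<Prod>x\<in>Poly_Mapping.keys m. u x ^ Poly_Mapping.lookup m x)"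

lemma eval_poly_monomial:
  "eval_poly u p = (\<Sum>m\<in>Poly_Mapping.keys p. of_rat (Poly_Mapping.lookup p m) * monomial u m)"
  by (simp add: eval_poly_def monomial_def)

lemma monomial_add: "monomial u (m + m') = monomial u m * monomial u m'"
proof -
  let ?S = "Poly_Mapping.keys m \<union> Poly_Mapping.keys m'"
  have super: "monomial u k = (\<Prod>x\<in>?S. u x ^ Poly_Mapping.lookup k x)"
    if "Poly_Mapping.keys k \<subseteq> ?S" for k
    unfolding monomial_def using that by (intro prod.mono_neutral_left) (auto simp: in_keys_iff)
  have "Poly_Mapping.keys (m + m') \<subseteq> ?S" by (rule Poly_Mapping.keys_add)
  then show ?thesis
    by (simp add: super lookup_add power_add prod.distrib)
qed

text \<open>
  The partial derivatives with respect to the tuple \<open>u\<close>.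
\<close>

definition dual_derivations ::
    "'f::field_char_0 set \<Rightarrow> 'v set \<Rightarrow> ('v \<Rightarrow> 'f) \<Rightarrow> ('v \<Rightarrow> 'f \<Rightarrow> 'f) \<Rightarrow> bool" where
  "dual_derivations F I u D \<longleftrightarrow>
     (\<forall>i\<in>I. derivation_on F (D i) \<and> (\<forall>j\<in>I. D i (u j) = (if j = i then 1 else 0)))"

text \<open>
  A monomial is an eigenvector of the Euler operator \<open>u i * D i\<close>, with its exponent of \<open>u i\<close> as
  eigenvalue.
\<close>

lemma dual_derivation_monomial:
  assumes F: "is_subfield F" "u ` I \<subseteq> F" and D: "dual_derivations F I u D" and i: "i \<in> I"
    and m: "Poly_Mapping.keys m \<subseteq> I"
  shows "u i * D i (monomial u m) = of_nat (Poly_Mapping.lookup m i) * monomial u m \<and> monomial u m \<in> F"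
proof -
  note R = is_subfieldD(1)[OF F(1)]
  have Di: "derivation_on F (D i)" and dual: "\<And>j. j \<in> I \<Longrightarrow> D i (u j) = (if j = i then 1 else 0)"
    using D i by (auto simp: dual_derivations_def)
  have pow: "u i * D i (u x ^ n) = (if x = i then of_nat n else 0) * u x ^ n \<and> u x ^ n \<in> F"
    if "x \<in> I" for x n
  proof (induction n)
    case 0
    then show ?case using derivation_1[OF R Di] is_subfieldD(3)[OF F(1)] by simp
  next
    case (Suc n)
    have "u x \<in> F" using that F by auto
    then show ?case
      using Suc derivation_mult[OF R Di, of "u x" "u x ^ n"] dual[OF that] is_subfieldD(5)[OF F(1)]
      by (auto simp: algebra_simps)
  qed
  have "u i * D i (\<Prod>x\<in>K. u x ^ e x) = (if i \<in> K then of_nat (e i) else 0) * (\<Prod>x\<in>K. u x ^ e x)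
      \<and> (\<Prod>x\<in>K. u x ^ e x) \<in> F" if "finite K" "K \<subseteq> I" for K e
    using that
  proof (induction K rule: finite_induct)
    case empty
    then show ?case using derivation_1[OF R Di] is_subfieldD(3)[OF F(1)] by simp
  next
    case (insert x K)
    then have IH: "u i * D i (\<Prod>x\<in>K. u x ^ e x) =
        (if i \<in> K then of_nat (e i) else 0) * (\<Prod>x\<in>K. u x ^ e x)" "(\<Prod>x\<in>K. u x ^ e x) \<in> F"
      and x: "x \<in> I" by auto
    have "u i * D i (u x ^ e x * (\<Prod>x\<in>K. u x ^ e x)) =
        (u i * D i (u x ^ e x)) * (\<Prod>x\<in>K. u x ^ e x) + u x ^ e x * (u i * D i (\<Prod>x\<in>K. u x ^ e x))"
      unfolding derivation_mult[OF R Di conjunct2[OF pow[OF x]] IH(2)] by (simp add: algebra_simps)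
    also have "\<dots> = (if i \<in> insert x K then of_nat (e i) else 0) * (u x ^ e x * (\<Prod>x\<in>K. u x ^ e x))"
      by (simp only: pow[OF x, THEN conjunct1] IH(1))
         (use insert.hyps in \<open>auto simp: algebra_simps\<close>)
    finally show ?case
      using insert.hyps is_subfieldD(5)[OF F(1)] pow[OF x] IH by simp
  qed
  from this[of "Poly_Mapping.keys m" "Poly_Mapping.lookup m"] show ?thesis
    using m by (auto simp: monomial_def in_keys_iff)
qed

lemma dual_derivations_nonzero:
  assumes "is_subfield F" "dual_derivations F I u D" "i \<in> I"
  shows "u i \<noteq> 0"
proof
  assume "u i = 0"
  moreover have "derivation_on F (D i)" "D i (u i) = 1"
    using assms(2,3) by (simp_all add: dual_derivations_def)
  ultimately show False
    using derivation_0[OF is_subfieldD(1)[OF assms(1)], of "D i"] by simp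
qed

text \<open>
  Distinct monomials have distinct systems of eigenvalues for the Euler operators, and in
  characteristic 0 these remain distinct in the field.  So monomials are linearly independent, by the
  usual argument for eigenvectors.
\<close>

lemma dual_derivations_imp_algebraically_independent:
  assumes F: "is_subfield F" "u ` I \<subseteq> F" and D: "dual_derivations F I u D"
  shows "algebraically_independent I u"
proof -
  note R = is_subfieldD(1)[OF F(1)]
  have indep: "\<forall>m\<in>S. c m = 0"
    if "finite S" "\<And>m. m \<in> S \<Longrightarrow> Poly_Mapping.keys m \<subseteq> I"
      "(\<Sum>m\<in>S. of_rat (c m) * monomial u m) = 0" for S c
    using that
  proof (induction S arbitrary: c rule: finite_induct)
    case (insert m0 S)
    have mon: "u i * D i (monomial u m) = of_nat (Poly_Mapping.lookup m i) * monomial u m"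
      "monomial u m \<in> F" if "i \<in> I" "m \<in> insert m0 S" for i m
      using dual_derivation_monomial[OF F D that(1) insert.prems(1)[OF that(2)]] by auto
    have monF: "monomial u m \<in> F" if "m \<in> insert m0 S" for m
    proof (cases "I = {}")
      case True
      then have "m = 0" using insert.prems(1)[OF that] by simp
      then show ?thesis using is_subfieldD(3)[OF F(1)] by (simp add: monomial_def)
    qed (use mon that in blast)
    have rat: "of_rat q \<in> F" for q by (rule subfield_of_rat[OF F(1)])
    \<comment> \<open>Apply an Euler operator that separates \<open>m\<close> from \<open>m0\<close> and subtract the eigenvalue of \<open>m0\<close> times the relation.\<close>
    have S: "c m = 0" if m: "m \<in> S" for m
    proof -
      have "m \<noteq> m0" using insert.hyps m by auto
      then obtain i where i: "Poly_Mapping.lookup m i \<noteq> Poly_Mapping.lookup m0 i"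
        by (metis poly_mapping_eqI)
      then have "i \<in> Poly_Mapping.keys m \<or> i \<in> Poly_Mapping.keys m0"
        by (auto simp: in_keys_iff)
      then have iI: "i \<in> I" using insert.prems(1) m by blast
      have Di: "derivation_on F (D i)" using D iI by (simp add: dual_derivations_def)
      have euler: "u i * D i (of_rat (c k) * monomial u k) =
          of_rat (c k) * of_nat (Poly_Mapping.lookup k i) * monomial u k" if "k \<in> insert m0 S" for k
        using derivation_mult[OF R Di rat monF[OF that], of "c k"] mon(1)[OF iI that]
          derivation_of_rat[OF F(1) Di] by (simp add: algebra_simps)
      have "0 = u i * D i (\<Sum>k\<in>insert m0 S. of_rat (c k) * monomial u k)"
        using insert.prems(2) derivation_0[OF R Di] by simp
      also have "\<dots> = (\<Sum>k\<in>insert m0 S. u i * D i (of_rat (c k) * monomial u k))"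
        using derivation_sum[OF R Di, of "insert m0 S" "\<lambda>k. of_rat (c k) * monomial u k"]
          insert.hyps(1) rat monF is_subfieldD(5)[OF F(1)]
        by (simp only: sum_distrib_left) (simp add: sum_distrib_left)
      also have "\<dots> = (\<Sum>k\<in>insert m0 S. of_rat (c k) * of_nat (Poly_Mapping.lookup k i) * monomial u k)"
        using euler by (intro sum.cong) auto
      finally have "0 = (\<Sum>k\<in>insert m0 S. of_rat (c k) * of_nat (Poly_Mapping.lookup k i) * monomial u k)
          - of_nat (Poly_Mapping.lookup m0 i) * (\<Sum>k\<in>insert m0 S. of_rat (c k) * monomial u k)"
        using insert.prems(2) by simp
      also have "\<dots> = (\<Sum>k\<in>insert m0 S. of_rat (c k) *
          (of_nat (Poly_Mapping.lookup k i) - of_nat (Poly_Mapping.lookup m0 i)) * monomial u k)"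
        unfolding sum_distrib_left sum_subtractf[symmetric]
        by (intro sum.cong) (auto simp: algebra_simps)
      also have "\<dots> = (\<Sum>k\<in>S. of_rat (c k *
          (of_nat (Poly_Mapping.lookup k i) - of_nat (Poly_Mapping.lookup m0 i))) * monomial u k)"
        using insert.hyps by (simp add: of_rat_mult of_rat_diff)
      finally have "\<forall>k\<in>S. c k * (of_nat (Poly_Mapping.lookup k i) - of_nat (Poly_Mapping.lookup m0 i)) = 0"
        using insert.IH[of "\<lambda>k. c k * (of_nat (Poly_Mapping.lookup k i) - of_nat (Poly_Mapping.lookup m0 i))"]
          insert.prems(1) by (metis (no_types, lifting) insertCI)
      then show ?thesis using m i by auto
    qed
    then have "of_rat (c m0) * monomial u m0 = 0"
      using insert.prems(2) insert.hyps by simp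
    moreover have "monomial u m0 \<noteq> 0"
      using dual_derivations_nonzero[OF F(1) D] insert.prems(1)[of m0]
      by (auto simp: monomial_def)
    ultimately have "c m0 = 0" by simp
    then show ?case using S by simp
  qed simp
  show ?thesis
    unfolding algebraically_independent_def
  proof (intro allI impI, elim conjE)
    fix p assume "\<forall>m\<in>Poly_Mapping.keys p. Poly_Mapping.keys m \<subseteq> I" "eval_poly u p = 0"
    then have "\<forall>m\<in>Poly_Mapping.keys p. Poly_Mapping.lookup p m = 0"
      using indep[of "Poly_Mapping.keys p" "Poly_Mapping.lookup p"] by (simp add: eval_poly_monomial)
    then show "p = 0" by (metis in_keys_iff lookup_zero poly_mapping_eqI)
  qed
qed

text \<open>
  Independence makes the polynomial that represents an element of the ring generated by \<open>u\<close> unique,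
  so the Euler operator of \<open>u i\<close> is well defined on this ring.  It extends to the field of fractions by
  the quotient rule, and division by \<open>u i\<close> turns it into the partial derivative.
\<close>

lemma algebraically_independent_imp_derivation:
  fixes u :: "'v \<Rightarrow> 'f::field_char_0"
  assumes AI: "algebraically_independent I u" and i: "i \<in> I"
  shows "\<exists>D. derivation_on (field_generated (u ` I)) D \<and> (\<forall>j\<in>I. D (u j) = (if j = i then 1 else 0))"
proof -
  define P where "P = {p :: ('v \<Rightarrow>\<^sub>0 nat) \<Rightarrow>\<^sub>0 rat. \<forall>m\<in>Poly_Mapping.keys p. Poly_Mapping.keys m \<subseteq> I}"
  define R where "R = eval_poly u ` P"
  define e where "e m = of_nat (Poly_Mapping.lookup m i) * monomial u m" for m
  define L where "L p = (\<Sum>m\<in>Poly_Mapping.keys p. of_rat (Poly_Mapping.lookup p m) * e m)"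
    for p :: "('v \<Rightarrow>\<^sub>0 nat) \<Rightarrow>\<^sub>0 rat"
  \<comment> \<open>The Euler operator on the ring \<open>R\<close>, through a choice of representing polynomial.\<close>
  define \<theta> where "\<theta> x = L (SOME p. p \<in> P \<and> eval_poly u p = x)" for x
  have eval_diff: "eval_poly u (p - q) = eval_poly u p - eval_poly u q" for p q
    unfolding eval_poly_monomial by (rule combination_diff)
  have eval_add: "eval_poly u (p + q) = eval_poly u p + eval_poly u q" for p q
    unfolding eval_poly_monomial by (rule combination_add)
  have L_add: "L (p + q) = L p + L q" for p q
    unfolding L_def by (rule combination_add)
  have eval_mult: "eval_poly u (p * q) = eval_poly u p * eval_poly u q" for p q
    unfolding eval_poly_monomial
    by (subst combination_mult) (simp add: sum_product monomial_add mult_ac)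
  have L_mult: "L (p * q) = L p * eval_poly u q + eval_poly u p * L q" for p q
    unfolding eval_poly_monomial L_def
    by (subst combination_mult)
       (unfold sum_product sum.distrib[symmetric],
        intro sum.cong refl, simp add: monomial_add e_def lookup_add algebra_simps)
  have eval_1: "eval_poly u 1 = 1" by (simp add: eval_poly_monomial monomial_def)
  have eval_single: "eval_poly u (Poly_Mapping.single m 1) = monomial u m" for m
    unfolding eval_poly_monomial by (subst combination_single) simp
  have L_single: "L (Poly_Mapping.single m 1) = e m" for m
    unfolding L_def by (subst combination_single) simp
  have P: "1 \<in> P" "\<And>p q. p \<in> P \<Longrightarrow> q \<in> P \<Longrightarrow> p + q \<in> P" "\<And>p q. p \<in> P \<Longrightarrow> q \<in> P \<Longrightarrow> p - q \<in> P"
    "\<And>p q. p \<in> P \<Longrightarrow> q \<in> P \<Longrightarrow> p * q \<in> P"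
  proof -
    show "1 \<in> P" by (auto simp: P_def)
    fix p q assume pq: "p \<in> P" "q \<in> P"
    show "p + q \<in> P" using pq Poly_Mapping.keys_add[of p q] by (auto simp: P_def)
    have "Poly_Mapping.keys (p - q) \<subseteq> Poly_Mapping.keys p \<union> Poly_Mapping.keys q"
      by (auto simp: in_keys_iff lookup_minus)
    then show "p - q \<in> P" using pq by (auto simp: P_def)
    show "p * q \<in> P"
      unfolding P_def
    proof (intro CollectI ballI)
      fix m assume "m \<in> Poly_Mapping.keys (p * q)"
      then obtain a b where ab: "m = a + b" "a \<in> Poly_Mapping.keys p" "b \<in> Poly_Mapping.keys q"
        using keys_mult[of p q] by auto
      have "Poly_Mapping.keys a \<subseteq> I" "Poly_Mapping.keys b \<subseteq> I"
        using pq ab by (auto simp: P_def)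
      then show "Poly_Mapping.keys m \<subseteq> I"
        unfolding ab(1) using Poly_Mapping.keys_add[of a b] by blast
    qed
  qed
  have L: "L p = \<theta> (eval_poly u p)" if "p \<in> P" for p
  proof -
    define q where "q = (SOME q. q \<in> P \<and> eval_poly u q = eval_poly u p)"
    have q: "q \<in> P \<and> eval_poly u q = eval_poly u p"
      unfolding q_def by (rule someI[of _ p]) (use that in simp)
    then have "eval_poly u (p - q) = 0" by (simp add: eval_diff)
    then have "p - q = 0"
      using AI P(3)[OF that] q unfolding algebraically_independent_def P_def by blast
    then show ?thesis unfolding \<theta>_def q_def[symmetric] by simp
  qed
  have R: "is_subring R"
    unfolding is_subring_def
  proof (intro conjI ballI)
    show "1 \<in> R" using P(1) eval_1 unfolding R_def by force
    fix x y assume "x \<in> R" "y \<in> R"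
    then obtain p q where pq: "x = eval_poly u p" "y = eval_poly u q" "p \<in> P" "q \<in> P"
      by (auto simp: R_def)
    show "x - y \<in> R" "x * y \<in> R"
      unfolding R_def pq(1,2) eval_diff[symmetric] eval_mult[symmetric]
      by (intro imageI P pq)+
  qed
  have der: "derivation_on R \<theta>"
    unfolding derivation_on_def
  proof (intro ballI)
    fix x y assume "x \<in> R" "y \<in> R"
    then obtain p q where pq: "x = eval_poly u p" "y = eval_poly u q" "p \<in> P" "q \<in> P"
      by (auto simp: R_def)
    have "x + y = eval_poly u (p + q)" "x * y = eval_poly u (p * q)"
      by (simp_all add: pq eval_mult eval_add)
    then show "\<theta> (x + y) = \<theta> x + \<theta> y \<and> \<theta> (x * y) = \<theta> x * y + x * \<theta> y"
      using pq P L[symmetric] L_mult L_add by simp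
  qed
  have gen: "u j \<in> R \<and> \<theta> (u j) = (if j = i then u j else 0)" if "j \<in> I" for j
  proof -
    define p where "p = (Poly_Mapping.single (Poly_Mapping.single j 1) 1 :: ('v \<Rightarrow>\<^sub>0 nat) \<Rightarrow>\<^sub>0 rat)"
    have "monomial u (Poly_Mapping.single j 1) = u j" by (simp add: monomial_def)
    then have ep: "eval_poly u p = u j" "L p = (if j = i then u j else 0)"
      by (auto simp: p_def eval_single L_single e_def lookup_single)
    moreover have "p \<in> P" using that by (auto simp: p_def P_def)
    ultimately show ?thesis using L by (force simp: R_def)
  qed
  have "u i \<noteq> 0"
  proof
    define p where "p = (Poly_Mapping.single (Poly_Mapping.single i 1) 1 :: ('v \<Rightarrow>\<^sub>0 nat) \<Rightarrow>\<^sub>0 rat)"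
    assume "u i = 0"
    moreover have "monomial u (Poly_Mapping.single i 1) = u i" by (simp add: monomial_def)
    ultimately have "eval_poly u p = 0"
      by (simp add: p_def eval_single)
    moreover have "p \<in> P" using i by (auto simp: p_def P_def)
    ultimately have "p = 0" using AI unfolding algebraically_independent_def P_def by blast
    then have "Poly_Mapping.lookup p (Poly_Mapping.single i 1) = 0" by simp
    then show False by (simp add: p_def)
  qed
  obtain D where D: "derivation_on {a / b |a b. a \<in> R \<and> b \<in> R \<and> b \<noteq> 0} D"
    "\<And>x. x \<in> R \<Longrightarrow> D x = \<theta> x"
    using derivation_extends_to_fractions[OF R der] by blast
  have "u j \<in> {a / b |a b. a \<in> R \<and> b \<in> R \<and> b \<noteq> 0}" if "j \<in> I" for j
  proof -
    have "u j = u j / 1 \<and> u j \<in> R \<and> 1 \<in> R \<and> (1 :: 'f) \<noteq> 0"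
      using gen[OF that] is_subringD(2)[OF R] by simp
    then show ?thesis by blast
  qed
  then have "field_generated (u ` I) \<subseteq> {a / b |a b. a \<in> R \<and> b \<in> R \<and> b \<noteq> 0}"
    by (intro field_generated_minimal subring_fractions_subfield[OF R]) auto
  then have "derivation_on (field_generated (u ` I)) D"
    using D(1) derivation_on_subset by blast
  then have "derivation_on (field_generated (u ` I)) (\<lambda>x. D x / u i)"
    unfolding derivation_on_def by (simp add: add_divide_distrib)
  moreover have "D (u j) / u i = (if j = i then 1 else 0)" if "j \<in> I" for j
    using D(2) gen[OF that] \<open>u i \<noteq> 0\<close> by auto
  ultimately show ?thesis by blast
qed

theorem algebraically_independent_iff_dual_derivations:
  "algebraically_independent I u \<longleftrightarrow> (\<exists>D. dual_derivations (field_generated (u ` I)) I u D)"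
proof
  assume "algebraically_independent I u"
  then have "\<forall>i\<in>I. \<exists>D. derivation_on (field_generated (u ` I)) D \<and>
      (\<forall>j\<in>I. D (u j) = (if j = i then 1 else 0))"
    by (intro ballI algebraically_independent_imp_derivation)
  then show "\<exists>D. dual_derivations (field_generated (u ` I)) I u D"
    unfolding dual_derivations_def by (rule bchoice)
next
  assume "\<exists>D. dual_derivations (field_generated (u ` I)) I u D"
  then show "algebraically_independent I u"
    by (elim exE) (rule dual_derivations_imp_algebraically_independent[OF field_generated_subfield
      field_generated_superset])
qed

lemma free_generating_set_dual:
  assumes "free_generating_set F I u"
  obtains D where "dual_derivations F I u D" "F = field_generated (u ` I)" "is_subfield F" "u ` I \<subseteq> F"
  using assms field_generated_subfield[of "u ` I"] field_generated_superset[of "u ` I"]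
  unfolding free_generating_set_def algebraically_independent_iff_dual_derivations by blast

lemma free_generating_setI:
  assumes "dual_derivations F I u D" "F = field_generated (u ` I)"
  shows "free_generating_set F I u"
  using assms unfolding free_generating_set_def algebraically_independent_iff_dual_derivations
  by blast

text \<open>
  The chain rule: both sides are derivations, and they agree on the generators.
\<close>

lemma derivation_expansion:
  assumes fin: "finite I" and gen: "F = field_generated (u ` I)" and E: "dual_derivations F I u E"
    and D: "derivation_on F D" and x: "x \<in> F"
  shows "D x = (\<Sum>i\<in>I. D (u i) * E i x)"
proof (rule derivations_agree_on_generated[where F = F and X = "u ` I" and D = D
      and E = "\<lambda>x. \<Sum>i\<in>I. D (u i) * E i x"])
  show "is_subfield F" unfolding gen by (rule field_generated_subfield)
  show "derivation_on F D" by fact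
  show "derivation_on F (\<lambda>x. \<Sum>i\<in>I. D (u i) * E i x)"
    using E by (intro derivation_on_linear_combination) (simp add: dual_derivations_def)
  show "field_generated (u ` I) \<subseteq> F" "x \<in> field_generated (u ` I)" using gen x by auto
  fix y assume "y \<in> u ` I"
  then obtain j where j: "y = u j" "j \<in> I" by auto
  have "(\<Sum>i\<in>I. D (u i) * E i y) = (\<Sum>i\<in>I. if i = j then D (u i) else 0)"
    using E j by (intro sum.cong) (auto simp: dual_derivations_def)
  then show "D y = (\<Sum>i\<in>I. D (u i) * E i y)" using fin j by simp
qed

text \<open>
  By the chain rule the Jacobian matrices of \<open>u\<close> with respect to \<open>v\<close> and of \<open>v\<close> with respect to \<open>u\<close> are
  inverse to each other.  The traces of their two products are the two cardinalities, and they are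
  equal in a field of characteristic 0.
\<close>

theorem free_generating_sets_same_card:
  assumes "finite I" "finite J" "free_generating_set F I u" "free_generating_set F J v"
  shows "card I = card J"
proof -
  obtain D where D: "dual_derivations F I u D" and F: "F = field_generated (u ` I)" "u ` I \<subseteq> F"
    using free_generating_set_dual[OF assms(3)] by metis
  obtain E where E: "dual_derivations F J v E" and F': "F = field_generated (v ` J)" "v ` J \<subseteq> F"
    using free_generating_set_dual[OF assms(4)] by metis
  have "(\<Sum>j\<in>J. D i (v j) * E j (u i)) = 1" if "i \<in> I" for i
    using derivation_expansion[OF assms(2) F'(1) E, of "D i" "u i"] D F(2) that
    by (auto simp: dual_derivations_def)
  then have "of_nat (card I) = (\<Sum>i\<in>I. \<Sum>j\<in>J. D i (v j) * E j (u i))" by simp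
  also have "\<dots> = (\<Sum>j\<in>J. \<Sum>i\<in>I. E j (u i) * D i (v j))"
    by (subst sum.swap) (simp add: mult.commute)
  also have "\<dots> = (\<Sum>j\<in>J. 1)"
    using derivation_expansion[OF assms(1) F(1) D] E F'(2)
    by (intro sum.cong) (auto simp: dual_derivations_def)
  finally show ?thesis by (simp only: sum_constant mult_1_right of_nat_eq_iff)
qed

text \<open>
  Write \<open>f = p(x) / q(x)\<close> with polynomials over \<open>K\<close>.  The element \<open>x\<close> is transcendental over the field of
  constants of \<open>D\<close>, since differentiating an algebraic relation of least degree lowers its degree.
  If \<open>f\<close> is a constant, the relation \<open>p(x) - f q(x) = 0\<close> is one over the constants, so \<open>p = f q\<close>
  coefficientwise and \<open>f\<close> is a quotient of coefficients, which lie in \<open>K\<close>.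
\<close>

lemma constant_in_base_field:
  fixes K F :: "'f::field_char_0 set"
  assumes K: "is_subfield K" and F: "F = field_generated (insert x K)"
    and D: "derivation_on F D" "\<And>c. c \<in> K \<Longrightarrow> D c = 0" "D x = 1"
    and f: "f \<in> F" "D f = 0"
  shows "f \<in> K"
proof -
  have sF: "is_subfield F" unfolding F by (rule field_generated_subfield)
  note R = is_subfieldD(1)[OF sF]
  have sub: "insert x K \<subseteq> F" unfolding F by (rule field_generated_superset)
  define P where "P S = {p :: 'f poly. \<forall>n. coeff p n \<in> S}" for S
  define C where "C = {c \<in> F. D c = 0}"
  have C: "is_subfield C" unfolding C_def by (rule derivation_kernel_subfield[OF sF D(1)])
  have KC: "K \<subseteq> C" using D(2) sub by (auto simp: C_def)
  have P_subring: "1 \<in> P S" "\<And>p q. p \<in> P S \<Longrightarrow> q \<in> P S \<Longrightarrow> p - q \<in> P S"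
    "\<And>p q. p \<in> P S \<Longrightarrow> q \<in> P S \<Longrightarrow> p * q \<in> P S" if S: "is_subfield S" for S
  proof -
    have S_sum: "(\<Sum>i\<in>A. g i) \<in> S" if "finite A" "\<And>i. i \<in> A \<Longrightarrow> g i \<in> S" for A :: "nat set" and g
      using that by (induction A rule: finite_induct) (auto intro: is_subfieldD[OF S])
    show "1 \<in> P S" using is_subfieldD(2,3)[OF S] by (simp add: P_def coeff_1)
    fix p q assume pq: "p \<in> P S" "q \<in> P S"
    show "p - q \<in> P S" using pq is_subfieldD(4)[OF S] by (simp add: P_def)
    show "p * q \<in> P S"
      using pq unfolding P_def by (auto simp: coeff_mult intro!: S_sum is_subfieldD(5)[OF S])
  qed
  have P_eval: "poly p x \<in> F \<and> D (poly p x) = poly (pderiv p) x" if "p \<in> P C" for p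
    using that
  proof (induction p)
    case (pCons a p)
    have "coeff (pCons a p) 0 \<in> C" "\<And>n. coeff (pCons a p) (Suc n) \<in> C"
      using pCons.prems unfolding P_def by blast+
    then have a: "a \<in> F" "D a = 0" and "p \<in> P C" by (auto simp: P_def C_def)
    then have IH: "poly p x \<in> F" "D (poly p x) = poly (pderiv p) x" using pCons.IH by auto
    then show ?case
      using a D(3) sub derivation_add[OF R D(1), of a "x * poly p x"]
        derivation_mult[OF R D(1), of x "poly p x"] is_subfieldD[OF sF]
      by (simp add: pderiv_pCons)
  qed (use is_subfieldD(2)[OF sF] derivation_0[OF R D(1)] in simp)
  have transcendental: "p = 0" if "p \<in> P C" "poly p x = 0" for p
    using that
  proof (induction "degree p" arbitrary: p rule: less_induct)
    case less
    have nat: "of_nat n \<in> C" for n by (induction n) (auto intro: is_subfieldD[OF C])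
    have "pderiv p \<in> P C"
      using less.prems(1) nat is_subfieldD(5)[OF C] unfolding P_def
      by (auto simp: coeff_pderiv simp del: of_nat_Suc)
    moreover have "poly (pderiv p) x = 0"
      using P_eval[OF less.prems(1)] less.prems(2) derivation_0[OF R D(1)] by simp
    moreover have "degree (pderiv p) < degree p" if "degree p \<noteq> 0"
      using that by (simp add: degree_pderiv)
    ultimately have "degree p = 0" using less.hyps pderiv_eq_0_iff by blast
    then show ?case using less.prems(2) by (auto elim: degree_eq_zeroE)
  qed
  let ?Q = "{poly p x / poly q x |p q. p \<in> P K \<and> q \<in> P K \<and> poly q x \<noteq> 0}"
  have "is_subring ((\<lambda>p. poly p x) ` P K)"
    unfolding is_subring_def
  proof (intro conjI ballI)
    show "1 \<in> (\<lambda>p. poly p x) ` P K" using P_subring(1)[OF K] by force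
    fix a b assume "a \<in> (\<lambda>p. poly p x) ` P K" "b \<in> (\<lambda>p. poly p x) ` P K"
    then obtain p q where pq: "a = poly p x" "b = poly q x" "p \<in> P K" "q \<in> P K" by auto
    show "a - b \<in> (\<lambda>p. poly p x) ` P K" "a * b \<in> (\<lambda>p. poly p x) ` P K"
      unfolding pq(1,2) poly_diff[symmetric] poly_mult[symmetric]
      by (intro imageI P_subring K pq)+
  qed
  then have "is_subfield {a / b |a b. a \<in> (\<lambda>p. poly p x) ` P K \<and> b \<in> (\<lambda>p. poly p x) ` P K \<and> b \<noteq> 0}"
    by (rule subring_fractions_subfield)
  also have "{a / b |a b. a \<in> (\<lambda>p. poly p x) ` P K \<and> b \<in> (\<lambda>p. poly p x) ` P K \<and> b \<noteq> 0} = ?Q"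
    by blast
  finally have "is_subfield ?Q" .
  moreover have "insert x K \<subseteq> ?Q"
  proof -
    have "[:c:] \<in> P K" if "c \<in> K" for c
      using that is_subfieldD(2)[OF K] by (auto simp: P_def coeff_pCons split: nat.split)
    moreover have "[:0, 1:] \<in> P K"
      using is_subfieldD(2,3)[OF K] by (auto simp: P_def coeff_pCons split: nat.split)
    moreover have "c = poly [:c:] x / poly 1 x" "x = poly [:0, 1:] x / poly 1 x" "poly 1 x \<noteq> 0" for c
      by simp_all
    ultimately show ?thesis using P_subring(1)[OF K] by blast
  qed
  ultimately have "F \<subseteq> ?Q" unfolding F by (intro field_generated_minimal)
  then obtain p q where pq: "f = poly p x / poly q x" "p \<in> P K" "q \<in> P K" "poly q x \<noteq> 0"
    using f(1) by blast
  have fC: "f \<in> C" using f by (simp add: C_def)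
  have "p - smult f q \<in> P C"
    unfolding P_def
  proof (intro CollectI allI)
    fix n
    have "coeff p n \<in> C" "coeff q n \<in> C" using pq(2,3) KC by (auto simp: P_def)
    then show "coeff (p - smult f q) n \<in> C" by (simp add: is_subfieldD(4,5)[OF C] fC)
  qed
  moreover have "poly (p - smult f q) x = 0" using pq by simp
  ultimately have p: "p = smult f q" using transcendental by fastforce
  obtain n where n: "coeff q n \<noteq> 0" using pq(4) by (metis leading_coeff_0_iff poly_0)
  then have "f = coeff p n / coeff q n" by (simp add: p)
  then show ?thesis using pq is_subfieldD(9)[OF K] by (simp add: P_def)
qed

text \<open>
  The variables indexed by \<open>W\<close> are removed one at a time by \<open>constant_in_base_field\<close>.
\<close>

lemma common_constants:
  assumes "finite W" "W \<subseteq> I" and gen: "F = field_generated (u ` I)" and D: "dual_derivations F I u D"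
    and "f \<in> F" "\<And>k. k \<in> W \<Longrightarrow> D k f = 0"
  shows "f \<in> field_generated (u ` (I - W))"
  using assms(1,2,6)
proof (induction W rule: finite_induct)
  case empty
  then show ?case using assms(5) gen by simp
next
  case (insert k W)
  let ?K = "field_generated (u ` (I - insert k W))" and ?L = "field_generated (u ` (I - W))"
  have k: "k \<in> I" using insert by auto
  have Dk: "derivation_on F (D k)" and dual: "\<And>j. j \<in> I \<Longrightarrow> D k (u j) = (if j = k then 1 else 0)"
    using D k by (auto simp: dual_derivations_def)
  have sub: "?L \<subseteq> F" "?K \<subseteq> F" unfolding gen by (intro field_generated_mono; blast)+
  have sF: "is_subfield F" unfolding gen by (rule field_generated_subfield)
  have "u ` (I - W) = {u k} \<union> u ` (I - insert k W)" using insert.hyps k by auto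
  then have L: "?L = field_generated (insert (u k) ?K)"
    using field_generated_Un_left[of "u ` (I - insert k W)" "{u k}"] by (simp add: Un_commute)
  show ?case
  proof (rule constant_in_base_field[OF field_generated_subfield L])
    show "derivation_on ?L (D k)" using Dk sub(1) by (rule derivation_on_subset)
    show "D k c = 0" if "c \<in> ?K" for c
      using that by (rule derivation_vanishes_on_generated[OF sF Dk sub(2), rotated])
        (use dual in \<open>auto split: if_splits\<close>)
    show "D k (u k) = 1" using dual k by simp
    show "f \<in> ?L" using insert by auto
    show "D k f = 0" using insert.prems by simp
  qed
qed

text \<open>
  Suppose that two free generating sets of \<open>F\<close> are split into two blocks and that the blocks of \<open>v\<close> lie
  in the fields of the corresponding blocks of \<open>u\<close>.  Then the Jacobian matrix is block diagonal, hence
  so is its inverse.  This says that \<open>u ` I\<close> is killed by the derivatives in the directions \<open>J'\<close>, so it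
  lies in the field generated by \<open>v ` I'\<close>.
\<close>

theorem block_fields_eq:
  assumes fin: "finite I" "finite J" "finite I'" "finite J'" and disj: "I \<inter> J = {}" "I' \<inter> J' = {}"
    and u: "free_generating_set F (I \<union> J) u" and v: "free_generating_set F (I' \<union> J') v"
    and sub: "v ` I' \<subseteq> field_generated (u ` I)" "v ` J' \<subseteq> field_generated (u ` J)"
  shows "field_generated (v ` I') = field_generated (u ` I)"
proof (rule field_generated_eqI[OF sub(1)])
  obtain D where D: "dual_derivations F (I \<union> J) u D" and F: "F = field_generated (u ` (I \<union> J))"
    and sF: "is_subfield F" and uF: "u ` (I \<union> J) \<subseteq> F"
    using free_generating_set_dual[OF u] by metis
  obtain E where E: "dual_derivations F (I' \<union> J') v E" and F': "F = field_generated (v ` (I' \<union> J'))"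
    using free_generating_set_dual[OF v] by metis
  have subF: "field_generated (u ` I) \<subseteq> F" "field_generated (u ` J) \<subseteq> F"
    unfolding F by (intro field_generated_mono; blast)+
  have zero: "E k (u i) = 0" if k: "k \<in> J'" and i: "i \<in> I" for k i
  proof -
    \<comment> \<open>The part of the expansion of \<open>E k\<close> that belongs to the first block.  It agrees with \<open>E k\<close> on the first field, vanishes on the second one, and therefore kills all of \<open>v\<close>.\<close>
    define G where "G x = (\<Sum>j\<in>I. E k (u j) * D j x)" for x
    have Ek: "derivation_on F (E k)" using E k by (simp add: dual_derivations_def)
    have G: "derivation_on F G"
      unfolding G_def using D by (intro derivation_on_linear_combination) (simp add: dual_derivations_def)
    have Gu: "G (u j) = (if j \<in> I then E k (u j) else 0)" if "j \<in> I \<union> J" for j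
    proof -
      have "G (u j) = (\<Sum>l\<in>I. if l = j then E k (u j) else 0)"
        unfolding G_def using D that by (intro sum.cong) (auto simp: dual_derivations_def)
      then show ?thesis using fin(1) by simp
    qed
    have "G x = E k x" if "x \<in> field_generated (u ` I)" for x
      by (rule derivations_agree_on_generated[OF sF G Ek subF(1) _ that]) (use Gu in auto)
    then have "G (v l) = 0" if "l \<in> I'" for l
      using that sub(1) E k disj by (auto simp: dual_derivations_def image_subset_iff)
    moreover have "G (v l) = 0" if "l \<in> J'" for l
      by (rule derivation_vanishes_on_generated[OF sF G subF(2)])
         (use Gu disj sub(2) that in auto)
    ultimately have "G x = 0" if "x \<in> F" for x
      using that derivation_vanishes_on_generated[OF sF G, of "v ` (I' \<union> J')"] F' by blast
    then show ?thesis using Gu[of i] i uF by auto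
  qed
  show "u ` I \<subseteq> field_generated (v ` I')"
  proof
    fix x assume "x \<in> u ` I"
    then obtain i where i: "x = u i" "i \<in> I" by auto
    have "x \<in> field_generated (v ` (I' \<union> J' - J'))"
      using zero i uF by (intro common_constants[OF fin(4) _ F' E]) auto
    also have "I' \<union> J' - J' = I'" using disj by auto
    finally show "x \<in> field_generated (v ` I')" .
  qed
qed

text \<open>
  The derivatives with respect to \<open>w\<close> in the new directions are extended to \<open>F\<close> by the chain rule, so
  as to vanish on the untouched block; the derivatives in the old directions remain as they are.
\<close>

lemma free_generating_set_replace_block:
  assumes fin: "finite I" and disj: "I \<inter> J = {}"
    and u: "free_generating_set F (I \<union> J) u"
    and v: "free_generating_set (field_generated (u ` I)) I w"
    and w: "\<And>j. j \<in> J \<Longrightarrow> w j = u j"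
  shows "free_generating_set F (I \<union> J) w"
proof -
  let ?K = "field_generated (u ` I)"
  obtain D where D: "dual_derivations F (I \<union> J) u D" and F: "F = field_generated (u ` (I \<union> J))"
    and sF: "is_subfield F"
    using free_generating_set_dual[OF u] by metis
  obtain E where E: "dual_derivations ?K I w E" and K: "?K = field_generated (w ` I)" and wK: "w ` I \<subseteq> ?K"
    using free_generating_set_dual[OF v] by metis
  have sub: "?K \<subseteq> F" unfolding F by (intro field_generated_mono) blast
  define G where "G k x = (if k \<in> I then (\<Sum>j\<in>I. E k (u j) * D j x) else D k x)" for k x
  have der: "derivation_on F (D k)" if "k \<in> I \<union> J" for k
    using D that by (simp add: dual_derivations_def)
  have Dw: "D j (w l) = 0" if "j \<in> J" "l \<in> I" for j l
    by (rule derivation_vanishes_on_generated[OF sF der sub])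
       (use that D disj wK in \<open>auto simp: dual_derivations_def\<close>)
  show ?thesis
  proof (rule free_generating_setI)
    show "dual_derivations F (I \<union> J) w G"
      unfolding dual_derivations_def
    proof (intro ballI conjI)
      fix k l assume k: "k \<in> I \<union> J"
      show G: "derivation_on F (G k)"
      proof (cases "k \<in> I")
        case True
        have "derivation_on F (\<lambda>x. \<Sum>j\<in>I. E k (u j) * D j x)"
          by (rule derivation_on_linear_combination) (use der in blast)
        then show ?thesis using True by (simp add: G_def[abs_def])
      next
        case False
        then show ?thesis using der[OF k] by (simp add: G_def[abs_def])
      qed
      assume l: "l \<in> I \<union> J"
      show "G k (w l) = (if l = k then 1 else 0)"
      proof (cases "k \<in> I")
        case False
        then show ?thesis
          using k l Dw w D disj by (auto simp: G_def dual_derivations_def)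
      next
        case kI: True
        show ?thesis
        proof (cases "l \<in> I")
          case True
          have Ek: "derivation_on ?K (E k)" using E kI by (simp add: dual_derivations_def)
          have "G k (w l) = E k (w l)"
          proof (rule derivations_agree_on_generated[OF field_generated_subfield
                derivation_on_subset[OF G sub] Ek subset_refl])
            show "w l \<in> ?K" using wK True by auto
            fix x assume "x \<in> u ` I"
            then obtain i where i: "x = u i" "i \<in> I" by auto
            have "G k x = (\<Sum>j\<in>I. if j = i then E k (u j) else 0)"
              unfolding G_def i using kI D i by (auto simp: dual_derivations_def intro!: sum.cong)
            then show "G k x = E k x" using fin i by simp
          qed
          then show ?thesis using E kI True by (simp add: dual_derivations_def)
        next
          case False
          then have "l \<in> J" "l \<noteq> k" using l kI by auto
          then show ?thesis
            using kI D w disj by (auto simp: G_def dual_derivations_def intro!: sum.neutral)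
        qed
      qed
    qed
    have "F = field_generated (?K \<union> u ` J)"
      unfolding F field_generated_Un_left by (simp add: image_Un)
    also have "\<dots> = field_generated (w ` I \<union> u ` J)"
      unfolding K field_generated_Un_left ..
    also have "w ` I \<union> u ` J = w ` (I \<union> J)" using w by force
    finally show "F = field_generated (w ` (I \<union> J))" .
  qed
qed

lemma free_generating_set_subset:
  assumes "free_generating_set F I u" "J \<subseteq> I"
  shows "free_generating_set (field_generated (u ` J)) J u"
  using assms unfolding free_generating_set_def algebraically_independent_def by blast

lemma derivative_of_exchange:
  assumes u: "free_generating_set F I u" and D: "dual_derivations F I u D" and i: "i \<in> I"
    and N: "N \<in> field_generated (u ` (I - {i}))"
  shows "D i N = 0" "D i (N / u i) = - N / (u i * u i)" "N / u i \<in> F" "u i \<noteq> 0"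
proof -
  have F: "F = field_generated (u ` I)" "is_subfield F" "u ` I \<subseteq> F"
    using free_generating_set_dual[OF u] by metis+
  have sub: "field_generated (u ` (I - {i})) \<subseteq> F"
    unfolding F(1) by (intro field_generated_mono) blast
  have Di: "derivation_on F (D i)" "D i (u i) = 1" using D i by (simp_all add: dual_derivations_def)
  show 0: "D i N = 0"
    by (rule derivation_vanishes_on_generated[OF F(2) Di(1) sub _ N])
       (use D i in \<open>auto simp: dual_derivations_def split: if_splits\<close>)
  have mem: "N \<in> F" "u i \<in> F" using N sub F(3) i by auto
  show "D i (N / u i) = - N / (u i * u i)"
    using derivation_divide_constant[OF F(2) Di(1) mem 0] Di(2) by simp
  show "N / u i \<in> F" using mem by (rule is_subfieldD(9)[OF F(2)])
  show "u i \<noteq> 0" by (rule dual_derivations_nonzero[OF F(2) D i])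
qed

text \<open>
  The variable \<open>u i\<close> is replaced by \<open>N / u i\<close> with \<open>N\<close> independent of \<open>u i\<close>.  The change of coordinates is
  triangular, and its diagonal entry \<open>D i (N / u i)\<close> is not 0 by \<open>derivative_of_exchange\<close>.
\<close>

lemma free_generating_set_exchange:
  assumes u: "free_generating_set F I u" and i: "i \<in> I"
    and N: "N \<in> field_generated (u ` (I - {i}))" "N \<noteq> 0"
  shows "free_generating_set F I (u(i := N / u i))"
proof -
  let ?w = "u(i := N / u i)"
  obtain D where D: "dual_derivations F I u D" and F: "F = field_generated (u ` I)"
    and sF: "is_subfield F" and uF: "u ` I \<subseteq> F"
    using free_generating_set_dual[OF u] by metis
  have sub: "field_generated (u ` (I - {i})) \<subseteq> F" unfolding F by (intro field_generated_mono) blast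
  have der: "derivation_on F (D j)" if "j \<in> I" for j using D that by (simp add: dual_derivations_def)
  have ui: "u i \<noteq> 0" "u i \<in> F" using dual_derivations_nonzero[OF sF D i] uF i by auto
  have c: "D i (N / u i) \<noteq> 0" using derivative_of_exchange(2)[OF u D i N(1)] N ui by simp
  define c where "c = D i (N / u i)"
  define G where "G j x = (if j = i then 0 else 1) * D j x
      + (if j = i then 1 / c else - (D j (N / u i) / c)) * D i x" for j x
  show ?thesis
  proof (rule free_generating_setI)
    show "dual_derivations F I ?w G"
      unfolding dual_derivations_def
    proof (intro ballI conjI)
      fix j assume j: "j \<in> I"
      show "derivation_on F (G j)"
        using der[OF j] der[OF i] unfolding derivation_on_def G_def by (simp add: algebra_simps)
      fix l assume "l \<in> I"
      then show "G j (?w l) = (if l = j then 1 else 0)"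
        using D i j c by (auto simp: G_def c_def dual_derivations_def)
    qed
    have "u ` I \<subseteq> field_generated (?w ` I)"
    proof
      fix x assume "x \<in> u ` I"
      then obtain j where j: "x = u j" "j \<in> I" by auto
      show "x \<in> field_generated (?w ` I)"
      proof (cases "j = i")
        case True
        have "u ` (I - {i}) \<subseteq> ?w ` I" by force
        then have "N \<in> field_generated (?w ` I)" using N field_generated_mono by blast
        moreover have "N / u i \<in> field_generated (?w ` I)"
          using i field_generated_superset[of "?w ` I"] by force
        moreover have "x = N / (N / u i)" using True j N ui by simp
        ultimately show ?thesis
          using is_subfieldD(9)[OF field_generated_subfield] by metis
      next
        case False
        then have "x \<in> ?w ` I" using j by force
        then show ?thesis using field_generated_superset by blast
      qed
    qed
    moreover have "?w ` I \<subseteq> field_generated (u ` I)"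
      unfolding F[symmetric] using uF ui N sub is_subfieldD(9)[OF sF] by auto
    ultimately show "F = field_generated (?w ` I)"
      unfolding F by (rule field_generated_eqI)
  qed
qed

text \<open>
  The sum of two coprime monomials really involves each of their variables: only one of the two
  summands of the derivative survives, so that nothing can cancel.
\<close>

lemma exchange_polynomial:
  assumes u: "free_generating_set F I u" and D: "dual_derivations F I u D"
    and MN: "set_mset M \<subseteq> I" "set_mset N \<subseteq> I" "set_mset M \<inter> set_mset N = {}"
  defines "P \<equiv> (\<Prod>x\<in>#M. u x) + (\<Prod>x\<in>#N. u x)"
  shows exchange_polynomial_derivative: "l \<in> set_mset M \<union> set_mset N \<Longrightarrow> D l P \<noteq> 0"
    and exchange_polynomial_nonzero: "P \<noteq> 0"
proof -
  have F: "is_subfield F" "u ` I \<subseteq> F"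
    using free_generating_set_dual[OF u] by metis+
  note R = is_subfieldD(1)[OF F(1)]
  have nz: "u x \<noteq> 0" if "x \<in> I" for x by (rule dual_derivations_nonzero[OF F(1) D that])
  have prod_nz: "(\<Prod>x\<in>#A. u x) \<noteq> 0" if "set_mset A \<subseteq> I" for A
    using that nz by (auto simp: prod_mset_zero_iff)
  have deriv: "(\<Prod>x\<in>#A. u x) \<in> F \<and>
      D l (\<Prod>x\<in>#A. u x) = of_nat (count A l) / u l * (\<Prod>x\<in>#A. u x)"
    if A: "set_mset A \<subseteq> I" and l: "l \<in> I" for A l
  proof -
    have Dl: "derivation_on F (D l)" using D l by (simp add: dual_derivations_def)
    have AI: "\<And>x. x \<in># A \<Longrightarrow> x \<in> I" and uF: "\<And>x. x \<in> I \<Longrightarrow> u x \<in> F" using A F(2) by auto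
    have "D l (\<Prod>x\<in>#A. u x) = (\<Sum>x\<in>#A. if x = l then 1 / u l else 0) * (\<Prod>x\<in>#A. u x)
        \<and> (\<Prod>x\<in>#A. u x) \<in> F"
      by (rule derivation_log_prod_mset[OF R Dl])
         (use AI l D uF nz in \<open>auto simp: dual_derivations_def\<close>)
    moreover have "(\<Sum>x\<in>#A. if x = l then 1 / u l else 0) = of_nat (count A l) / u l"
      by (induction A) (auto simp: add_divide_distrib)
    ultimately show ?thesis by simp
  qed
  have *: "D l P \<noteq> 0" if l: "l \<in> set_mset M \<union> set_mset N" for l
  proof -
    have lI: "l \<in> I" using l MN by auto
    have "D l P = of_nat (count M l) / u l * (\<Prod>x\<in>#M. u x) + of_nat (count N l) / u l * (\<Prod>x\<in>#N. u x)"
      unfolding P_def using derivation_add[OF R, of "D l"] deriv[OF MN(1) lI] deriv[OF MN(2) lI] D lI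
      by (simp add: dual_derivations_def)
    moreover have "count M l = 0 \<and> count N l \<noteq> 0 \<or> count M l \<noteq> 0 \<and> count N l = 0"
      using l MN(3) by (auto simp: count_eq_zero_iff)
    ultimately show ?thesis
      using prod_nz[OF MN(1)] prod_nz[OF MN(2)] nz[OF lI] by (elim disjE) simp_all
  qed
  then show "l \<in> set_mset M \<union> set_mset N \<Longrightarrow> D l P \<noteq> 0" .
  show "P \<noteq> 0"
  proof (cases "set_mset M \<union> set_mset N = {}")
    case True
    then show ?thesis by (simp add: P_def)
  next
    case False
    then obtain l where l: "l \<in> set_mset M \<union> set_mset N" by blast
    then have "derivation_on F (D l)" using D MN by (auto simp: dual_derivations_def)
    then show ?thesis using *[OF l] derivation_0[OF R, of "D l"] by auto
  qed
qed

section \<open>Quiver mutation in terms of arrow multiplicities\<close>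

lemma count_image_mset_inj_on:
  assumes "inj_on f S" "set_mset A \<subseteq> S" "x \<in> S"
  shows "count (image_mset f A) (f x) = count A x"
  using assms(2) by (induction A) (use assms(1,3) in \<open>auto simp: inj_on_eq_iff\<close>)

lemma count_sources_into: "count (sources_into i A) h = count A (h, i)"
  by (induction A) (auto simp: sources_into_def)

lemma count_targets_from: "count (targets_from i A) j = count A (i, j)"
  by (induction A) (auto simp: targets_from_def)

lemma in_sources_into: "h \<in># sources_into i A \<longleftrightarrow> (h, i) \<in># A"
  by (auto simp: sources_into_def image_iff)

lemma in_targets_from: "j \<in># targets_from i A \<longleftrightarrow> (i, j) \<in># A"
  by (auto simp: targets_from_def image_iff)

lemma count_add_composites:
  "count (add_composites i A) (a, b) = count A (a, b) + count A (a, i) * count A (i, b)"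
proof -
  have 1: "count (image_mset (Pair h) T) (a, b) = (if h = a then count T b else 0)" for h T
    by (induction T) auto
  have "count (\<Sum>h\<in>#S. image_mset (Pair h) T) (a, b) = count S a * count T b" for S T
    by (induction S) (auto simp: 1)
  then show ?thesis
    by (simp add: add_composites_def count_sources_into count_targets_from)
qed

lemma count_reverse_at:
  "count (reverse_at i A) (a, b) = (if a = i \<or> b = i then count A (b, a) else count A (a, b))"
proof -
  let ?f = "\<lambda>(a, b). if a = i \<or> b = i then (b, a) else (a, b)"
  have "?f (?f p) = p" for p by (cases p) auto
  then have "inj_on ?f UNIV" by (metis (no_types, lifting) inj_onI)
  then have "count (image_mset ?f A) (?f (?f (a, b))) = count A (?f (a, b))"
    by (rule count_image_mset_inj_on) auto
  then show ?thesis by (auto simp: reverse_at_def)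
qed

lemma count_swap: "count (image_mset prod.swap A) (a, b) = count A (b, a)"
  by (induction A) auto

lemma count_cancel_2cycles: "count (cancel_2cycles A) (a, b) = count A (a, b) - count A (b, a)"
  by (simp add: cancel_2cycles_def count_swap)

lemma is_quiverD:
  assumes "is_quiver Q"
  shows "finite (verts Q)" "set_mset (arrows Q) \<subseteq> verts Q \<times> verts Q"
    "count (arrows Q) (a, a) = 0" "count (arrows Q) (a, b) = 0 \<or> count (arrows Q) (b, a) = 0"
    "a \<notin> verts Q \<or> b \<notin> verts Q \<Longrightarrow> count (arrows Q) (a, b) = 0"
proof -
  show "finite (verts Q)" "set_mset (arrows Q) \<subseteq> verts Q \<times> verts Q"
    "count (arrows Q) (a, a) = 0" "count (arrows Q) (a, b) = 0 \<or> count (arrows Q) (b, a) = 0"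
    using assms by (auto simp: is_quiver_def count_eq_zero_iff)
  then show "a \<notin> verts Q \<or> b \<notin> verts Q \<Longrightarrow> count (arrows Q) (a, b) = 0"
    by (auto simp: count_eq_zero_iff)
qed

lemma is_quiverI:
  assumes "finite (verts Q)"
    "\<And>a b. a \<notin> verts Q \<or> b \<notin> verts Q \<Longrightarrow> count (arrows Q) (a, b) = 0"
    "\<And>a. count (arrows Q) (a, a) = 0"
    "\<And>a b. count (arrows Q) (a, b) = 0 \<or> count (arrows Q) (b, a) = 0"
  shows "is_quiver Q"
  using assms unfolding is_quiver_def by (auto simp: count_eq_zero_iff)

lemma quiver_eqI:
  assumes "verts Q = verts R" "\<And>a b. count (arrows Q) (a, b) = count (arrows R) (a, b)"
  shows "Q = R"
  using assms by (auto intro!: quiver.expand multiset_eqI)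

lemma verts_mutate_quiver [simp]: "verts (mutate_quiver i Q) = verts Q"
  by (simp add: mutate_quiver_def)

text \<open>
  This is matrix mutation, written for natural numbers: the truncated difference carries out the
  cancellation of 2-cycles.
\<close>

lemma count_mutate_quiver:
  assumes "is_quiver Q"
  shows "count (arrows (mutate_quiver i Q)) (a, b) =
    (if a = i \<or> b = i then count (arrows Q) (b, a)
     else (count (arrows Q) (a, b) + count (arrows Q) (a, i) * count (arrows Q) (i, b)) -
          (count (arrows Q) (b, a) + count (arrows Q) (b, i) * count (arrows Q) (i, a)))"
  using is_quiverD(3)[OF assms, of i] is_quiverD(4)[OF assms, of a b]
  by (auto simp: mutate_quiver_def count_cancel_2cycles count_reverse_at count_add_composites)

lemma is_quiver_mutate:
  assumes "is_quiver Q"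
  shows "is_quiver (mutate_quiver i Q)"
proof (rule is_quiverI)
  note Q = is_quiverD[OF assms]
  show "finite (verts (mutate_quiver i Q))" using Q(1) by simp
  fix a b
  show "count (arrows (mutate_quiver i Q)) (a, a) = 0"
    by (simp add: count_mutate_quiver[OF assms] Q(3))
  show "count (arrows (mutate_quiver i Q)) (a, b) = 0 \<or> count (arrows (mutate_quiver i Q)) (b, a) = 0"
    using Q(4)[of a b] by (auto simp: count_mutate_quiver[OF assms])
  assume "a \<notin> verts (mutate_quiver i Q) \<or> b \<notin> verts (mutate_quiver i Q)"
  then show "count (arrows (mutate_quiver i Q)) (a, b) = 0"
    using Q(5) by (auto simp: count_mutate_quiver[OF assms])
qed

lemma mutate_quiver_involutive:
  assumes "is_quiver Q"
  shows "mutate_quiver i (mutate_quiver i Q) = Q"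
proof (rule quiver_eqI)
  fix a b
  show "count (arrows (mutate_quiver i (mutate_quiver i Q))) (a, b) = count (arrows Q) (a, b)"
    using is_quiverD(4)[OF assms, of a b]
    by (auto simp: count_mutate_quiver[OF is_quiver_mutate[OF assms]] count_mutate_quiver[OF assms]
        mult.commute)
qed simp

text \<open>
  For quivers, being isomorphic along \<open>\<sigma>\<close> is an equality of arrow multiplicities, which is how mutation
  is known.
\<close>

lemma arrows_image_iff:
  fixes Q :: "'a quiver" and R :: "'b quiver"
  assumes Q: "is_quiver Q" and R: "is_quiver R" and \<sigma>: "bij_betw \<sigma> (verts Q) (verts R)"
  shows "arrows R = image_mset (map_prod \<sigma> \<sigma>) (arrows Q) \<longleftrightarrow>
    (\<forall>a\<in>verts Q. \<forall>b\<in>verts Q. count (arrows R) (\<sigma> a, \<sigma> b) = count (arrows Q) (a, b))"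
proof -
  let ?V = "verts Q \<times> verts Q" and ?f = "map_prod \<sigma> \<sigma>"
  have inj: "inj_on ?f ?V" using \<sigma> by (auto simp: bij_betw_def intro: map_prod_inj_on)
  have count: "count (image_mset ?f (arrows Q)) (\<sigma> a, \<sigma> b) = count (arrows Q) (a, b)"
    if "a \<in> verts Q" "b \<in> verts Q" for a b
    using count_image_mset_inj_on[OF inj is_quiverD(2)[OF Q], of "(a, b)"] that by simp
  show ?thesis
  proof
    assume *: "\<forall>a\<in>verts Q. \<forall>b\<in>verts Q. count (arrows R) (\<sigma> a, \<sigma> b) = count (arrows Q) (a, b)"
    show "arrows R = image_mset ?f (arrows Q)"
    proof (rule multiset_eqI)
      fix p :: "'b \<times> 'b"
      obtain x y where p: "p = (x, y)" by fastforce
      show "count (arrows R) p = count (image_mset ?f (arrows Q)) p"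
      proof (cases "x \<in> verts R \<and> y \<in> verts R")
        case True
        then obtain a b where "x = \<sigma> a" "y = \<sigma> b" "a \<in> verts Q" "b \<in> verts Q"
          using \<sigma> unfolding bij_betw_def by (metis imageE)
        then show ?thesis using * count p by simp
      next
        case False
        have "p \<notin> ?f ` set_mset (arrows Q)"
          using False is_quiverD(2)[OF Q] \<sigma> by (auto simp: p bij_betw_def)
        then have "count (image_mset ?f (arrows Q)) p = 0" by (simp add: count_eq_zero_iff)
        then show ?thesis using is_quiverD(5)[OF R, of x y] False p by auto
      qed
    qed
  qed (use count in simp)
qed

lemma mutate_quiver_iso:
  assumes Q: "is_quiver Q" and R: "is_quiver R" and \<sigma>: "bij_betw \<sigma> (verts Q) (verts R)"
    and eq: "arrows R = image_mset (map_prod \<sigma> \<sigma>) (arrows Q)" and i: "i \<in> verts Q"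
  shows "arrows (mutate_quiver (\<sigma> i) R) = image_mset (map_prod \<sigma> \<sigma>) (arrows (mutate_quiver i Q))"
proof -
  have "\<sigma> a = \<sigma> i \<longleftrightarrow> a = i" if "a \<in> verts Q" for a
    using \<sigma> i that by (auto simp: bij_betw_def inj_on_eq_iff)
  then show ?thesis
    using eq \<sigma> i
    by (simp add: arrows_image_iff[OF Q R \<sigma>]
        arrows_image_iff[OF is_quiver_mutate[OF Q] is_quiver_mutate[OF R]]
        count_mutate_quiver[OF Q] count_mutate_quiver[OF R])
qed

section \<open>Seeds and their mutation classes\<close>

text \<open>
  The right-hand side of the exchange relation at \<open>i\<close>.
\<close>

definition exchange_poly :: "('v \<Rightarrow> 'f::field) \<Rightarrow> 'v quiver \<Rightarrow> 'v \<Rightarrow> 'f" where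
  "exchange_poly u Q i =
     (\<Prod>h\<in>#sources_into i (arrows Q). u h) + (\<Prod>j\<in>#targets_from i (arrows Q). u j)"

lemma mutate_seed_eq: "mutate_seed i (u, Q) = (u(i := exchange_poly u Q i / u i), mutate_quiver i Q)"
  by (simp add: mutate_seed_def exchange_poly_def)

lemma fst_mutate_seed: "fst (mutate_seed i S) = (fst S)(i := exchange_poly (fst S) (snd S) i / fst S i)"
  and snd_mutate_seed [simp]: "snd (mutate_seed i S) = mutate_quiver i (snd S)"
  by (cases S; simp add: mutate_seed_eq)+

lemma exchange_poly_cong:
  assumes "\<And>h. (h, i) \<in># arrows Q \<Longrightarrow> u h = w h" "\<And>j. (i, j) \<in># arrows Q \<Longrightarrow> u j = w j"
  shows "exchange_poly u Q i = exchange_poly w Q i"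
  unfolding exchange_poly_def
  by (intro arg_cong2[where f = "(+)"] arg_cong[where f = prod_mset] image_mset_cong)
     (use assms in \<open>auto simp: in_sources_into in_targets_from\<close>)

lemma is_seed_iff: "is_seed F n S \<longleftrightarrow>
    is_quiver (snd S) \<and> card (verts (snd S)) = n \<and> free_generating_set F (verts (snd S)) (fst S)"
  by (auto simp: is_seed_def split: prod.splits)

lemma exchange_poly_in_field:
  assumes "is_quiver Q"
  shows "exchange_poly u Q i \<in> field_generated (u ` (verts Q - {i}))"
proof -
  have "h \<in> verts Q - {i}" if "(h, i) \<in># arrows Q \<or> (i, h) \<in># arrows Q" for h
    using that assms unfolding is_quiver_def by fastforce
  then show ?thesis
    unfolding exchange_poly_def
    by (intro is_subfieldD(7)[OF field_generated_subfield] subfield_prod_mset[OF field_generated_subfield])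
       (use field_generated_superset[of "u ` (verts Q - {i})"] in
         \<open>auto simp: in_sources_into in_targets_from image_subset_iff\<close>)
qed

text \<open>
  A quiver without 2-cycles has no vertex that is both a source and a target of arrows at \<open>i\<close>, so the
  two exchange monomials are coprime and \<open>exchange_polynomial\<close> applies.
\<close>

lemma exchange_poly_facts:
  assumes "is_seed F n (u, Q)" "dual_derivations F (verts Q) u D" "i \<in> verts Q"
  shows "exchange_poly u Q i \<noteq> 0"
    and "(l, i) \<in># arrows Q \<or> (i, l) \<in># arrows Q \<Longrightarrow> D l (exchange_poly u Q i) \<noteq> 0"
proof -
  have Q: "is_quiver Q" and u: "free_generating_set F (verts Q) u"
    using assms by (auto simp: is_seed_iff)
  have "set_mset (sources_into i (arrows Q)) \<subseteq> verts Q" "set_mset (targets_from i (arrows Q)) \<subseteq> verts Q"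
    "set_mset (sources_into i (arrows Q)) \<inter> set_mset (targets_from i (arrows Q)) = {}"
    using Q by (auto simp: in_sources_into in_targets_from is_quiver_def)
  note * = exchange_polynomial_nonzero[OF u assms(2) this]
    exchange_polynomial_derivative[OF u assms(2) this, of l]
  show "exchange_poly u Q i \<noteq> 0" using *(1) by (simp add: exchange_poly_def)
  assume "(l, i) \<in># arrows Q \<or> (i, l) \<in># arrows Q"
  then show "D l (exchange_poly u Q i) \<noteq> 0"
    using *(2) by (auto simp: exchange_poly_def in_sources_into in_targets_from)
qed

lemma exchange_poly_nonzero:
  assumes "is_seed F n (u, Q)" "i \<in> verts Q"
  shows "exchange_poly u Q i \<noteq> 0"
proof -
  have "free_generating_set F (verts Q) u" using assms by (simp add: is_seed_iff)
  then obtain D where "dual_derivations F (verts Q) u D" by (rule free_generating_set_dual)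
  then show ?thesis by (rule exchange_poly_facts(1)[OF assms(1) _ assms(2)])
qed

lemma mutate_is_seed:
  assumes "is_seed F n S" "i \<in> verts (snd S)"
  shows "is_seed F n (mutate_seed i S)"
proof -
  obtain u Q where S: "S = (u, Q)" by fastforce
  show ?thesis
    using assms exchange_poly_nonzero[of F n u Q i] exchange_poly_in_field[of Q u i]
    by (auto simp: S is_seed_iff mutate_seed_eq is_quiver_mutate intro!: free_generating_set_exchange)
qed

lemma mutation_class_invariants:
  assumes "T \<in> mutation_class S" "is_seed F n S"
  shows mutation_class_is_seed: "is_seed F n T"
    and "verts (snd T) = verts (snd S)"
    and "x \<notin> verts (snd S) \<Longrightarrow> fst T x = fst S x"
proof -
  have "is_seed F n T \<and> verts (snd T) = verts (snd S) \<and>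
      (\<forall>x. x \<notin> verts (snd S) \<longrightarrow> fst T x = fst S x)"
    using assms(1)
  proof (induction rule: mutation_class.induct)
    case initial
    then show ?case using assms(2) by simp
  next
    case (mutate T i)
    then show ?case using mutate_is_seed[of F n T i] by (auto simp: fst_mutate_seed)
  qed
  then show "is_seed F n T" "verts (snd T) = verts (snd S)"
    "x \<notin> verts (snd S) \<Longrightarrow> fst T x = fst S x" by auto
qed

lemma mutate_seed_involutive:
  assumes "is_seed F n S" "i \<in> verts (snd S)"
  shows "mutate_seed i (mutate_seed i S) = S"
proof -
  obtain u Q where S: "S = (u, Q)" by fastforce
  have Q: "is_quiver Q" using assms S by (simp add: is_seed_iff)
  obtain D where "dual_derivations F (verts Q) u D" "is_subfield F"
    using assms S free_generating_set_dual by (metis fst_conv is_seed_iff snd_conv)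
  then have ui: "u i \<noteq> 0" using dual_derivations_nonzero assms S by fastforce
  define w where "w = u(i := exchange_poly u Q i / u i)"
  have "sources_into i (arrows (mutate_quiver i Q)) = targets_from i (arrows Q)"
    "targets_from i (arrows (mutate_quiver i Q)) = sources_into i (arrows Q)"
    by (intro multiset_eqI; simp add: count_sources_into count_targets_from count_mutate_quiver[OF Q])+
  then have "exchange_poly w (mutate_quiver i Q) i = exchange_poly w Q i"
    by (simp add: exchange_poly_def add.commute)
  also have "\<dots> = exchange_poly u Q i"
    by (rule exchange_poly_cong) (use Q in \<open>auto simp: w_def is_quiver_def\<close>)
  finally have "exchange_poly w (mutate_quiver i Q) i / w i = u i"
    using ui exchange_poly_nonzero[of F n u Q i] assms S by (simp add: w_def)
  then show ?thesis
    unfolding S mutate_seed_eq w_def[symmetric] mutate_quiver_involutive[OF Q] by (auto simp: w_def)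
qed

lemma seed_iso_iff:
  "seed_iso S T \<longleftrightarrow> (\<exists>\<sigma>. bij_betw \<sigma> (verts (snd S)) (verts (snd T)) \<and>
     (\<forall>j\<in>verts (snd S). fst T (\<sigma> j) = fst S j) \<and>
     arrows (snd T) = image_mset (map_prod \<sigma> \<sigma>) (arrows (snd S)))"
  by (auto simp: seed_iso_def split: prod.splits)

lemma seed_isoI:
  assumes "bij_betw \<sigma> (verts (snd S)) (verts (snd T))"
    "\<And>j. j \<in> verts (snd S) \<Longrightarrow> fst T (\<sigma> j) = fst S j"
    "arrows (snd T) = image_mset (map_prod \<sigma> \<sigma>) (arrows (snd S))"
  shows "seed_iso S T"
  using assms by (auto simp: seed_iso_def split: prod.splits)

lemma seed_iso_refl: "seed_iso S S"
  by (rule seed_isoI[of id]) (auto simp: map_prod.id)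

lemma seed_iso_trans:
  assumes "seed_iso S T" "seed_iso T U"
  shows "seed_iso S U"
proof -
  obtain \<sigma> where \<sigma>: "bij_betw \<sigma> (verts (snd S)) (verts (snd T))"
    "\<And>j. j \<in> verts (snd S) \<Longrightarrow> fst T (\<sigma> j) = fst S j"
    "arrows (snd T) = image_mset (map_prod \<sigma> \<sigma>) (arrows (snd S))"
    using assms(1) by (auto simp: seed_iso_iff)
  obtain \<tau> where \<tau>: "bij_betw \<tau> (verts (snd T)) (verts (snd U))"
    "\<And>j. j \<in> verts (snd T) \<Longrightarrow> fst U (\<tau> j) = fst T j"
    "arrows (snd U) = image_mset (map_prod \<tau> \<tau>) (arrows (snd T))"
    using assms(2) by (auto simp: seed_iso_iff)
  show ?thesis
  proof (rule seed_isoI)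
    show "bij_betw (\<tau> \<circ> \<sigma>) (verts (snd S)) (verts (snd U))" using \<sigma>(1) \<tau>(1) by (rule bij_betw_trans)
    show "fst U ((\<tau> \<circ> \<sigma>) j) = fst S j" if "j \<in> verts (snd S)" for j
      using that \<sigma> \<tau>(2) by (auto dest: bij_betwE)
    show "arrows (snd U) = image_mset (map_prod (\<tau> \<circ> \<sigma>) (\<tau> \<circ> \<sigma>)) (arrows (snd S))"
      by (simp add: \<sigma>(3) \<tau>(3) multiset.map_comp map_prod.comp)
  qed
qed

lemma seed_iso_sym:
  assumes "seed_iso S T" "is_quiver (snd S)" "is_quiver (snd T)"
  shows "seed_iso T S"
proof -
  obtain \<sigma> where \<sigma>: "bij_betw \<sigma> (verts (snd S)) (verts (snd T))"
    "\<And>j. j \<in> verts (snd S) \<Longrightarrow> fst T (\<sigma> j) = fst S j"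
    "arrows (snd T) = image_mset (map_prod \<sigma> \<sigma>) (arrows (snd S))"
    using assms(1) by (auto simp: seed_iso_iff)
  let ?\<tau> = "inv_into (verts (snd S)) \<sigma>"
  have \<tau>: "bij_betw ?\<tau> (verts (snd T)) (verts (snd S))" using \<sigma>(1) by (rule bij_betw_inv_into)
  have inv: "?\<tau> x \<in> verts (snd S)" "\<sigma> (?\<tau> x) = x" if "x \<in> verts (snd T)" for x
    using \<tau> \<sigma>(1) that by (auto dest: bij_betwE simp: bij_betw_inv_into_right)
  show ?thesis
  proof (rule seed_isoI[OF \<tau>])
    show "fst S (?\<tau> j) = fst T j" if "j \<in> verts (snd T)" for j
      using inv[OF that] \<sigma>(2) by metis
    show "arrows (snd S) = image_mset (map_prod ?\<tau> ?\<tau>) (arrows (snd T))"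
      unfolding arrows_image_iff[OF assms(3,2) \<tau>]
      using \<sigma>(3)[unfolded arrows_image_iff[OF assms(2,3) \<sigma>(1)]] inv by metis
  qed
qed

lemma mutate_seed_iso:
  assumes "bij_betw \<sigma> (verts (snd S)) (verts (snd T))"
    "\<And>j. j \<in> verts (snd S) \<Longrightarrow> fst T (\<sigma> j) = fst S j"
    "arrows (snd T) = image_mset (map_prod \<sigma> \<sigma>) (arrows (snd S))"
    and Q: "is_quiver (snd S)" "is_quiver (snd T)" and i: "i \<in> verts (snd S)"
  shows "seed_iso (mutate_seed i S) (mutate_seed (\<sigma> i) T)"
proof (rule seed_isoI[of \<sigma>])
  show "bij_betw \<sigma> (verts (snd (mutate_seed i S))) (verts (snd (mutate_seed (\<sigma> i) T)))"
    using assms(1) by simp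
  show "arrows (snd (mutate_seed (\<sigma> i) T)) = image_mset (map_prod \<sigma> \<sigma>) (arrows (snd (mutate_seed i S)))"
    using mutate_quiver_iso[OF Q assms(1,3) i] by simp
  have inj: "\<sigma> a = \<sigma> i \<longleftrightarrow> a = i" if "a \<in> verts (snd S)" for a
    using assms(1) i that by (auto simp: bij_betw_def inj_on_eq_iff)
  have "sources_into (\<sigma> i) (image_mset (map_prod \<sigma> \<sigma>) A) = image_mset \<sigma> (sources_into i A) \<and>
      targets_from (\<sigma> i) (image_mset (map_prod \<sigma> \<sigma>) A) = image_mset \<sigma> (targets_from i A)"
    if "set_mset A \<subseteq> verts (snd S) \<times> verts (snd S)" for A
    using that by (induction A) (auto simp: sources_into_def targets_from_def inj)
  then have ST: "sources_into (\<sigma> i) (arrows (snd T)) = image_mset \<sigma> (sources_into i (arrows (snd S)))"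
    "targets_from (\<sigma> i) (arrows (snd T)) = image_mset \<sigma> (targets_from i (arrows (snd S)))"
    using is_quiverD(2)[OF Q(1)] assms(3) by simp_all
  have "exchange_poly (fst T) (snd T) (\<sigma> i) = exchange_poly (fst T \<circ> \<sigma>) (snd S) i"
    by (simp add: exchange_poly_def ST multiset.map_comp comp_def)
  also have "\<dots> = exchange_poly (fst S) (snd S) i"
    by (rule exchange_poly_cong) (use is_quiverD(2)[OF Q(1)] assms(2) in auto)
  finally show "fst (mutate_seed (\<sigma> i) T) (\<sigma> j) = fst (mutate_seed i S) j"
    if "j \<in> verts (snd (mutate_seed i S))" for j
    using that assms(2) inj i by (simp add: fst_mutate_seed)
qed

text \<open>
  Adjacency in the exchange graph.  It is symmetric up to isomorphism because mutation is an
  involution, so a single direction is enough.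
\<close>

definition adjacent_seeds :: "('v, 'f::field) seed \<Rightarrow> ('v, 'f) seed \<Rightarrow> bool" where
  "adjacent_seeds S T \<longleftrightarrow> (\<exists>i\<in>verts (snd S). seed_iso (mutate_seed i S) T)"

lemma adjacent_seeds_iso:
  assumes "adjacent_seeds S T" "seed_iso S S'" "seed_iso T T'" "is_quiver (snd S)" "is_quiver (snd S')"
  shows "adjacent_seeds S' T'"
proof -
  obtain \<sigma> where \<sigma>: "bij_betw \<sigma> (verts (snd S)) (verts (snd S'))"
    "\<And>j. j \<in> verts (snd S) \<Longrightarrow> fst S' (\<sigma> j) = fst S j"
    "arrows (snd S') = image_mset (map_prod \<sigma> \<sigma>) (arrows (snd S))"
    using assms(2) by (auto simp: seed_iso_iff)
  obtain i where i: "i \<in> verts (snd S)" "seed_iso (mutate_seed i S) T"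
    using assms(1) by (auto simp: adjacent_seeds_def)
  have "seed_iso (mutate_seed i S) (mutate_seed (\<sigma> i) S')"
    by (rule mutate_seed_iso[OF \<sigma> assms(4,5) i(1)])
  then have "seed_iso (mutate_seed (\<sigma> i) S') (mutate_seed i S)"
    using assms(4,5) by (auto intro!: seed_iso_sym is_quiver_mutate)
  then have "seed_iso (mutate_seed (\<sigma> i) S') T'"
    using i(2) assms(3) seed_iso_trans by blast
  moreover have "\<sigma> i \<in> verts (snd S')" using \<sigma>(1) i(1) by (auto dest: bij_betwE)
  ultimately show ?thesis by (auto simp: adjacent_seeds_def)
qed

lemma adjacent_seeds_sym:
  assumes "adjacent_seeds S T" "is_seed F n S" "is_quiver (snd T)"
  shows "adjacent_seeds T S"
proof -
  obtain i where i: "i \<in> verts (snd S)" "seed_iso (mutate_seed i S) T"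
    using assms(1) by (auto simp: adjacent_seeds_def)
  have "adjacent_seeds (mutate_seed i S) S"
    unfolding adjacent_seeds_def
    using i(1) by (intro bexI[of _ i]) (simp_all add: mutate_seed_involutive[OF assms(2)] seed_iso_refl)
  then show ?thesis
    by (rule adjacent_seeds_iso[OF _ i(2) seed_iso_refl _ assms(3)])
       (use assms(2) in \<open>auto simp: is_seed_iff is_quiver_mutate\<close>)
qed

text \<open>
  Exchange graphs have no loops: mutation at \<open>i\<close> yields a variable \<open>N / u i\<close> that does not occur among
  the \<open>u k\<close>.  Its derivative with respect to \<open>u i\<close> is \<open>- N / (u i * u i)\<close>, which is neither 0 nor, if
  \<open>N / u i = u i\<close>, equal to 1.
\<close>

lemma adjacent_seeds_not_iso:
  fixes S T :: "('v, 'f::field_char_0) seed"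
  assumes S: "is_seed F n S" and T: "is_quiver (snd T)" and "adjacent_seeds S T"
  shows "\<not> seed_iso S T"
proof
  assume iso: "seed_iso S T"
  obtain u Q where uQ: "S = (u, Q)" by fastforce
  obtain i where i: "i \<in> verts Q" "seed_iso (mutate_seed i S) T"
    using assms(3) uQ by (auto simp: adjacent_seeds_def)
  have Q: "is_quiver Q" and u: "free_generating_set F (verts Q) u" using S uQ by (auto simp: is_seed_iff)
  have "seed_iso T S" using seed_iso_sym[OF iso _ T] Q uQ by simp
  then have "seed_iso (mutate_seed i S) S" by (rule seed_iso_trans[OF i(2)])
  then obtain \<sigma> where \<sigma>: "bij_betw \<sigma> (verts Q) (verts Q)"
    "\<And>j. j \<in> verts Q \<Longrightarrow> u (\<sigma> j) = fst (mutate_seed i S) j"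
    by (auto simp: seed_iso_iff uQ)
  have k: "\<sigma> i \<in> verts Q" using \<sigma>(1) i by (auto dest: bij_betwE)
  let ?N = "exchange_poly u Q i"
  obtain D where D: "dual_derivations F (verts Q) u D" and F: "is_subfield F" "u ` verts Q \<subseteq> F"
    using free_generating_set_dual[OF u] by metis
  note d = derivative_of_exchange[OF u D i(1) exchange_poly_in_field[OF Q]]
  have eq: "u (\<sigma> i) = ?N / u i" using \<sigma>(2)[OF i(1)] uQ by (simp add: fst_mutate_seed)
  have N: "?N \<noteq> 0" using exchange_poly_nonzero[of F n u Q i] S uQ i by simp
  have "D i (u (\<sigma> i)) = (if \<sigma> i = i then 1 else 0)"
    using D k i(1) by (simp add: dual_derivations_def)
  then have "(if \<sigma> i = i then 1 else 0) = - ?N / (u i * u i)"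
    using d(2) eq by simp
  then have "\<sigma> i = i" and 1: "1 = - ?N / (u i * u i)"
    using N d(4) by (cases "\<sigma> i = i"; simp)+
  then have "?N = u i * u i" using eq d(4) by (simp add: field_simps)
  with 1 have "(1 :: 'f) = - 1" using d(4) by simp
  then show False by simp
qed

section \<open>Exchange graphs and clusters up to isomorphism of seeds\<close>

text \<open>
  The mutation class, the exchange graph and the clusters depend on the initial seed alone, so they
  are treated without reference to the ambient field.
\<close>

definition seed_class :: "('v, 'f::field) seed \<Rightarrow> ('v, 'f) seed \<Rightarrow> ('v, 'f) seed set" where
  "seed_class S T = {T' \<in> mutation_class S. seed_iso T T'}"

definition seed_graph :: "('v, 'f::field) seed \<Rightarrow> ('v, 'f) seed set graph" where
  "seed_graph S =
     (seed_class S ` mutation_class S,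
      {(seed_class S T, seed_class S U) |T U.
         T \<in> mutation_class S \<and> U \<in> mutation_class S \<and> adjacent_seeds T U})"

definition seed_clusters :: "('v, 'f::field) seed \<Rightarrow> 'f set set" where
  "seed_clusters S = (\<lambda>T. fst T ` verts (snd T)) ` mutation_class S"

lemma clusters_cluster_algebra: "clusters (cluster_algebra F S) = seed_clusters S"
  by (simp add: clusters_def clusters_of_def cluster_algebra_def seed_clusters_def case_prod_unfold)

lemma cluster_variables_cluster_algebra:
  "cluster_variables (cluster_algebra F S) = \<Union>(seed_clusters S)"
  by (simp add: cluster_variables_def clusters_cluster_algebra)

lemma mutation_class_is_quiver:
  "T \<in> mutation_class S \<Longrightarrow> is_seed F n S \<Longrightarrow> is_quiver (snd T)"
  using mutation_class_is_seed is_seed_iff by blast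

lemma seed_class_eq_iff:
  assumes S: "is_seed F n S" and "T \<in> mutation_class S" "U \<in> mutation_class S"
  shows "seed_class S T = seed_class S U \<longleftrightarrow> seed_iso T U"
proof
  assume "seed_class S T = seed_class S U"
  then have "U \<in> seed_class S T" using assms(3) seed_iso_refl by (simp add: seed_class_def)
  then show "seed_iso T U" by (simp add: seed_class_def)
next
  assume "seed_iso T U"
  moreover from this have "seed_iso U T"
    using seed_iso_sym mutation_class_is_quiver[OF _ S] assms(2,3) by blast
  ultimately show "seed_class S T = seed_class S U"
    unfolding seed_class_def using seed_iso_trans by blast
qed

lemma seed_graph_edge:
  assumes S: "is_seed F n S" and T: "T \<in> mutation_class S" and U: "U \<in> mutation_class S"
  shows "(seed_class S T, seed_class S U) \<in> snd (seed_graph S) \<longleftrightarrow> adjacent_seeds T U"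
proof
  assume "(seed_class S T, seed_class S U) \<in> snd (seed_graph S)"
  then obtain T' U' where *: "seed_class S T = seed_class S T'" "seed_class S U = seed_class S U'"
    "T' \<in> mutation_class S" "U' \<in> mutation_class S" "adjacent_seeds T' U'"
    by (auto simp: seed_graph_def)
  then have "seed_iso T' T" "seed_iso U' U"
    using seed_class_eq_iff[OF S] T U by metis+
  then show "adjacent_seeds T U"
    using adjacent_seeds_iso[OF *(5)] mutation_class_is_quiver[OF _ S] T *(3) by blast
next
  assume "adjacent_seeds T U"
  then show "(seed_class S T, seed_class S U) \<in> snd (seed_graph S)"
    using T U unfolding seed_graph_def snd_conv by blast
qed

lemma exchange_graph_cluster_algebra:
  assumes S: "is_seed F n S"
  shows "exchange_graph (cluster_algebra F' S) = seed_graph S"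
proof -
  let ?M = "mutation_class S" and ?A = "cluster_algebra F' S"
  have seeds: "seeds ?A = ?M" by (simp add: cluster_algebra_def)
  have classes: "seed_classes ?A = seed_class S ` ?M"
    unfolding seed_classes_def seeds quotient_def seed_class_def by auto
  have quiver: "is_quiver (snd T)" if "T \<in> ?M" for T using mutation_class_is_quiver[OF that S] .
  have "(\<exists>T'\<in>seed_class S T. \<exists>U'\<in>seed_class S U. one_mutation T' U' \<or> one_mutation U' T')
      \<longleftrightarrow> adjacent_seeds T U" (is "?L \<longleftrightarrow> _") if TU: "T \<in> ?M" "U \<in> ?M" for T U
  proof
    assume ?L
    then obtain T' U' where T': "T' \<in> ?M" "seed_iso T T'" and U': "U' \<in> ?M" "seed_iso U U'"
      and "one_mutation T' U' \<or> one_mutation U' T'" by (auto simp: seed_class_def)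
    then have "adjacent_seeds T' U' \<or> adjacent_seeds U' T'"
      unfolding one_mutation_def adjacent_seeds_def using seed_iso_refl by metis
    then have "adjacent_seeds T' U'"
      using adjacent_seeds_sym mutation_class_is_seed[OF U'(1) S] quiver[OF T'(1)] by blast
    moreover have "seed_iso T' T" "seed_iso U' U"
      using seed_iso_sym[OF T'(2)] seed_iso_sym[OF U'(2)] quiver TU T' U' by auto
    ultimately show "adjacent_seeds T U"
      using adjacent_seeds_iso quiver T'(1) TU(1) by blast
  next
    assume "adjacent_seeds T U"
    then obtain i where i: "i \<in> verts (snd T)" "seed_iso (mutate_seed i T) U"
      by (auto simp: adjacent_seeds_def)
    then have mem: "mutate_seed i T \<in> ?M" using TU(1) by (auto intro: mutation_class.mutate)
    moreover have "seed_iso U (mutate_seed i T)"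
      by (rule seed_iso_sym[OF i(2) quiver[OF mem] quiver[OF TU(2)]])
    moreover have "one_mutation T (mutate_seed i T)" using i(1) by (auto simp: one_mutation_def)
    ultimately show ?L
      using TU(1) seed_iso_refl[of T] unfolding seed_class_def by blast
  qed
  then show ?thesis
    unfolding exchange_graph_def classes seed_graph_def by (auto simp: image_iff) metis+
qed

lemma unistructural_cluster_algebra_iff:
  assumes S: "is_seed F n (S :: ('v, 'f::field_char_0) seed)"
  shows "unistructural (cluster_algebra F S) \<longleftrightarrow>
    (\<forall>T :: ('v, 'f) seed. is_seed F n T \<and> \<Union>(seed_clusters T) = \<Union>(seed_clusters S) \<longrightarrow>
       graph_isomorphic (seed_graph S) (seed_graph T) \<and> seed_clusters S = seed_clusters T)"
proof -
  have "rank (cluster_algebra F S) = n" "ambient (cluster_algebra F S) = F"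
    using S by (simp_all add: cluster_algebra_def is_seed_iff)
  then show ?thesis
    unfolding unistructural_def cluster_variables_cluster_algebra clusters_cluster_algebra
    using exchange_graph_cluster_algebra[OF S] exchange_graph_cluster_algebra by metis
qed

text \<open>
  For local finiteness it matters that adjacency does not depend on representatives: every neighbour
  of the class of \<open>T\<close> is the class of a mutation of \<open>T\<close> itself, and \<open>T\<close> has finitely many vertices.
\<close>

lemma seed_graph_connected:
  assumes S: "is_seed F n S"
  shows "connected_graph (seed_graph S)"
  unfolding connected_graph_def
proof (intro conjI ballI)
  let ?M = "mutation_class S" and ?G = "seed_graph S"
  note edge = seed_graph_edge[OF S] and quiver = mutation_class_is_quiver[OF _ S]
    and seed = mutation_class_is_seed[OF _ S]
  show "snd ?G \<subseteq> fst ?G \<times> fst ?G" by (auto simp: seed_graph_def)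
  show sym: "sym (snd ?G)"
  proof (rule symI)
    fix C D assume "(C, D) \<in> snd ?G"
    then obtain T U where *: "C = seed_class S T" "D = seed_class S U" "T \<in> ?M" "U \<in> ?M"
      "adjacent_seeds T U" by (auto simp: seed_graph_def)
    then have "adjacent_seeds U T" using adjacent_seeds_sym seed quiver by blast
    then show "(D, C) \<in> snd ?G" using * unfolding seed_graph_def snd_conv by blast
  qed
  show "irrefl (snd ?G)"
  proof (rule irreflI)
    fix C show "(C, C) \<notin> snd ?G"
    proof
      assume "(C, C) \<in> snd ?G"
      then obtain T U where *: "seed_class S T = seed_class S U" "T \<in> ?M" "U \<in> ?M"
        "adjacent_seeds T U" by (auto simp: seed_graph_def)
      then have "seed_iso T U" using seed_class_eq_iff[OF S] by blast
      then show False using adjacent_seeds_not_iso seed quiver * by blast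
    qed
  qed
  have reach: "(seed_class S S, seed_class S T) \<in> (snd ?G)\<^sup>*" if "T \<in> ?M" for T
    using that
  proof (induction rule: mutation_class.induct)
    case (mutate T i)
    have "adjacent_seeds T (mutate_seed i T)"
      using mutate.hyps(2) seed_iso_refl unfolding adjacent_seeds_def by blast
    then have "(seed_class S T, seed_class S (mutate_seed i T)) \<in> snd ?G"
      using edge[OF mutate.hyps(1) mutation_class.mutate[OF mutate.hyps]] by blast
    then show ?case by (rule rtrancl_into_rtrancl[OF mutate.IH])
  qed simp
  have symr: "sym ((snd ?G)\<^sup>*)" using sym by (rule sym_rtrancl)
  fix C assume "C \<in> fst ?G"
  then obtain T where T: "C = seed_class S T" "T \<in> ?M" by (auto simp: seed_graph_def)
  have "snd ?G `` {C} \<subseteq> (\<lambda>i. seed_class S (mutate_seed i T)) ` verts (snd T)"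
  proof
    fix D assume "D \<in> snd ?G `` {C}"
    then have "(C, D) \<in> snd ?G" by simp
    moreover from this obtain U where U: "D = seed_class S U" "U \<in> ?M"
      unfolding seed_graph_def snd_conv by blast
    ultimately have "adjacent_seeds T U" using edge[OF T(2) U(2)] T(1) by simp
    then obtain i where i: "i \<in> verts (snd T)" "seed_iso (mutate_seed i T) U"
      by (auto simp: adjacent_seeds_def)
    then have "D = seed_class S (mutate_seed i T)"
      using seed_class_eq_iff[OF S] U T(2) mutation_class.mutate by metis
    then show "D \<in> (\<lambda>i. seed_class S (mutate_seed i T)) ` verts (snd T)" using i(1) by blast
  qed
  then show "finite (snd ?G `` {C})"
    using is_quiverD(1)[OF quiver[OF T(2)]] finite_surj by blast
  fix D assume "D \<in> fst ?G"
  then obtain U where U: "D = seed_class S U" "U \<in> ?M" by (auto simp: seed_graph_def)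
  show "(C, D) \<in> (snd ?G)\<^sup>*"
    using reach[OF T(2)] reach[OF U(2)] symr unfolding T(1) U(1)
    by (meson rtrancl_trans symD)
qed

lemma seed_graph_nonempty: "fst (seed_graph S) \<noteq> {}"
  using mutation_class.initial[of S] unfolding seed_graph_def fst_conv by blast

text \<open>
  Two graphs are isomorphic if their vertices are labelled by one set such that the same labels are
  identified and the same labels are joined by an edge.
\<close>

lemma graph_isomorphic_by_labelling:
  assumes G: "fst G = \<kappa> ` M" and H: "fst H = \<mu> ` M"
    and eq: "\<And>x y. x \<in> M \<Longrightarrow> y \<in> M \<Longrightarrow> \<kappa> x = \<kappa> y \<longleftrightarrow> \<mu> x = \<mu> y"
    and edge: "\<And>x y. x \<in> M \<Longrightarrow> y \<in> M \<Longrightarrow> (\<kappa> x, \<kappa> y) \<in> snd G \<longleftrightarrow> (\<mu> x, \<mu> y) \<in> snd H"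
  shows "graph_isomorphic G H"
proof -
  define f where "f C = \<mu> (inv_into M \<kappa> C)" for C
  have f: "f (\<kappa> x) = \<mu> x" if "x \<in> M" for x
  proof -
    have "inv_into M \<kappa> (\<kappa> x) \<in> M" "\<kappa> (inv_into M \<kappa> (\<kappa> x)) = \<kappa> x"
      using that by (auto intro: inv_into_into f_inv_into_f)
    then show ?thesis using eq that by (simp add: f_def)
  qed
  have "bij_betw f (fst G) (fst H)"
    unfolding bij_betw_def G H using f eq by (force simp: inj_on_def image_iff)
  moreover have "\<forall>x\<in>fst G. \<forall>y\<in>fst G. (x, y) \<in> snd G \<longleftrightarrow> (f x, f y) \<in> snd H"
    unfolding G using f edge by auto
  ultimately show ?thesis unfolding graph_isomorphic_def by blast
qed

lemma seed_iso_mutation_class: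
  assumes T: "T \<in> mutation_class S" and S: "is_seed F n S" "is_quiver (snd S')" and iso: "seed_iso S S'"
  shows "\<exists>T'\<in>mutation_class S'. seed_iso T T' \<and> is_quiver (snd T')"
  using T
proof (induction rule: mutation_class.induct)
  case initial
  then show ?case using iso S(2) mutation_class.initial by blast
next
  case (mutate T i)
  then obtain T' where T': "T' \<in> mutation_class S'" "seed_iso T T'" "is_quiver (snd T')" by blast
  have q: "is_quiver (snd T)" using mutation_class_is_quiver[OF mutate.hyps(1) S(1)] .
  obtain \<sigma> where \<sigma>: "bij_betw \<sigma> (verts (snd T)) (verts (snd T'))"
    "\<And>j. j \<in> verts (snd T) \<Longrightarrow> fst T' (\<sigma> j) = fst T j"
    "arrows (snd T') = image_mset (map_prod \<sigma> \<sigma>) (arrows (snd T))"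
    using T'(2) by (auto simp: seed_iso_iff)
  have "seed_iso (mutate_seed i T) (mutate_seed (\<sigma> i) T')"
    by (rule mutate_seed_iso[OF \<sigma> q T'(3) mutate.hyps(2)])
  moreover have "mutate_seed (\<sigma> i) T' \<in> mutation_class S'"
    using T'(1) \<sigma>(1) mutate.hyps(2) by (auto intro!: mutation_class.mutate dest: bij_betwE)
  moreover have "is_quiver (snd (mutate_seed (\<sigma> i) T'))" using T'(3) by (simp add: is_quiver_mutate)
  ultimately show ?case by blast
qed

lemma seed_iso_is_seed:
  assumes S: "is_seed F n S" and S': "is_quiver (snd S')" and iso: "seed_iso S S'"
  shows "is_seed F n S'"
proof -
  obtain \<sigma> where \<sigma>: "bij_betw \<sigma> (verts (snd S)) (verts (snd S'))"
    "\<And>j. j \<in> verts (snd S) \<Longrightarrow> fst S' (\<sigma> j) = fst S j"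
    using iso by (auto simp: seed_iso_iff)
  let ?V = "verts (snd S)" and ?V' = "verts (snd S')"
  obtain D where D: "dual_derivations F ?V (fst S) D" and F: "F = field_generated (fst S ` ?V)"
    using S free_generating_set_dual unfolding is_seed_iff by metis
  have V': "?V' = \<sigma> ` ?V" and inj: "inj_on \<sigma> ?V" using \<sigma>(1) by (auto simp: bij_betw_def)
  have img: "fst S' ` ?V' = fst S ` ?V" unfolding V' image_image using \<sigma>(2) by auto
  have "dual_derivations F ?V' (fst S') (\<lambda>k. D (inv_into ?V \<sigma> k))"
    using D \<sigma>(2) inj unfolding V' dual_derivations_def by (auto simp: inj_on_eq_iff)
  then have "free_generating_set F ?V' (fst S')"
    by (rule free_generating_setI) (simp add: img F)
  moreover have "card ?V' = card ?V" using bij_betw_same_card[OF \<sigma>(1)] by simp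
  ultimately show ?thesis using S S' by (simp add: is_seed_iff)
qed

lemma seed_iso_cluster: "seed_iso S T \<Longrightarrow> fst S ` verts (snd S) = fst T ` verts (snd T)"
  unfolding seed_iso_iff bij_betw_def by (metis (no_types, lifting) image_cong image_image)

text \<open>
  Isomorphic seeds remain isomorphic when they are mutated at corresponding vertices.  Therefore
  relabelling a seed, or changing its tuple outside the vertices, affects neither the clusters nor
  the exchange graph.
\<close>

theorem seed_iso_invariance:
  assumes S: "is_seed F n S" and S': "is_quiver (snd S')" and iso: "seed_iso S S'"
  shows "seed_clusters S = seed_clusters S'" and "graph_isomorphic (seed_graph S) (seed_graph S')"
proof -
  let ?M = "mutation_class S" and ?M' = "mutation_class S'"
  have seed': "is_seed F n S'" by (rule seed_iso_is_seed[OF assms])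
  have qS: "is_quiver (snd S)" using S by (simp add: is_seed_iff)
  have iso': "seed_iso S' S" by (rule seed_iso_sym[OF iso qS S'])
  have match: "\<exists>T'\<in>?M'. seed_iso T T'" if "T \<in> ?M" for T
    using seed_iso_mutation_class[OF that S S' iso] by blast
  have match': "\<exists>T\<in>?M. seed_iso T' T" if "T' \<in> ?M'" for T'
    using seed_iso_mutation_class[OF that seed' qS iso'] by blast
  show "seed_clusters S = seed_clusters S'"
  proof (intro equalityI subsetI)
    fix c assume "c \<in> seed_clusters S"
    then obtain T where T: "c = fst T ` verts (snd T)" "T \<in> ?M" by (auto simp: seed_clusters_def)
    then obtain T' where "T' \<in> ?M'" "seed_iso T T'" using match by blast
    then show "c \<in> seed_clusters S'" unfolding T seed_clusters_def using seed_iso_cluster by blast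
  next
    fix c assume "c \<in> seed_clusters S'"
    then obtain T where T: "c = fst T ` verts (snd T)" "T \<in> ?M'" by (auto simp: seed_clusters_def)
    then obtain T' where "T' \<in> ?M" "seed_iso T T'" using match' by blast
    then show "c \<in> seed_clusters S" unfolding T seed_clusters_def using seed_iso_cluster by blast
  qed
  define \<Phi> where "\<Phi> T = (SOME T'. T' \<in> ?M' \<and> seed_iso T T')" for T
  have \<Phi>: "\<Phi> T \<in> ?M'" "seed_iso T (\<Phi> T)" if "T \<in> ?M" for T
    using someI_ex[of "\<lambda>T'. T' \<in> ?M' \<and> seed_iso T T'"] match[OF that] unfolding \<Phi>_def by auto
  note q = mutation_class_is_quiver[OF _ S] and q' = mutation_class_is_quiver[OF _ seed']
  have \<Phi>': "seed_iso (\<Phi> T) T" if "T \<in> ?M" for T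
    using seed_iso_sym[OF \<Phi>(2)[OF that] q[OF that] q'[OF \<Phi>(1)[OF that]]] .
  show "graph_isomorphic (seed_graph S) (seed_graph S')"
  proof (rule graph_isomorphic_by_labelling[of _ "seed_class S" ?M _ "\<lambda>T. seed_class S' (\<Phi> T)"])
    show "fst (seed_graph S) = seed_class S ` ?M" by (simp add: seed_graph_def)
    show "fst (seed_graph S') = (\<lambda>T. seed_class S' (\<Phi> T)) ` ?M"
    proof (intro equalityI subsetI)
      fix C assume "C \<in> fst (seed_graph S')"
      then obtain T' where T': "C = seed_class S' T'" "T' \<in> ?M'" by (auto simp: seed_graph_def)
      then obtain T where T: "T \<in> ?M" "seed_iso T' T" using match' by blast
      then have "seed_iso T' (\<Phi> T)" using \<Phi> seed_iso_trans by blast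
      then have "C = seed_class S' (\<Phi> T)"
        using seed_class_eq_iff[OF seed'] T' \<Phi>(1)[OF T(1)] by blast
      then show "C \<in> (\<lambda>T. seed_class S' (\<Phi> T)) ` ?M" using T by blast
    qed (use \<Phi> in \<open>auto simp: seed_graph_def\<close>)
    fix T U assume TU: "T \<in> ?M" "U \<in> ?M"
    show "seed_class S T = seed_class S U \<longleftrightarrow> seed_class S' (\<Phi> T) = seed_class S' (\<Phi> U)"
      unfolding seed_class_eq_iff[OF S TU] seed_class_eq_iff[OF seed' \<Phi>(1)[OF TU(1)] \<Phi>(1)[OF TU(2)]]
      using \<Phi>(2) \<Phi>' TU seed_iso_trans by metis
    show "(seed_class S T, seed_class S U) \<in> snd (seed_graph S) \<longleftrightarrow>
        (seed_class S' (\<Phi> T), seed_class S' (\<Phi> U)) \<in> snd (seed_graph S')"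
      unfolding seed_graph_edge[OF S TU] seed_graph_edge[OF seed' \<Phi>(1)[OF TU(1)] \<Phi>(1)[OF TU(2)]]
      using adjacent_seeds_iso \<Phi>[OF TU(1)] \<Phi>[OF TU(2)] \<Phi>'[OF TU(1)] \<Phi>'[OF TU(2)]
        q[OF TU(1)] q'[OF \<Phi>(1)[OF TU(1)]] by blast
  qed
qed

corollary unistructural_seed_iso:
  fixes S S' :: "('v, 'f::field_char_0) seed"
  assumes S: "is_seed F n S" and S': "is_quiver (snd S')" and iso: "seed_iso S S'"
  shows "unistructural (cluster_algebra F S) \<longleftrightarrow> unistructural (cluster_algebra F S')"
proof -
  have seed': "is_seed F n S'" by (rule seed_iso_is_seed[OF assms])
  note inv = seed_iso_invariance[OF assms]
  have "graph_isomorphic (seed_graph S) (seed_graph T) \<longleftrightarrow> graph_isomorphic (seed_graph S') (seed_graph T)"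
    for T :: "('v, 'f) seed"
    using inv(2) graph_isomorphic_trans graph_isomorphic_sym by blast
  then show ?thesis
    unfolding unistructural_cluster_algebra_iff[OF S] unistructural_cluster_algebra_iff[OF seed'] inv(1)
    by blast
qed

section \<open>Disjoint unions of two quivers\<close>

definition union_quiver :: "'v quiver \<Rightarrow> 'v quiver \<Rightarrow> 'v quiver" where
  "union_quiver Q R = Quiver (verts Q \<union> verts R) (arrows Q + arrows R)"

text \<open>
  Outside both vertex sets the tuple is that of \<open>T\<close>.  For seeds obtained by mutation from \<open>(u, Q)\<close> and
  \<open>(u, R)\<close> this is the value of \<open>u\<close>, which makes joining commute with mutation on the nose.
\<close>

definition join_seed :: "('v, 'f) seed \<Rightarrow> ('v, 'f) seed \<Rightarrow> ('v, 'f) seed" where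
  "join_seed S T = ((\<lambda>x. if x \<in> verts (snd S) then fst S x else fst T x), union_quiver (snd S) (snd T))"

definition two_blocks :: "'f::field_char_0 set \<Rightarrow> ('v \<Rightarrow> 'f) \<Rightarrow> 'v quiver \<Rightarrow> 'v quiver \<Rightarrow> bool" where
  "two_blocks F u Q R \<longleftrightarrow> is_quiver Q \<and> is_quiver R \<and> verts Q \<inter> verts R = {} \<and>
     free_generating_set F (verts Q \<union> verts R) u"

lemma verts_union_quiver [simp]: "verts (union_quiver Q R) = verts Q \<union> verts R"
  and arrows_union_quiver [simp]: "arrows (union_quiver Q R) = arrows Q + arrows R"
  by (simp_all add: union_quiver_def)

lemma union_quiver_commute: "union_quiver Q R = union_quiver R Q"
  by (simp add: union_quiver_def Un_commute add.commute)

lemma is_quiver_union: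
  assumes Q: "is_quiver Q" and R: "is_quiver R" and disj: "verts Q \<inter> verts R = {}"
  shows "is_quiver (union_quiver Q R)"
proof (rule is_quiverI)
  fix a b
  have "count (arrows Q) (a, b) = 0 \<and> count (arrows Q) (b, a) = 0 \<or>
      count (arrows R) (a, b) = 0 \<and> count (arrows R) (b, a) = 0"
    using is_quiverD(5)[OF Q] is_quiverD(5)[OF R] disj by blast
  then show "count (arrows (union_quiver Q R)) (a, b) = 0 \<or> count (arrows (union_quiver Q R)) (b, a) = 0"
    using is_quiverD(4)[OF Q, of a b] is_quiverD(4)[OF R, of a b] by (elim disjE) simp_all
qed (use is_quiverD[OF Q] is_quiverD[OF R] in auto)

lemma mutate_union_quiver:
  assumes Q: "is_quiver Q" and R: "is_quiver R" and disj: "verts Q \<inter> verts R = {}"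
    and i: "i \<in> verts Q"
  shows "mutate_quiver i (union_quiver Q R) = union_quiver (mutate_quiver i Q) R"
proof (rule quiver_eqI)
  fix a b
  have iR: "i \<notin> verts R" using i disj by auto
  have R0: "count (arrows R) (x, i) = 0" "count (arrows R) (i, x) = 0" for x
    using is_quiverD(5)[OF R] iR by auto
  have *: "count (arrows R) (a, b) = 0 \<and> count (arrows R) (b, a) = 0 \<or>
      (\<forall>x. count (arrows Q) (a, x) = 0 \<and> count (arrows Q) (x, a) = 0 \<and>
           count (arrows Q) (b, x) = 0 \<and> count (arrows Q) (x, b) = 0)"
    using is_quiverD(5)[OF Q] is_quiverD(5)[OF R] disj by blast
  show "count (arrows (mutate_quiver i (union_quiver Q R))) (a, b) =
      count (arrows (union_quiver (mutate_quiver i Q) R)) (a, b)"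
    using * is_quiverD(4)[OF R, of a b]
    by (auto simp: count_mutate_quiver[OF is_quiver_union[OF Q R disj]] count_mutate_quiver[OF Q] R0
        simp del: count_eq_zero_iff)
qed simp

lemma mutate_join_seed:
  assumes Q: "is_quiver (snd S)" "is_quiver (snd T)" and disj: "verts (snd S) \<inter> verts (snd T) = {}"
  shows "i \<in> verts (snd S) \<Longrightarrow> mutate_seed i (join_seed S T) = join_seed (mutate_seed i S) T"
    and "i \<in> verts (snd T) \<Longrightarrow> mutate_seed i (join_seed S T) = join_seed S (mutate_seed i T)"
proof -
  have S: "x \<in> verts (snd S) \<and> y \<in> verts (snd S)" if "(x, y) \<in># arrows (snd S)" for x y
    using is_quiverD(2)[OF Q(1)] that by auto
  have T: "x \<in> verts (snd T) \<and> y \<in> verts (snd T)" if "(x, y) \<in># arrows (snd T)" for x y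
    using is_quiverD(2)[OF Q(2)] that by auto
  have empty: "sources_into i (arrows R) = {#}" "targets_from i (arrows R) = {#}"
    if "is_quiver R" "i \<notin> verts R" for i R
    using is_quiverD(2)[OF that(1)] that(2) by (auto simp: multiset_eq_iff count_sources_into
        count_targets_from count_eq_zero_iff)
  have add: "sources_into i (A + B) = sources_into i A + sources_into i B"
    "targets_from i (A + B) = targets_from i A + targets_from i B" for i and A B :: "('a \<times> 'a) multiset"
    by (simp_all add: sources_into_def targets_from_def)
  { assume i: "i \<in> verts (snd S)"
    then have iT: "i \<notin> verts (snd T)" using disj by auto
    have "exchange_poly (fst (join_seed S T)) (union_quiver (snd S) (snd T)) i =
        exchange_poly (fst (join_seed S T)) (snd S) i"
      by (simp add: exchange_poly_def add empty[OF Q(2) iT])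
    also have "\<dots> = exchange_poly (fst S) (snd S) i"
      by (rule exchange_poly_cong) (use S in \<open>auto simp: join_seed_def\<close>)
    finally show "mutate_seed i (join_seed S T) = join_seed (mutate_seed i S) T"
      using i mutate_union_quiver[OF Q disj i]
      by (intro prod_eqI ext) (auto simp: fst_mutate_seed join_seed_def) }
  { assume i: "i \<in> verts (snd T)"
    then have iS: "i \<notin> verts (snd S)" using disj by auto
    have disj': "verts (snd T) \<inter> verts (snd S) = {}" using disj by auto
    have "exchange_poly (fst (join_seed S T)) (union_quiver (snd S) (snd T)) i =
        exchange_poly (fst (join_seed S T)) (snd T) i"
      by (simp add: exchange_poly_def add empty[OF Q(1) iS])
    also have "\<dots> = exchange_poly (fst T) (snd T) i"
      by (rule exchange_poly_cong) (use T disj in \<open>auto simp: join_seed_def\<close>)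
    finally show "mutate_seed i (join_seed S T) = join_seed S (mutate_seed i T)"
      using i iS mutate_union_quiver[OF Q(2,1) disj' i]
      by (intro prod_eqI ext) (auto simp: fst_mutate_seed join_seed_def union_quiver_commute[of "snd S"]) }
qed

lemma two_blocks_swap: "two_blocks F u Q R \<Longrightarrow> two_blocks F u R Q"
  by (auto simp: two_blocks_def Un_commute)

context
  fixes F :: "'f::field_char_0 set" and u :: "'v \<Rightarrow> 'f" and Q R :: "'v quiver"
  assumes blocks: "two_blocks F u Q R"
begin

lemma blocks_facts:
  "is_quiver Q" "is_quiver R" "verts Q \<inter> verts R = {}" "finite (verts Q)" "finite (verts R)"
  "free_generating_set F (verts Q \<union> verts R) u"
  using blocks by (auto simp: two_blocks_def is_quiver_def)

lemma two_blocks_is_seed: "is_seed F (card (verts Q \<union> verts R)) (u, union_quiver Q R)"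
  using blocks_facts is_quiver_union by (auto simp: is_seed_iff)

lemma left_block_is_seed: "is_seed (field_generated (u ` verts Q)) (card (verts Q)) (u, Q)"
  using blocks_facts free_generating_set_subset[OF blocks_facts(6)] by (auto simp: is_seed_iff)

end

lemmas right_block_is_seed = left_block_is_seed[OF two_blocks_swap]

context
  fixes F :: "'f::field_char_0 set" and u :: "'v \<Rightarrow> 'f" and Q R :: "'v quiver"
  assumes blocks: "two_blocks F u Q R"
begin

lemma block_classes:
  "T \<in> mutation_class (u, Q) \<Longrightarrow> is_quiver (snd T) \<and> verts (snd T) = verts Q \<and>
     (\<forall>x. x \<notin> verts Q \<longrightarrow> fst T x = u x)"
  "T \<in> mutation_class (u, R) \<Longrightarrow> is_quiver (snd T) \<and> verts (snd T) = verts R \<and>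
     (\<forall>x. x \<notin> verts R \<longrightarrow> fst T x = u x)"
  using mutation_class_invariants[OF _ left_block_is_seed[OF blocks]]
    mutation_class_invariants[OF _ right_block_is_seed[OF blocks]]
    mutation_class_is_quiver[OF _ left_block_is_seed[OF blocks]]
    mutation_class_is_quiver[OF _ right_block_is_seed[OF blocks]]
  by (metis fst_conv snd_conv)+

lemma block_class_quiver:
  "T \<in> mutation_class (u, Q) \<Longrightarrow> is_quiver (snd T)" "T \<in> mutation_class (u, Q) \<Longrightarrow> verts (snd T) = verts Q"
  "U \<in> mutation_class (u, R) \<Longrightarrow> is_quiver (snd U)" "U \<in> mutation_class (u, R) \<Longrightarrow> verts (snd U) = verts R"
  using block_classes by blast+

lemma join_seed_initial: "join_seed (u, Q) (u, R) = (u, union_quiver Q R)"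
  by (auto simp: join_seed_def)

lemma mutate_join_block:
  assumes "T \<in> mutation_class (u, Q)" "U \<in> mutation_class (u, R)"
  shows "i \<in> verts Q \<Longrightarrow> mutate_seed i (join_seed T U) = join_seed (mutate_seed i T) U"
    and "i \<in> verts R \<Longrightarrow> mutate_seed i (join_seed T U) = join_seed T (mutate_seed i U)"
  using mutate_join_seed[of T U i] block_class_quiver assms blocks_facts(3)[OF blocks] by simp_all

lemma mutation_class_union:
  "mutation_class (u, union_quiver Q R) =
     {join_seed T U |T U. T \<in> mutation_class (u, Q) \<and> U \<in> mutation_class (u, R)}"
proof (intro equalityI subsetI)
  fix S assume "S \<in> mutation_class (u, union_quiver Q R)"
  then show "S \<in> {join_seed T U |T U. T \<in> mutation_class (u, Q) \<and> U \<in> mutation_class (u, R)}"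
  proof (induction rule: mutation_class.induct)
    case initial
    then show ?case using join_seed_initial mutation_class.initial by (metis (mono_tags, lifting) mem_Collect_eq)
  next
    case (mutate S i)
    then obtain T U where TU: "S = join_seed T U" "T \<in> mutation_class (u, Q)" "U \<in> mutation_class (u, R)"
      by blast
    then have "i \<in> verts Q \<or> i \<in> verts R"
      using mutate.hyps(2) block_class_quiver by (simp add: join_seed_def)
    then show ?case
    proof
      assume i: "i \<in> verts Q"
      then have "mutate_seed i T \<in> mutation_class (u, Q)"
        using mutation_class.mutate[OF TU(2), of i] block_class_quiver(2)[OF TU(2)] by simp
      then show ?thesis unfolding TU(1) mutate_join_block(1)[OF TU(2,3) i] using TU by blast
    next
      assume i: "i \<in> verts R"
      then have "mutate_seed i U \<in> mutation_class (u, R)"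
        using mutation_class.mutate[OF TU(3), of i] block_class_quiver(4)[OF TU(3)] by simp
      then show ?thesis unfolding TU(1) mutate_join_block(2)[OF TU(2,3) i] using TU by blast
    qed
  qed
next
  let ?M = "mutation_class (u, union_quiver Q R)"
  fix S assume "S \<in> {join_seed T U |T U. T \<in> mutation_class (u, Q) \<and> U \<in> mutation_class (u, R)}"
  then obtain T U where TU: "S = join_seed T U" "T \<in> mutation_class (u, Q)" "U \<in> mutation_class (u, R)"
    by blast
  have verts: "verts (snd (join_seed T U)) = verts (snd T) \<union> verts (snd U)" for T U :: "('v, 'f) seed"
    by (simp add: join_seed_def)
  have base: "join_seed T (u, R) \<in> ?M"
    using TU(2)
  proof (induction rule: mutation_class.induct)
    case initial
    then show ?case using join_seed_initial mutation_class.initial by metis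
  next
    case (mutate T i)
    have "i \<in> verts Q" using mutate.hyps block_class_quiver(2) by blast
    then have "mutate_seed i (join_seed T (u, R)) = join_seed (mutate_seed i T) (u, R)"
      using mutate_join_block(1)[OF mutate.hyps(1) mutation_class.initial] by blast
    moreover have "mutate_seed i (join_seed T (u, R)) \<in> ?M"
      using mutate by (intro mutation_class.mutate) (auto simp: verts)
    ultimately show ?case by simp
  qed
  have "join_seed T U \<in> ?M"
    using TU(3)
  proof (induction rule: mutation_class.induct)
    case initial
    show ?case by (rule base)
  next
    case (mutate U i)
    have "i \<in> verts R" using mutate.hyps block_class_quiver(4) by blast
    then have "mutate_seed i (join_seed T U) = join_seed T (mutate_seed i U)"
      using mutate_join_block(2)[OF TU(2) mutate.hyps(1)] by blast
    moreover have "mutate_seed i (join_seed T U) \<in> ?M"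
      using mutate by (intro mutation_class.mutate) (auto simp: verts)
    ultimately show ?case by simp
  qed
  then show "S \<in> ?M" using TU(1) by simp
qed

lemma cluster_of_join:
  assumes "T \<in> mutation_class (u, Q)" "U \<in> mutation_class (u, R)"
  shows "fst (join_seed T U) ` verts (snd (join_seed T U)) = fst T ` verts (snd T) \<union> fst U ` verts (snd U)"
proof -
  have disj: "verts (snd T) \<inter> verts (snd U) = {}"
    using block_class_quiver assms blocks_facts(3)[OF blocks] by simp
  have "fst (join_seed T U) ` verts (snd T) = fst T ` verts (snd T)"
    by (rule image_cong) (auto simp: join_seed_def)
  moreover have "fst (join_seed T U) ` verts (snd U) = fst U ` verts (snd U)"
    by (rule image_cong) (use disj in \<open>auto simp: join_seed_def\<close>)
  moreover have "verts (snd (join_seed T U)) = verts (snd T) \<union> verts (snd U)"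
    by (simp add: join_seed_def)
  ultimately show ?thesis by (simp add: image_Un)
qed

lemma seed_clusters_union:
  "seed_clusters (u, union_quiver Q R) =
     {c \<union> d |c d. c \<in> seed_clusters (u, Q) \<and> d \<in> seed_clusters (u, R)}"
proof (intro equalityI subsetI)
  fix c assume "c \<in> seed_clusters (u, union_quiver Q R)"
  then obtain T U where "c = fst (join_seed T U) ` verts (snd (join_seed T U))"
    "T \<in> mutation_class (u, Q)" "U \<in> mutation_class (u, R)"
    unfolding seed_clusters_def mutation_class_union by blast
  then show "c \<in> {c \<union> d |c d. c \<in> seed_clusters (u, Q) \<and> d \<in> seed_clusters (u, R)}"
    using cluster_of_join[of T U] unfolding seed_clusters_def by blast
next
  fix c assume "c \<in> {c \<union> d |c d. c \<in> seed_clusters (u, Q) \<and> d \<in> seed_clusters (u, R)}"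
  then obtain T U where TU: "c = fst T ` verts (snd T) \<union> fst U ` verts (snd U)"
    "T \<in> mutation_class (u, Q)" "U \<in> mutation_class (u, R)"
    unfolding seed_clusters_def by blast
  then have "c = fst (join_seed T U) ` verts (snd (join_seed T U))" using cluster_of_join by simp
  then show "c \<in> seed_clusters (u, union_quiver Q R)"
    unfolding seed_clusters_def mutation_class_union using TU(2,3) by blast
qed

end

lemma seed_clusters_nonempty: "seed_clusters S \<noteq> {}"
  using mutation_class.initial[of S] unfolding seed_clusters_def by blast

lemma cluster_variableI:
  "T \<in> mutation_class S \<Longrightarrow> j \<in> verts (snd T) \<Longrightarrow> fst T j \<in> \<Union>(seed_clusters S)"
  unfolding seed_clusters_def by blast

lemma cluster_variables_in_field:
  assumes S: "is_seed F n S"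
  shows "\<Union>(seed_clusters S) \<subseteq> F"
proof -
  have "fst T ` verts (snd T) \<subseteq> F" if "T \<in> mutation_class S" for T
    using mutation_class_is_seed[OF that S] free_generating_set_dual unfolding is_seed_iff by metis
  then show ?thesis by (auto simp: seed_clusters_def)
qed

lemma cluster_variables_union:
  assumes "two_blocks F u Q R"
  shows "\<Union>(seed_clusters (u, union_quiver Q R)) =
     \<Union>(seed_clusters (u, Q)) \<union> \<Union>(seed_clusters (u, R))"
proof (intro equalityI subsetI)
  fix x assume "x \<in> \<Union>(seed_clusters (u, Q)) \<union> \<Union>(seed_clusters (u, R))"
  moreover obtain c d where "c \<in> seed_clusters (u, Q)" "d \<in> seed_clusters (u, R)"
    using seed_clusters_nonempty by (metis all_not_in_conv)
  ultimately show "x \<in> \<Union>(seed_clusters (u, union_quiver Q R))"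
    unfolding seed_clusters_union[OF assms] by blast
qed (auto simp: seed_clusters_union[OF assms])

text \<open>
  A variable \<open>x\<close> obtained from the right block belongs to a free generating set that also contains the
  initial variables of the left block.  The derivative with respect to \<open>x\<close> kills the left field, but
  not \<open>x\<close>.
\<close>

lemma right_variables_not_in_left_field:
  assumes blocks: "two_blocks F u Q R"
  shows "\<Union>(seed_clusters (u, R)) \<inter> field_generated (u ` verts Q) = {}"
proof (rule ccontr)
  assume "\<not> ?thesis"
  then obtain U j where U: "U \<in> mutation_class (u, R)" and "j \<in> verts (snd U)"
    and x: "fst U j \<in> field_generated (u ` verts Q)"
    unfolding seed_clusters_def by blast
  then have j: "j \<in> verts R" using block_class_quiver(4)[OF blocks] by blast
  note disj = blocks_facts(3)[OF blocks]
  define T where "T = join_seed (u, Q) U"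
  have "T \<in> mutation_class (u, union_quiver Q R)"
    unfolding mutation_class_union[OF blocks] T_def using U mutation_class.initial by blast
  then have T: "is_seed F (card (verts Q \<union> verts R)) T" "verts (snd T) = verts Q \<union> verts R"
    using mutation_class_invariants[OF _ two_blocks_is_seed[OF blocks]] by auto
  then have fgs: "free_generating_set F (verts Q \<union> verts R) (fst T)" by (simp add: is_seed_iff)
  obtain D where D: "dual_derivations F (verts Q \<union> verts R) (fst T) D"
    and F: "F = field_generated (fst T ` (verts Q \<union> verts R))" "is_subfield F"
    using free_generating_set_dual[OF fgs] by metis
  have Tj: "fst T j = fst U j" using j disj by (auto simp: T_def join_seed_def)
  have TQ: "fst T k = u k" if "k \<in> verts Q" for k using that by (simp add: T_def join_seed_def)
  have sub: "field_generated (u ` verts Q) \<subseteq> F"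
    unfolding F(1) using TQ by (intro field_generated_mono) (auto simp: image_Un)
  have "D j (fst U j) = 0"
  proof (rule derivation_vanishes_on_generated[OF F(2) _ sub _ x])
    show "derivation_on F (D j)" using D j by (simp add: dual_derivations_def)
    fix y assume "y \<in> u ` verts Q"
    then obtain k where k: "y = fst T k" "k \<in> verts Q" using TQ by auto
    then have "k \<noteq> j" using j disj by auto
    then show "D j y = 0" using D j k by (simp add: dual_derivations_def)
  qed
  moreover have "D j (fst T j) = 1" using D j by (simp add: dual_derivations_def)
  ultimately show False using Tj by simp
qed

lemma seed_isoI_counts:
  assumes "bij_betw \<sigma> (verts (snd S)) (verts (snd T))" "is_quiver (snd S)" "is_quiver (snd T)"
    "\<And>j. j \<in> verts (snd S) \<Longrightarrow> fst T (\<sigma> j) = fst S j"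
    "\<And>a b. a \<in> verts (snd S) \<Longrightarrow> b \<in> verts (snd S) \<Longrightarrow>
       count (arrows (snd T)) (\<sigma> a, \<sigma> b) = count (arrows (snd S)) (a, b)"
  shows "seed_iso S T"
  using assms arrows_image_iff[OF assms(2,3,1)] by (auto simp: seed_iso_iff)

lemma seed_isoE_counts:
  assumes "seed_iso S T" "is_quiver (snd S)" "is_quiver (snd T)"
  shows "\<exists>\<sigma>. bij_betw \<sigma> (verts (snd S)) (verts (snd T)) \<and>
    (\<forall>j\<in>verts (snd S). fst T (\<sigma> j) = fst S j) \<and>
    (\<forall>a\<in>verts (snd S). \<forall>b\<in>verts (snd S).
       count (arrows (snd T)) (\<sigma> a, \<sigma> b) = count (arrows (snd S)) (a, b))"
proof -
  obtain \<sigma> where \<sigma>: "bij_betw \<sigma> (verts (snd S)) (verts (snd T))"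
    "\<forall>j\<in>verts (snd S). fst T (\<sigma> j) = fst S j"
    "arrows (snd T) = image_mset (map_prod \<sigma> \<sigma>) (arrows (snd S))"
    using assms(1) unfolding seed_iso_iff by blast
  then show ?thesis using arrows_image_iff[OF assms(2,3) \<sigma>(1)] by blast
qed

context
  fixes F :: "'f::field_char_0 set" and u :: "'v \<Rightarrow> 'f" and Q R :: "'v quiver"
  assumes blocks: "two_blocks F u Q R"
begin

text \<open>
  An isomorphism of joined seeds preserves cluster variables, and these determine the block.  Hence it
  maps each block to itself and restricts to isomorphisms of the parts.
\<close>

lemma seed_iso_join_iff:
  assumes T: "T \<in> mutation_class (u, Q)" "T' \<in> mutation_class (u, Q)"
    and U: "U \<in> mutation_class (u, R)" "U' \<in> mutation_class (u, R)"
  shows "seed_iso (join_seed T U) (join_seed T' U') \<longleftrightarrow> seed_iso T T' \<and> seed_iso U U'"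
proof -
  note bc = block_class_quiver[OF blocks]
  note V = bc(2)[OF T(1)] bc(2)[OF T(2)] bc(4)[OF U(1)] bc(4)[OF U(2)]
  note q = bc(1)[OF T(1)] bc(1)[OF T(2)] bc(3)[OF U(1)] bc(3)[OF U(2)]
  note disj = blocks_facts(3)[OF blocks]
  have qj: "is_quiver (snd (join_seed T U))" "is_quiver (snd (join_seed T' U'))"
    using q V disj by (auto simp: join_seed_def intro!: is_quiver_union)
  have cQ: "count (arrows (snd W)) (a, b) = 0"
    if "W = T \<or> W = T'" "a \<in> verts R \<or> b \<in> verts R" for W a b
  proof (rule is_quiverD(5))
    show "is_quiver (snd W)" using that(1) q by auto
    have "verts (snd W) = verts Q" using that(1) V by auto
    then show "a \<notin> verts (snd W) \<or> b \<notin> verts (snd W)" using that(2) disj by auto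
  qed
  have cR: "count (arrows (snd W)) (a, b) = 0"
    if "W = U \<or> W = U'" "a \<in> verts Q \<or> b \<in> verts Q" for W a b
  proof (rule is_quiverD(5))
    show "is_quiver (snd W)" using that(1) q by auto
    have "verts (snd W) = verts R" using that(1) V by auto
    then show "a \<notin> verts (snd W) \<or> b \<notin> verts (snd W)" using that(2) disj by auto
  qed
  show ?thesis
  proof
    assume "seed_iso T T' \<and> seed_iso U U'"
    then obtain \<sigma> \<tau> where
      \<sigma>: "bij_betw \<sigma> (verts Q) (verts Q)" "\<And>j. j \<in> verts Q \<Longrightarrow> fst T' (\<sigma> j) = fst T j"
        "\<And>a b. a \<in> verts Q \<Longrightarrow> b \<in> verts Q \<Longrightarrow>
          count (arrows (snd T')) (\<sigma> a, \<sigma> b) = count (arrows (snd T)) (a, b)" and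
      \<tau>: "bij_betw \<tau> (verts R) (verts R)" "\<And>j. j \<in> verts R \<Longrightarrow> fst U' (\<tau> j) = fst U j"
        "\<And>a b. a \<in> verts R \<Longrightarrow> b \<in> verts R \<Longrightarrow>
          count (arrows (snd U')) (\<tau> a, \<tau> b) = count (arrows (snd U)) (a, b)"
      using seed_isoE_counts[OF _ q(1,2)] seed_isoE_counts[OF _ q(3,4)] V by metis
    define \<rho> where "\<rho> x = (if x \<in> verts Q then \<sigma> x else \<tau> x)" for x
    have \<rho>Q: "\<rho> x = \<sigma> x" "\<rho> x \<in> verts Q" if "x \<in> verts Q" for x
      using that \<sigma>(1) by (auto simp: \<rho>_def dest: bij_betwE)
    have \<rho>R: "\<rho> x = \<tau> x" "\<rho> x \<in> verts R" "\<rho> x \<notin> verts Q" if "x \<in> verts R" for x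
      using that \<tau>(1) disj by (auto simp: \<rho>_def dest: bij_betwE)
    have "bij_betw \<rho> (verts Q) (verts Q)" "bij_betw \<rho> (verts R) (verts R)"
      using \<sigma>(1) \<tau>(1) \<rho>Q(1) \<rho>R(1) by (metis bij_betw_cong)+
    then have bij: "bij_betw \<rho> (verts Q \<union> verts R) (verts Q \<union> verts R)"
      using disj by (rule bij_betw_combine)
    show "seed_iso (join_seed T U) (join_seed T' U')"
    proof (rule seed_isoI_counts[OF _ qj])
      show "bij_betw \<rho> (verts (snd (join_seed T U))) (verts (snd (join_seed T' U')))"
        using bij V by (simp add: join_seed_def)
      show "fst (join_seed T' U') (\<rho> j) = fst (join_seed T U) j"
        if "j \<in> verts (snd (join_seed T U))" for j
        using that V \<rho>Q \<rho>R \<sigma>(2) \<tau>(2) disj by (auto simp: join_seed_def)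
      fix a b assume "a \<in> verts (snd (join_seed T U))" "b \<in> verts (snd (join_seed T U))"
      then have ab: "a \<in> verts Q \<or> a \<in> verts R" "b \<in> verts Q \<or> b \<in> verts R"
        using V by (auto simp: join_seed_def)
      have "count (arrows (snd T')) (\<rho> a, \<rho> b) = count (arrows (snd T)) (a, b)"
        using ab cQ \<rho>Q \<rho>R \<sigma>(3) by metis
      moreover have "count (arrows (snd U')) (\<rho> a, \<rho> b) = count (arrows (snd U)) (a, b)"
        using ab cR \<rho>Q \<rho>R \<tau>(3) by metis
      ultimately show "count (arrows (snd (join_seed T' U'))) (\<rho> a, \<rho> b) =
          count (arrows (snd (join_seed T U))) (a, b)"
        by (simp add: join_seed_def)
    qed
  next
    assume "seed_iso (join_seed T U) (join_seed T' U')"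
    then obtain \<rho> where
      \<rho>: "bij_betw \<rho> (verts Q \<union> verts R) (verts Q \<union> verts R)"
        "\<And>j. j \<in> verts Q \<union> verts R \<Longrightarrow> fst (join_seed T' U') (\<rho> j) = fst (join_seed T U) j"
        "\<And>a b. a \<in> verts Q \<union> verts R \<Longrightarrow> b \<in> verts Q \<union> verts R \<Longrightarrow>
          count (arrows (snd T') + arrows (snd U')) (\<rho> a, \<rho> b) =
          count (arrows (snd T) + arrows (snd U)) (a, b)"
      using seed_isoE_counts[OF _ qj] V by (auto simp: join_seed_def)
    have XQ: "fst W j \<in> field_generated (u ` verts Q)" if "W = T \<or> W = T'" "j \<in> verts Q" for W j
    proof -
      have "W \<in> mutation_class (u, Q)" "j \<in> verts (snd W)" using that T V by auto
      then have "fst W j \<in> \<Union>(seed_clusters (u, Q))" by (rule cluster_variableI)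
      then show ?thesis
        by (rule subsetD[OF cluster_variables_in_field[OF left_block_is_seed[OF blocks]]])
    qed
    have XR: "fst W j \<notin> field_generated (u ` verts Q)" if "W = U \<or> W = U'" "j \<in> verts R" for W j
    proof -
      have "W \<in> mutation_class (u, R)" "j \<in> verts (snd W)" using that U V by auto
      then have "fst W j \<in> \<Union>(seed_clusters (u, R))" by (rule cluster_variableI)
      then show ?thesis using right_variables_not_in_left_field[OF blocks] by (simp add: disjoint_iff)
    qed
    have jQ: "fst (join_seed W W') j = fst W j" if "W = T \<or> W = T'" "j \<in> verts Q" for W W' j
      using that V by (auto simp: join_seed_def)
    have jR: "fst (join_seed W W') j = fst W' j" if "W = T \<or> W = T'" "j \<in> verts R" for W W' j
      using that V disj by (auto simp: join_seed_def)
    have mem: "\<rho> j \<in> verts Q \<union> verts R" if "j \<in> verts Q \<union> verts R" for j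
      using \<rho>(1) that by (rule bij_betw_apply)
    have \<rho>Q: "\<rho> j \<in> verts Q" if j: "j \<in> verts Q" for j
    proof (rule ccontr)
      assume "\<rho> j \<notin> verts Q"
      then have k: "\<rho> j \<in> verts R" using mem[of j] j by blast
      have "fst U' (\<rho> j) = fst T j" using \<rho>(2)[of j] jQ[of T j U] jR[of T' "\<rho> j" U'] j k by simp
      then show False using XQ[of T j] XR[of U' "\<rho> j"] j k by simp
    qed
    have \<rho>R: "\<rho> j \<in> verts R" if j: "j \<in> verts R" for j
    proof (rule ccontr)
      assume "\<rho> j \<notin> verts R"
      then have k: "\<rho> j \<in> verts Q" using mem[of j] j by blast
      have "fst T' (\<rho> j) = fst U j" using \<rho>(2)[of j] jR[of T j U] jQ[of T' "\<rho> j" U'] j k by simp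
      then show False using XQ[of T' "\<rho> j"] XR[of U j] j k by simp
    qed
    have "inj_on \<rho> (verts Q)" "inj_on \<rho> (verts R)"
      using \<rho>(1) by (auto simp: bij_betw_def intro: inj_on_subset)
    moreover have "\<rho> ` verts Q \<subseteq> verts Q" "\<rho> ` verts R \<subseteq> verts R" using \<rho>Q \<rho>R by blast+
    ultimately have bij: "bij_betw \<rho> (verts Q) (verts Q)" "bij_betw \<rho> (verts R) (verts R)"
      using endo_inj_surj blocks_facts(4,5)[OF blocks] by (simp_all add: bij_betw_def)
    have "seed_iso T T'"
    proof (rule seed_isoI_counts[OF _ q(1,2)])
      show "bij_betw \<rho> (verts (snd T)) (verts (snd T'))" using bij V by simp
      show "fst T' (\<rho> j) = fst T j" if "j \<in> verts (snd T)" for j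
        using that V \<rho>(2)[of j] \<rho>Q[of j] jQ[of T j U] jQ[of T' "\<rho> j" U'] by simp
      show "count (arrows (snd T')) (\<rho> a, \<rho> b) = count (arrows (snd T)) (a, b)"
        if "a \<in> verts (snd T)" "b \<in> verts (snd T)" for a b
        using that V \<rho>(3)[of a b] \<rho>Q[of a] cR[of U a b] cR[of U' "\<rho> a" "\<rho> b"] by simp
    qed
    moreover have "seed_iso U U'"
    proof (rule seed_isoI_counts[OF _ q(3,4)])
      show "bij_betw \<rho> (verts (snd U)) (verts (snd U'))" using bij V by simp
      show "fst U' (\<rho> j) = fst U j" if "j \<in> verts (snd U)" for j
        using that V \<rho>(2)[of j] \<rho>R[of j] jR[of T j U] jR[of T' "\<rho> j" U'] by simp
      show "count (arrows (snd U')) (\<rho> a, \<rho> b) = count (arrows (snd U)) (a, b)"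
        if "a \<in> verts (snd U)" "b \<in> verts (snd U)" for a b
        using that V \<rho>(3)[of a b] \<rho>R[of a] cQ[of T a b] cQ[of T' "\<rho> a" "\<rho> b"] by simp
    qed
    ultimately show "seed_iso T T' \<and> seed_iso U U'" by blast
  qed
qed

lemma adjacent_join_iff:
  assumes T: "T \<in> mutation_class (u, Q)" "T' \<in> mutation_class (u, Q)"
    and U: "U \<in> mutation_class (u, R)" "U' \<in> mutation_class (u, R)"
  shows "adjacent_seeds (join_seed T U) (join_seed T' U') \<longleftrightarrow>
    adjacent_seeds T T' \<and> seed_iso U U' \<or> seed_iso T T' \<and> adjacent_seeds U U'"
proof -
  note bc = block_class_quiver[OF blocks]
  have V: "verts (snd T) = verts Q" "verts (snd U) = verts R" using bc T U by auto
  have "verts (snd (join_seed T U)) = verts Q \<union> verts R" by (simp add: join_seed_def V)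
  then have "adjacent_seeds (join_seed T U) (join_seed T' U') \<longleftrightarrow>
      (\<exists>i\<in>verts Q. seed_iso (mutate_seed i (join_seed T U)) (join_seed T' U')) \<or>
      (\<exists>i\<in>verts R. seed_iso (mutate_seed i (join_seed T U)) (join_seed T' U'))"
    unfolding adjacent_seeds_def by blast
  also have "\<dots> \<longleftrightarrow> (\<exists>i\<in>verts Q. seed_iso (mutate_seed i T) T' \<and> seed_iso U U') \<or>
      (\<exists>i\<in>verts R. seed_iso T T' \<and> seed_iso (mutate_seed i U) U')"
  proof (intro arg_cong2[where f = "(\<or>)"] bex_cong refl)
    fix i assume i: "i \<in> verts Q"
    have "mutate_seed i T \<in> mutation_class (u, Q)" using i T(1) V by (auto intro: mutation_class.mutate)
    then show "seed_iso (mutate_seed i (join_seed T U)) (join_seed T' U') \<longleftrightarrow>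
        seed_iso (mutate_seed i T) T' \<and> seed_iso U U'"
      using mutate_join_block(1)[OF blocks T(1) U(1) i] seed_iso_join_iff T(2) U by simp
  next
    fix i assume i: "i \<in> verts R"
    have "mutate_seed i U \<in> mutation_class (u, R)" using i U(1) V by (auto intro: mutation_class.mutate)
    then show "seed_iso (mutate_seed i (join_seed T U)) (join_seed T' U') \<longleftrightarrow>
        seed_iso T T' \<and> seed_iso (mutate_seed i U) U'"
      using mutate_join_block(2)[OF blocks T(1) U(1) i] seed_iso_join_iff T U(2) by simp
  qed
  also have "\<dots> \<longleftrightarrow> adjacent_seeds T T' \<and> seed_iso U U' \<or> seed_iso T T' \<and> adjacent_seeds U U'"
    unfolding adjacent_seeds_def V by blast
  finally show ?thesis .
qed

text \<open>
  Both graphs are labelled by pairs of seeds, one from each block.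
\<close>

theorem seed_graph_union:
  "graph_isomorphic (box_product (seed_graph (u, Q)) (seed_graph (u, R)))
     (seed_graph (u, union_quiver Q R))"
proof (rule graph_isomorphic_by_labelling)
  let ?M = "mutation_class (u, Q) \<times> mutation_class (u, R)"
  let ?S = "(u, union_quiver Q R)"
  let ?\<kappa> = "\<lambda>p. (seed_class (u, Q) (fst p), seed_class (u, R) (snd p))"
  let ?\<mu> = "\<lambda>p. seed_class ?S (join_seed (fst p) (snd p))"
  note sS = two_blocks_is_seed[OF blocks] and sQ = left_block_is_seed[OF blocks]
    and sR = right_block_is_seed[OF blocks]
  show "fst (box_product (seed_graph (u, Q)) (seed_graph (u, R))) = ?\<kappa> ` ?M"
    by (auto simp: box_product_def seed_graph_def image_iff)
  show "fst (seed_graph ?S) = ?\<mu> ` ?M"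
    unfolding seed_graph_def fst_conv mutation_class_union[OF blocks] by (force simp: image_iff)
  fix p q assume "p \<in> ?M" "q \<in> ?M"
  then obtain T U T' U' where pq: "p = (T, U)" "q = (T', U')"
    and T: "T \<in> mutation_class (u, Q)" "T' \<in> mutation_class (u, Q)"
    and U: "U \<in> mutation_class (u, R)" "U' \<in> mutation_class (u, R)" by (cases p, cases q) auto
  have J: "join_seed T U \<in> mutation_class ?S" "join_seed T' U' \<in> mutation_class ?S"
    unfolding mutation_class_union[OF blocks] using T U by blast+
  show "?\<kappa> p = ?\<kappa> q \<longleftrightarrow> ?\<mu> p = ?\<mu> q"
    by (simp add: pq seed_class_eq_iff[OF sQ T] seed_class_eq_iff[OF sR U] seed_class_eq_iff[OF sS J]
        seed_iso_join_iff[OF T U])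
  have V: "seed_class (u, Q) W \<in> fst (seed_graph (u, Q))" if "W \<in> mutation_class (u, Q)" for W
    using that by (auto simp: seed_graph_def)
  have V': "seed_class (u, R) W \<in> fst (seed_graph (u, R))" if "W \<in> mutation_class (u, R)" for W
    using that by (auto simp: seed_graph_def)
  show "(?\<kappa> p, ?\<kappa> q) \<in> snd (box_product (seed_graph (u, Q)) (seed_graph (u, R))) \<longleftrightarrow>
      (?\<mu> p, ?\<mu> q) \<in> snd (seed_graph ?S)"
    by (simp add: pq box_product_def V T V' U seed_graph_edge[OF sQ T] seed_graph_edge[OF sR U]
        seed_graph_edge[OF sS J] adjacent_join_iff[OF T U]
        seed_class_eq_iff[OF sQ T] seed_class_eq_iff[OF sR U])
qed

end

section \<open>Unistructurality of disjoint unions\<close>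

lemma left_clusters:
  assumes blocks: "two_blocks F u Q R"
  shows "seed_clusters (u, Q) =
    (\<lambda>c. c \<inter> field_generated (u ` verts Q)) ` seed_clusters (u, union_quiver Q R)"
proof -
  let ?F = "field_generated (u ` verts Q)"
  have "c \<subseteq> ?F" if "c \<in> seed_clusters (u, Q)" for c
    using cluster_variables_in_field[OF left_block_is_seed[OF blocks]] that by blast
  moreover have "d \<inter> ?F = {}" if "d \<in> seed_clusters (u, R)" for d
    using right_variables_not_in_left_field[OF blocks] that by blast
  ultimately have *: "(c \<union> d) \<inter> ?F = c"
    if "c \<in> seed_clusters (u, Q)" "d \<in> seed_clusters (u, R)" for c d
    using that by blast
  obtain d where d: "d \<in> seed_clusters (u, R)" using seed_clusters_nonempty by blast
  show ?thesis
  proof (intro equalityI subsetI)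
    fix c assume "c \<in> seed_clusters (u, Q)"
    then show "c \<in> (\<lambda>c. c \<inter> ?F) ` seed_clusters (u, union_quiver Q R)"
      unfolding seed_clusters_union[OF blocks] using * d by (intro image_eqI[of _ _ "c \<union> d"]) auto
  next
    fix c assume "c \<in> (\<lambda>c. c \<inter> ?F) ` seed_clusters (u, union_quiver Q R)"
    then obtain c' d' where "c = (c' \<union> d') \<inter> ?F" "c' \<in> seed_clusters (u, Q)" "d' \<in> seed_clusters (u, R)"
      unfolding seed_clusters_union[OF blocks] by blast
    then show "c \<in> seed_clusters (u, Q)" using * by simp
  qed
qed

lemma left_variables:
  assumes blocks: "two_blocks F u Q R"
  shows "\<Union>(seed_clusters (u, Q)) =
    \<Union>(seed_clusters (u, union_quiver Q R)) \<inter> field_generated (u ` verts Q)"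
  unfolding left_clusters[OF blocks] by blast

text \<open>
  A competing seed may have its vertices anywhere in the type, even on the vertices of the other
  block.  Before it is glued to that block it is moved to a prescribed vertex set.
\<close>

lemma relabel_seed:
  assumes q: "is_quiver (snd T)" and V: "finite V" "card V = card (verts (snd T))"
  shows "\<exists>w P. verts P = V \<and> is_quiver P \<and> seed_iso T (w, P) \<and> (\<forall>x. x \<notin> V \<longrightarrow> w x = u x)"
proof -
  let ?W = "verts (snd T)"
  obtain \<sigma> where \<sigma>: "bij_betw \<sigma> ?W V"
    using finite_same_card_bij[OF is_quiverD(1)[OF q] V(1)] V(2) by auto
  define w where "w x = (if x \<in> V then fst T (inv_into ?W \<sigma> x) else u x)" for x
  define P where "P = Quiver V (image_mset (map_prod \<sigma> \<sigma>) (arrows (snd T)))"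
  have inj: "\<sigma> a = \<sigma> b \<longleftrightarrow> a = b" if "a \<in> ?W" "b \<in> ?W" for a b
    using \<sigma> that by (auto simp: bij_betw_def inj_on_eq_iff)
  have arr: "a \<in> ?W \<and> b \<in> ?W" if "(a, b) \<in># arrows (snd T)" for a b
    using is_quiverD(2)[OF q] that by auto
  have "is_quiver P"
    unfolding is_quiver_def
  proof (intro conjI allI impI)
    show "finite (verts P)" by (simp add: P_def V)
    show "set_mset (arrows P) \<subseteq> verts P \<times> verts P"
      using arr \<sigma> by (auto simp: P_def dest: bij_betwE)
    fix x
    show "(x, x) \<notin># arrows P"
    proof
      assume "(x, x) \<in># arrows P"
      then obtain a b where ab: "\<sigma> a = x" "\<sigma> b = x" "(a, b) \<in># arrows (snd T)" by (auto simp: P_def)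
      then have "a = b" using inj[of a b] arr[OF ab(3)] by simp
      then show False using ab(3) q by (simp add: is_quiver_def)
    qed
    fix y assume "(x, y) \<in># arrows P"
    then obtain a b where ab: "\<sigma> a = x" "\<sigma> b = y" "(a, b) \<in># arrows (snd T)" by (auto simp: P_def)
    show "(y, x) \<notin># arrows P"
    proof
      assume "(y, x) \<in># arrows P"
      then obtain c d where cd: "\<sigma> c = y" "\<sigma> d = x" "(c, d) \<in># arrows (snd T)" by (auto simp: P_def)
      then have "c = b" "d = a" using inj[of c b] inj[of d a] ab arr[OF ab(3)] arr[OF cd(3)] by simp_all
      then show False using ab(3) cd(3) q by (auto simp: is_quiver_def)
    qed
  qed
  moreover have "seed_iso T (w, P)"
  proof (rule seed_isoI[of \<sigma>])
    show "bij_betw \<sigma> ?W (verts (snd (w, P)))" using \<sigma> by (simp add: P_def)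
    show "fst (w, P) (\<sigma> j) = fst T j" if "j \<in> ?W" for j
      using that \<sigma> by (simp add: w_def bij_betw_inv_into_left bij_betw_apply)
    show "arrows (snd (w, P)) = image_mset (map_prod \<sigma> \<sigma>) (arrows (snd T))" by (simp add: P_def)
  qed
  ultimately show ?thesis
    by (intro exI[of _ w] exI[of _ P]) (auto simp: P_def w_def)
qed

text \<open>
  The competitor \<open>T\<close> is moved to the vertices of \<open>Q\<close> and glued to \<open>(u, R)\<close>.
\<close>

theorem unistructural_left_block:
  fixes u :: "'v \<Rightarrow> 'f::field_char_0"
  assumes blocks: "two_blocks F u Q R"
    and uni: "unistructural (cluster_algebra F (u, union_quiver Q R))"
  shows "unistructural (cluster_algebra (field_generated (u ` verts Q)) (u, Q))"
  unfolding unistructural_cluster_algebra_iff[OF left_block_is_seed[OF blocks]]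
proof (intro allI impI, elim conjE)
  let ?F = "field_generated (u ` verts Q)"
  note facts = blocks_facts[OF blocks]
  fix T :: "('v, 'f) seed"
  assume T: "is_seed ?F (card (verts Q)) T"
    and X: "\<Union>(seed_clusters T) = \<Union>(seed_clusters (u, Q))"
  have "is_quiver (snd T)" "card (verts Q) = card (verts (snd T))" using T by (simp_all add: is_seed_iff)
  then obtain w P where P: "verts P = verts Q" "is_quiver P" and iso: "seed_iso T (w, P)"
    and w: "\<And>x. x \<notin> verts Q \<Longrightarrow> w x = u x"
    using relabel_seed[OF _ facts(4)] by metis
  have q: "is_quiver (snd (w, P))" using P(2) by simp
  have "is_seed ?F (card (verts Q)) (w, P)" by (rule seed_iso_is_seed[OF T q iso])
  then have fw: "free_generating_set ?F (verts Q) w" by (simp add: is_seed_iff P)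
  have "free_generating_set F (verts Q \<union> verts R) w"
    by (rule free_generating_set_replace_block[OF facts(4,3,6) fw]) (use w facts(3) in auto)
  then have blocks': "two_blocks F w P R"
    using P facts by (simp add: two_blocks_def)
  have Fw: "field_generated (w ` verts P) = ?F"
    using fw P(1) by (simp add: free_generating_set_def)
  have TP: "seed_clusters T = seed_clusters (w, P)" "graph_isomorphic (seed_graph T) (seed_graph (w, P))"
    using seed_iso_invariance[OF T q iso] by auto
  have qR: "is_quiver (snd (w, R))" using facts(2) by simp
  have "seed_iso (u, R) (w, R)"
    by (rule seed_isoI[of id]) (use w facts(3) in \<open>auto simp: map_prod.id\<close>)
  note R = seed_iso_invariance[OF right_block_is_seed[OF blocks] qR this]
  have "\<Union>(seed_clusters (w, union_quiver P R)) = \<Union>(seed_clusters (u, union_quiver Q R))"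
    using cluster_variables_union[OF blocks] cluster_variables_union[OF blocks'] X TP(1) R(1) by simp
  moreover have "is_seed F (card (verts Q \<union> verts R)) (w, union_quiver P R)"
    using two_blocks_is_seed[OF blocks'] P(1) by simp
  ultimately have
    G: "graph_isomorphic (seed_graph (u, union_quiver Q R)) (seed_graph (w, union_quiver P R))" and
    C: "seed_clusters (u, union_quiver Q R) = seed_clusters (w, union_quiver P R)"
    using uni unfolding unistructural_cluster_algebra_iff[OF two_blocks_is_seed[OF blocks]] by blast+
  have clusters: "seed_clusters (u, Q) = seed_clusters T"
    unfolding TP(1) left_clusters[OF blocks] left_clusters[OF blocks'] Fw C ..
  have "graph_isomorphic (box_product (seed_graph (u, Q)) (seed_graph (u, R)))
      (box_product (seed_graph (w, P)) (seed_graph (w, R)))"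
    by (rule graph_isomorphic_trans[OF graph_isomorphic_trans[OF seed_graph_union[OF blocks] G]
          graph_isomorphic_sym[OF seed_graph_union[OF blocks']]])
  then have "graph_isomorphic (box_product (seed_graph (u, Q)) (seed_graph (u, R)))
      (box_product (seed_graph (w, P)) (seed_graph (u, R)))"
    by (rule graph_isomorphic_trans[OF _ box_product_cong[OF graph_isomorphic_refl
          graph_isomorphic_sym[OF R(2)]]])
  then have "graph_isomorphic (seed_graph (u, Q)) (seed_graph (w, P))"
    by (rule box_product_cancel[OF seed_graph_connected[OF left_block_is_seed[OF blocks]]
          seed_graph_connected[OF left_block_is_seed[OF blocks']]
          seed_graph_connected[OF right_block_is_seed[OF blocks]]
          seed_graph_nonempty seed_graph_nonempty])
  then have "graph_isomorphic (seed_graph (u, Q)) (seed_graph T)"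
    by (rule graph_isomorphic_trans[OF _ graph_isomorphic_sym[OF TP(2)]])
  then show "graph_isomorphic (seed_graph (u, Q)) (seed_graph T) \<and> seed_clusters (u, Q) = seed_clusters T"
    using clusters by simp
qed

text \<open>
  With \<open>N\<close> the exchange polynomial at \<open>k\<close>, the new variable \<open>N / v k\<close> has a nonzero derivative with respect
  to \<open>v k\<close>, so it lies in the field of \<open>A\<close>, and with it \<open>N\<close>.  An arrow between \<open>k\<close> and \<open>l\<close> would give \<open>N\<close>
  a nonzero derivative with respect to \<open>v l\<close>.
\<close>

lemma no_arrow_between_blocks:
  assumes S: "is_seed F n (v, P)" and V: "verts P = A \<union> B" "A \<inter> B = {}" and k: "k \<in> A" and l: "l \<in> B"
    and x: "exchange_poly v P k / v k \<in> field_generated (v ` A) \<union> field_generated (v ` B)"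
  shows "(l, k) \<notin># arrows P \<and> (k, l) \<notin># arrows P"
proof (rule ccontr)
  assume "\<not> ?thesis"
  then have arrow: "(l, k) \<in># arrows P \<or> (k, l) \<in># arrows P" by blast
  let ?N = "exchange_poly v P k"
  have P: "is_quiver P" and fv: "free_generating_set F (verts P) v" using S by (simp_all add: is_seed_iff)
  obtain D where D: "dual_derivations F (verts P) v D" and F: "F = field_generated (v ` verts P)" "is_subfield F"
    using free_generating_set_dual[OF fv] by metis
  have kP: "k \<in> verts P" and lP: "l \<in> verts P" using k l V by auto
  note d = derivative_of_exchange[OF fv D kP exchange_poly_in_field[OF P]]
  have zero: "D i y = 0" if "i \<in> verts P" "C \<subseteq> verts P" "i \<notin> C" "y \<in> field_generated (v ` C)" for i y C
  proof (rule derivation_vanishes_on_generated[OF F(2) _ _ _ that(4)])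
    show "derivation_on F (D i)" using D that(1) by (simp add: dual_derivations_def)
    show "field_generated (v ` C) \<subseteq> F" unfolding F(1) using that(2) by (intro field_generated_mono) blast
    show "D i z = 0" if "z \<in> v ` C" for z
      using that D \<open>i \<in> verts P\<close> \<open>C \<subseteq> verts P\<close> \<open>i \<notin> C\<close> by (auto simp: dual_derivations_def)
  qed
  have N: "?N \<noteq> 0" by (rule exchange_poly_nonzero[OF S kP])
  have "?N / v k \<notin> field_generated (v ` B)"
  proof
    assume "?N / v k \<in> field_generated (v ` B)"
    then have "D k (?N / v k) = 0" using zero[OF kP, of B] k V by blast
    then show False using d(2,4) N by simp
  qed
  then have "?N / v k \<in> field_generated (v ` A)" using x by blast
  moreover have "v k \<in> field_generated (v ` A)" using k field_generated_superset by blast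
  ultimately have "?N / v k * v k \<in> field_generated (v ` A)"
    by (rule is_subfieldD(5)[OF field_generated_subfield])
  then have "?N \<in> field_generated (v ` A)" using d(4) by simp
  then have "D l ?N = 0" using zero[OF lP, of A] l V by blast
  then show False using exchange_poly_facts(2)[OF S D kP arrow] by simp
qed

text \<open>
  The vertices of a competing seed are sorted by the field that contains their variable; by
  \<open>no_arrow_between_blocks\<close> its quiver is the disjoint union of the two parts.
\<close>

theorem unistructural_union:
  fixes u :: "'v \<Rightarrow> 'f::field_char_0"
  assumes blocks: "two_blocks F u Q R"
    and uQ: "unistructural (cluster_algebra (field_generated (u ` verts Q)) (u, Q))"
    and uR: "unistructural (cluster_algebra (field_generated (u ` verts R)) (u, R))"
  shows "unistructural (cluster_algebra F (u, union_quiver Q R))"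
  unfolding unistructural_cluster_algebra_iff[OF two_blocks_is_seed[OF blocks]]
proof (intro allI impI, elim conjE)
  let ?F = "field_generated (u ` verts Q)" and ?E = "field_generated (u ` verts R)"
  note facts = blocks_facts[OF blocks]
  fix T :: "('v, 'f) seed"
  assume T: "is_seed F (card (verts Q \<union> verts R)) T"
    and X: "\<Union>(seed_clusters T) = \<Union>(seed_clusters (u, union_quiver Q R))"
  obtain v P where vP: "T = (v, P)" by fastforce
  have P: "is_quiver P" and fv: "free_generating_set F (verts P) v" using T vP by (simp_all add: is_seed_iff)
  define A where "A = {k \<in> verts P. v k \<in> ?F}"
  define B where "B = verts P - A"
  have AB: "verts P = A \<union> B" "A \<inter> B = {}" by (auto simp: A_def B_def)
  have fin: "finite A" "finite B" using is_quiverD(1)[OF P] by (auto simp: A_def B_def)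
  have XFE: "\<Union>(seed_clusters T) \<subseteq> ?F \<union> ?E"
    unfolding X cluster_variables_union[OF blocks]
    using cluster_variables_in_field[OF left_block_is_seed[OF blocks]]
      cluster_variables_in_field[OF right_block_is_seed[OF blocks]] by blast
  have vX: "v k \<in> \<Union>(seed_clusters T)" if "k \<in> verts P" for k
    using cluster_variableI[OF mutation_class.initial, of k T] that vP by simp
  have vA: "v ` A \<subseteq> ?F" by (auto simp: A_def)
  have vB: "v ` B \<subseteq> ?E"
  proof
    fix x assume "x \<in> v ` B"
    then obtain k where "x = v k" "k \<in> verts P" "v k \<notin> ?F" by (auto simp: A_def B_def)
    then show "x \<in> ?E" using vX[of k] XFE by blast
  qed
  have fv': "free_generating_set F (A \<union> B) v" using fv AB by simp
  have FA: "field_generated (v ` A) = ?F"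
    by (rule block_fields_eq[OF facts(4,5) fin facts(3) AB(2) facts(6) fv' vA vB])
  have FB: "field_generated (v ` B) = ?E"
  proof (rule block_fields_eq[OF facts(5,4) fin(2,1) _ _ _ _ vB vA])
    show "verts R \<inter> verts Q = {}" "B \<inter> A = {}" using facts(3) AB by auto
    show "free_generating_set F (verts R \<union> verts Q) u" "free_generating_set F (B \<union> A) v"
      using facts(6) fv' by (simp_all add: Un_commute)
  qed
  have exch: "exchange_poly v P k / v k \<in> ?F \<union> ?E" if k: "k \<in> verts P" for k
  proof -
    have "mutate_seed k T \<in> mutation_class T" "k \<in> verts (snd (mutate_seed k T))"
      using mutation_class.mutate[OF mutation_class.initial, of k T] k vP by auto
    then have "fst (mutate_seed k T) k \<in> \<Union>(seed_clusters T)" by (rule cluster_variableI)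
    then show ?thesis using XFE vP by (auto simp: fst_mutate_seed)
  qed
  have cross: "(l, k) \<notin># arrows P \<and> (k, l) \<notin># arrows P" if "k \<in> A" "l \<in> B" for k l
    using no_arrow_between_blocks[OF _ AB that, of F "card (verts Q \<union> verts R)" v] T vP
      exch[of k] that(1) AB(1) by (simp add: FA FB)
  define PA where "PA = Quiver A (filter_mset (\<lambda>(a, b). a \<in> A \<and> b \<in> A) (arrows P))"
  define PB where "PB = Quiver B (filter_mset (\<lambda>(a, b). a \<in> B \<and> b \<in> B) (arrows P))"
  have V: "verts PA = A" "verts PB = B" by (simp_all add: PA_def PB_def)
  have split: "union_quiver PA PB = P"
  proof (rule quiver_eqI)
    fix a b
    show "count (arrows (union_quiver PA PB)) (a, b) = count (arrows P) (a, b)"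
    proof (cases "(a, b) \<in># arrows P")
      case True
      then have "a \<in> A \<union> B" "b \<in> A \<union> B" using is_quiverD(2)[OF P] AB by auto
      then have "a \<in> A \<and> b \<in> A \<and> a \<notin> B \<or> a \<in> B \<and> b \<in> B \<and> a \<notin> A"
        using True cross AB(2) by blast
      then show ?thesis by (auto simp: PA_def PB_def)
    next
      case False
      then show ?thesis by (simp add: PA_def PB_def count_eq_zero_iff)
    qed
  qed (simp add: V AB)
  have "is_quiver PA" "is_quiver PB"
    using P fin by (auto simp: is_quiver_def PA_def PB_def)
  then have blocks': "two_blocks F v PA PB"
    using fv' AB by (simp add: two_blocks_def V)
  have blocks'': "two_blocks F v PB PA" by (rule two_blocks_swap[OF blocks'])
  have "card A = card (verts Q)"
    by (rule free_generating_sets_same_card[OF fin(1) facts(4)])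
       (use free_generating_set_subset[OF fv', of A] free_generating_set_subset[OF facts(6), of "verts Q"] FA
         in auto)
  then have sA: "is_seed ?F (card (verts Q)) (v, PA)"
    using left_block_is_seed[OF blocks'] by (simp add: V FA)
  have "card B = card (verts R)"
    by (rule free_generating_sets_same_card[OF fin(2) facts(5)])
       (use free_generating_set_subset[OF fv', of B] free_generating_set_subset[OF facts(6), of "verts R"] FB
         in auto)
  then have sB: "is_seed ?E (card (verts R)) (v, PB)"
    using right_block_is_seed[OF blocks'] by (simp add: V FB)
  have X': "\<Union>(seed_clusters (v, union_quiver PA PB)) = \<Union>(seed_clusters (u, union_quiver Q R))"
    using X by (simp add: vP split)
  have "\<Union>(seed_clusters (v, PA)) = \<Union>(seed_clusters (u, Q))"
    using X' by (simp add: left_variables[OF blocks] left_variables[OF blocks'] V FA)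
  then have Q: "graph_isomorphic (seed_graph (u, Q)) (seed_graph (v, PA))"
      "seed_clusters (u, Q) = seed_clusters (v, PA)"
    using uQ sA unfolding unistructural_cluster_algebra_iff[OF left_block_is_seed[OF blocks]] by blast+
  have "\<Union>(seed_clusters (v, PB)) = \<Union>(seed_clusters (u, R))"
    using X' by (simp add: left_variables[OF two_blocks_swap[OF blocks]] left_variables[OF blocks''] V FB
        union_quiver_commute[of R] union_quiver_commute[of PB])
  then have R: "graph_isomorphic (seed_graph (u, R)) (seed_graph (v, PB))"
      "seed_clusters (u, R) = seed_clusters (v, PB)"
    using uR sB unfolding unistructural_cluster_algebra_iff[OF right_block_is_seed[OF blocks]] by blast+
  have "graph_isomorphic (seed_graph (u, union_quiver Q R)) (seed_graph (v, union_quiver PA PB))"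
    by (rule graph_isomorphic_trans[OF graph_isomorphic_trans[OF
          graph_isomorphic_sym[OF seed_graph_union[OF blocks]] box_product_cong[OF Q(1) R(1)]]
          seed_graph_union[OF blocks']])
  moreover have "seed_clusters (u, union_quiver Q R) = seed_clusters (v, union_quiver PA PB)"
    unfolding seed_clusters_union[OF blocks] seed_clusters_union[OF blocks'] Q(2) R(2) ..
  ultimately show "graph_isomorphic (seed_graph (u, union_quiver Q R)) (seed_graph T) \<and>
      seed_clusters (u, union_quiver Q R) = seed_clusters T"
    by (simp add: vP split)
qed

corollary unistructural_union_iff:
  fixes u :: "'v \<Rightarrow> 'f::field_char_0"
  assumes "two_blocks F u Q R"
  shows "unistructural (cluster_algebra F (u, union_quiver Q R)) \<longleftrightarrow>
    unistructural (cluster_algebra (field_generated (u ` verts Q)) (u, Q)) \<and>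
    unistructural (cluster_algebra (field_generated (u ` verts R)) (u, R))"
  using unistructural_union[OF assms] unistructural_left_block[OF assms]
    unistructural_left_block[OF two_blocks_swap[OF assms]] union_quiver_commute[of R Q]
  by auto

lemma unistructural_blocks:
  fixes u :: "'v \<Rightarrow> 'f::field_char_0" and Qs :: "nat \<Rightarrow> 'v quiver"
  assumes "1 \<le> m" and quiver: "\<And>i. i \<in> {1..m} \<Longrightarrow> is_quiver (Qs i)"
    and disj: "\<And>i j. i \<in> {1..m} \<Longrightarrow> j \<in> {1..m} \<Longrightarrow> i \<noteq> j \<Longrightarrow> verts (Qs i) \<inter> verts (Qs j) = {}"
    and "Q = Quiver (\<Union>i\<in>{1..m}. verts (Qs i)) (\<Sum>i\<in>{1..m}. arrows (Qs i))"
    and "free_generating_set F (verts Q) u"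
  shows "is_quiver Q \<and> (unistructural (cluster_algebra F (u, Q)) \<longleftrightarrow>
    (\<forall>i\<in>{1..m}. unistructural (cluster_algebra (field_generated (u ` verts (Qs i))) (u, Qs i))))"
  using assms
proof (induction m arbitrary: Q F rule: nat_induct_at_least)
  case base
  have "Q = Qs 1" using base.prems(3) by (cases "Qs 1") simp
  moreover from this have "F = field_generated (u ` verts (Qs 1))"
    using base.prems(4) by (simp add: free_generating_set_def)
  ultimately show ?case using base.prems(1)[of 1] by simp
next
  case (Suc m)
  define Q' where "Q' = Quiver (\<Union>i\<in>{1..m}. verts (Qs i)) (\<Sum>i\<in>{1..m}. arrows (Qs i))"
  have range: "{1..Suc m} = insert (Suc m) {1..m}" by auto
  have Q: "Q = union_quiver Q' (Qs (Suc m))"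
    unfolding Suc.prems(3) Q'_def range by (simp add: union_quiver_def Un_commute add.commute)
  have "free_generating_set F (verts Q' \<union> verts (Qs (Suc m))) u"
    using Suc.prems(4) by (simp add: Q)
  then have "free_generating_set (field_generated (u ` verts Q')) (verts Q') u"
    by (rule free_generating_set_subset) simp
  then have IH: "is_quiver Q'" "unistructural (cluster_algebra (field_generated (u ` verts Q')) (u, Q')) \<longleftrightarrow>
      (\<forall>i\<in>{1..m}. unistructural (cluster_algebra (field_generated (u ` verts (Qs i))) (u, Qs i)))"
    using Suc.IH[OF _ _ Q'_def] Suc.prems(1,2) by auto
  have "verts (Qs i) \<inter> verts (Qs (Suc m)) = {}" if "i \<in> {1..m}" for i
    using Suc.prems(2)[of i "Suc m"] that by simp
  then have "verts Q' \<inter> verts (Qs (Suc m)) = {}"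
    unfolding Q'_def quiver.sel by blast
  then have blocks: "two_blocks F u Q' (Qs (Suc m))"
    using IH(1) Suc.prems(1)[of "Suc m"] Suc.prems(4) by (simp add: two_blocks_def Q)
  have "is_quiver Q"
    using two_blocks_is_seed[OF blocks] by (simp add: is_seed_iff Q)
  then show ?case
    unfolding Q unistructural_union_iff[OF blocks] IH(2) range by auto
qed

theorem proposition2p14:
  fixes F :: "'f::field_char_0 set"
    and u :: "'v \<Rightarrow> 'f"
    and Q :: "'v quiver"
    and us :: "nat \<Rightarrow> 'v \<Rightarrow> 'f"
    and Qs :: "nat \<Rightarrow> 'v quiver"
    and n r :: nat
  assumes "r \<ge> 1"
    and "disjoint_union_of Q {1..r} Qs"
    and "is_seed F n (u, Q)"
    and "\<And>i. i \<in> {1..r} \<Longrightarrow> us i = restrict u (verts (Qs i))"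
  shows "unistructural (cluster_algebra F (u, Q)) \<longleftrightarrow>
         (\<forall>i\<in>{1..r}. unistructural
            (cluster_algebra (field_generated (us i ` verts (Qs i))) (us i, Qs i)))"
proof -
  have fu: "free_generating_set F (verts Q) u" using assms(3) by (simp add: is_seed_iff)
  have quiver: "is_quiver (Qs i)" if "i \<in> {1..r}" for i
    using assms(2) that by (simp add: disjoint_union_of_def)
  have "Q = Quiver (\<Union>i\<in>{1..r}. verts (Qs i)) (\<Sum>i\<in>{1..r}. arrows (Qs i))"
    using assms(2) by (cases Q) (simp add: disjoint_union_of_def)
  then have "unistructural (cluster_algebra F (u, Q)) \<longleftrightarrow>
      (\<forall>i\<in>{1..r}. unistructural (cluster_algebra (field_generated (u ` verts (Qs i))) (u, Qs i)))"
    using unistructural_blocks[of r Qs Q F u] assms(1,2) fu by (simp add: disjoint_union_of_def)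
  also have "\<dots> \<longleftrightarrow> (\<forall>i\<in>{1..r}. unistructural
      (cluster_algebra (field_generated (us i ` verts (Qs i))) (us i, Qs i)))"
  proof (intro ball_cong refl)
    fix i assume i: "i \<in> {1..r}"
    have img: "us i ` verts (Qs i) = u ` verts (Qs i)" using assms(4)[OF i] by auto
    have "verts (Qs i) \<subseteq> verts Q" using assms(2) i by (auto simp: disjoint_union_of_def)
    then have "is_seed (field_generated (u ` verts (Qs i))) (card (verts (Qs i))) (u, Qs i)"
      using free_generating_set_subset[OF fu] quiver[OF i] by (simp add: is_seed_iff)
    moreover have "seed_iso (u, Qs i) (us i, Qs i)"
      by (rule seed_isoI[of id]) (use assms(4)[OF i] in \<open>auto simp: map_prod.id\<close>)
    ultimately show "unistructural (cluster_algebra (field_generated (u ` verts (Qs i))) (u, Qs i)) \<longleftrightarrow>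
        unistructural (cluster_algebra (field_generated (us i ` verts (Qs i))) (us i, Qs i))"
      unfolding img using quiver[OF i] by (intro unistructural_seed_iso) simp_all
  qed
  finally show ?thesis .
qed

end
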